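(* Let $(R,\mathfrak m)$ be a Noetherian local ring of characteristic $p>0$ and let $x$ be a regular element of $R$. Then: (1) If $R/(x)$ is $F$-anti-nilpotent, then so is $R$. (2) If $R/(x)$ is $F$-full, then so is $R$. (3) If $R/(x)$ is $F$-full and $F$-injective, then $R$ is $F$-full and $F$-injective.
   Context: A regular element of $R$ is a nonzerodivisor $x$ of $R$ contained in $\mathfrak m$. Let $(S,\mathfrak n)$ be a Noetherian local ring of characteristic $p>0$ (applied to $S=R$ and $S=R/(x)$). A Frobenius action on an $S$-module $M$ is an additive map $F:M\to M$ with $F(ru)=r^pF(u)$ for all $r\in S$, $u\in M$. A submodule $N\subseteq M$ is $F$-stable if $F(N)\subseteq N$. The action is full if the $S$-span of $\{F^e(u): u\in M\}$ is all of $M$ for some (equivalently, every) $e\ge 1$. The action is anti-nilpotent if for every $F$-stable submodule $N\subseteq M$ the induced Frobenius action on $M/N$ is injective. The Frobenius endomorphism $r\mapsto r^p$ of $S$ induces a natural Frobenius action on each local cohomology module $H^i_{\mathfrak n}(S)$. The ring $S$ is $F$-injective (resp. $F$-full, $F$-anti-nilpotent) if this action on $H^i_{\mathfrak n}(S)$ is injective (resp. full, anti-nilpotent) for every $i\ge 0$. *)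

theory Defs
  imports "HOL-Algebra.Module" "HOL-Algebra.Ring_Divisibility" "HOL-Computational_Algebra.Primes"
begin

section \<open>Noetherian local rings\<close>

locale noetherian_local_ring = cring R + noetherian_ring R for R (structure) and \<mm> +
  assumes maximal: "maximalideal \<mm> R"
    and unique_maximal: "maximalideal I R \<Longrightarrow> I = \<mm>"

definition max_ideal :: "('a, 'b) ring_scheme \<Rightarrow> 'a set"
  where "max_ideal S = (THE \<nn>. maximalideal \<nn> S)"

definition regular_element :: "('a, 'b) ring_scheme \<Rightarrow> 'a set \<Rightarrow> 'a \<Rightarrow> bool"
  where "regular_element R \<mm> x \<longleftrightarrow>
    x \<in> \<mm> \<and> (\<forall>a \<in> carrier R. x \<otimes>\<^bsub>R\<^esub> a = \<zero>\<^bsub>R\<^esub> \<longrightarrow> a = \<zero>\<^bsub>R\<^esub>)"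


section \<open>Modules with a Frobenius action\<close>

text \<open>
  The record of modules extends the record of rings; the fields \<open>mult\<close> and \<open>one\<close>
  carry no information for a module and are left undefined below.  Throughout, \<open>F\<close> stands
  for a Frobenius action on \<open>M\<close>, that is, an additive map with \<open>F (r u) = r\<^sup>p F u\<close>.  If \<open>N\<close>
  is an \<open>F\<close>-stable submodule, then \<open>quot_map M N F\<close> is the action induced on \<open>M / N\<close>;
  it sends \<open>N + u\<close> to \<open>N + F u\<close>, and the union is over equal cosets.
\<close>

definition quot_module :: "('a, 'm, 'c) module_scheme \<Rightarrow> 'm set \<Rightarrow> ('a, 'm set) module"
  where "quot_module M N =
    \<lparr>carrier = a_rcosets\<^bsub>M\<^esub> N, mult = undefined, one = undefined,
     zero = N, ring.add = set_add M,
     smult = (\<lambda>r C. \<Union>u\<in>C. N +>\<^bsub>M\<^esub> (r \<odot>\<^bsub>M\<^esub> u))\<rparr>"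

definition quot_map :: "('a, 'm, 'c) module_scheme \<Rightarrow> 'm set \<Rightarrow> ('m \<Rightarrow> 'm) \<Rightarrow> 'm set \<Rightarrow> 'm set"
  where "quot_map M N F = (\<lambda>C. \<Union>u\<in>C. N +>\<^bsub>M\<^esub> F u)"

definition module_span ::
    "('a, 'b) ring_scheme \<Rightarrow> ('a, 'm, 'c) module_scheme \<Rightarrow> 'm set \<Rightarrow> 'm set"
  where "module_span S M X = \<Inter>{N. submodule N S M \<and> X \<subseteq> N}"

definition injective_action :: "('a, 'm, 'c) module_scheme \<Rightarrow> ('m \<Rightarrow> 'm) \<Rightarrow> bool"
  where "injective_action M F \<longleftrightarrow> inj_on F (carrier M)"

definition full_action ::
    "('a, 'b) ring_scheme \<Rightarrow> ('a, 'm, 'c) module_scheme \<Rightarrow> ('m \<Rightarrow> 'm) \<Rightarrow> bool"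
  where "full_action S M F \<longleftrightarrow>
    (\<exists>e\<ge>1. module_span S M ((F ^^ e) ` carrier M) = carrier M)"

definition F_stable ::
    "('a, 'b) ring_scheme \<Rightarrow> ('a, 'm, 'c) module_scheme \<Rightarrow> ('m \<Rightarrow> 'm) \<Rightarrow> 'm set \<Rightarrow> bool"
  where "F_stable S M F N \<longleftrightarrow> submodule N S M \<and> F ` N \<subseteq> N"

definition anti_nilpotent_action ::
    "('a, 'b) ring_scheme \<Rightarrow> ('a, 'm, 'c) module_scheme \<Rightarrow> ('m \<Rightarrow> 'm) \<Rightarrow> bool"
  where "anti_nilpotent_action S M F \<longleftrightarrow>
    (\<forall>N. F_stable S M F N \<longrightarrow> injective_action (quot_module M N) (quot_map M N F))"


section \<open>Localization at an element\<close>

text \<open>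
  The fraction \<open>a / f\<^sup>n\<close> is the class of the pair \<open>(a, n)\<close>, where \<open>a / f\<^sup>n = b / f\<^sup>m\<close> iff
  \<open>f\<^sup>k (f\<^sup>m a - f\<^sup>n b) = 0\<close> for some \<open>k\<close>.  In the operations and maps on fractions the unions
  run over all representatives, which all yield the same fraction.
\<close>

definition fraction :: "('a, 'b) ring_scheme \<Rightarrow> 'a \<Rightarrow> 'a \<Rightarrow> nat \<Rightarrow> ('a \<times> nat) set"
  where "fraction S f a n = {(b, m). b \<in> carrier S \<and>
    (\<exists>k::nat. f [^]\<^bsub>S\<^esub> (k + m) \<otimes>\<^bsub>S\<^esub> a = f [^]\<^bsub>S\<^esub> (k + n) \<otimes>\<^bsub>S\<^esub> b)}"

definition localize :: "('a, 'b) ring_scheme \<Rightarrow> 'a \<Rightarrow> ('a, ('a \<times> nat) set) module"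
  where "localize S f =
    \<lparr>carrier = {fraction S f a n | a n. a \<in> carrier S},
     mult = (\<lambda>X Y. \<Union>(a, n)\<in>X. \<Union>(b, m)\<in>Y. fraction S f (a \<otimes>\<^bsub>S\<^esub> b) (n + m)),
     one = fraction S f \<one>\<^bsub>S\<^esub> 0,
     zero = fraction S f \<zero>\<^bsub>S\<^esub> 0,
     add = (\<lambda>X Y. \<Union>(a, n)\<in>X. \<Union>(b, m)\<in>Y.
       fraction S f (f [^]\<^bsub>S\<^esub> m \<otimes>\<^bsub>S\<^esub> a \<oplus>\<^bsub>S\<^esub> f [^]\<^bsub>S\<^esub> n \<otimes>\<^bsub>S\<^esub> b) (n + m)),
     smult = (\<lambda>r X. \<Union>(a, n)\<in>X. fraction S f (r \<otimes>\<^bsub>S\<^esub> a) n)\<rparr>"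

text \<open>The canonical map from the localization at \<open>f\<close> to the localization at \<open>f g\<close>.\<close>

definition localize_map ::
    "('a, 'b) ring_scheme \<Rightarrow> 'a \<Rightarrow> 'a \<Rightarrow> ('a \<times> nat) set \<Rightarrow> ('a \<times> nat) set"
  where "localize_map S f g X =
    (\<Union>(a, n)\<in>X. fraction S (f \<otimes>\<^bsub>S\<^esub> g) (a \<otimes>\<^bsub>S\<^esub> g [^]\<^bsub>S\<^esub> n) n)"

text \<open>The Frobenius endomorphism of the localization at \<open>f\<close>.\<close>

definition localize_frob ::
    "nat \<Rightarrow> ('a, 'b) ring_scheme \<Rightarrow> 'a \<Rightarrow> ('a \<times> nat) set \<Rightarrow> ('a \<times> nat) set"
  where "localize_frob p S f X = (\<Union>(a, n)\<in>X. fraction S f (a [^]\<^bsub>S\<^esub> p) (p * n))"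


section \<open>Local cohomology via the Cech complex\<close>

text \<open>
  For a list \<open>gs = [g\<^sub>0, \<dots>, g\<^sub>t\<^sub>-\<^sub>1]\<close> the Cech complex is in degree \<open>i\<close> the direct sum of the
  localizations of \<open>S\<close> at the products \<open>g\<^sub>J\<close> of the \<open>g\<^sub>j\<close> with \<open>j \<in> J\<close>, over all sets of
  positions \<open>J\<close> of size \<open>i\<close>.
\<close>

definition cech_index :: "'a list \<Rightarrow> nat \<Rightarrow> nat set set"
  where "cech_index gs i = {J. J \<subseteq> {..<length gs} \<and> card J = i}"

definition cech_elem :: "('a, 'b) ring_scheme \<Rightarrow> 'a list \<Rightarrow> nat set \<Rightarrow> 'a"
  where "cech_elem S gs J = (\<Otimes>\<^bsub>S\<^esub>j\<in>J. gs ! j)"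

definition cech ::
    "('a, 'b) ring_scheme \<Rightarrow> 'a list \<Rightarrow> nat \<Rightarrow> ('a, nat set \<Rightarrow> ('a \<times> nat) set) module"
  where "cech S gs i =
    \<lparr>carrier = (\<Pi>\<^sub>E J\<in>cech_index gs i. carrier (localize S (cech_elem S gs J))),
     mult = undefined, one = undefined,
     zero = (\<lambda>J\<in>cech_index gs i. \<zero>\<^bsub>localize S (cech_elem S gs J)\<^esub>),
     add = (\<lambda>c d. \<lambda>J\<in>cech_index gs i. c J \<oplus>\<^bsub>localize S (cech_elem S gs J)\<^esub> d J),
     smult = (\<lambda>r c. \<lambda>J\<in>cech_index gs i. r \<odot>\<^bsub>localize S (cech_elem S gs J)\<^esub> c J)\<rparr>"

text \<open>The sign exponent \<open>card {k \<in> J. k < j}\<close> is the position of \<open>j\<close> in the ordered set \<open>J\<close>.\<close>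

definition cech_diff :: "('a, 'b) ring_scheme \<Rightarrow> 'a list \<Rightarrow> nat
    \<Rightarrow> (nat set \<Rightarrow> ('a \<times> nat) set) \<Rightarrow> (nat set \<Rightarrow> ('a \<times> nat) set)"
  where "cech_diff S gs i c = (\<lambda>J\<in>cech_index gs (Suc i).
    \<Oplus>\<^bsub>localize S (cech_elem S gs J)\<^esub>j\<in>J.
      ((\<ominus>\<^bsub>S\<^esub> \<one>\<^bsub>S\<^esub>) [^]\<^bsub>S\<^esub> card {k \<in> J. k < j})
        \<odot>\<^bsub>localize S (cech_elem S gs J)\<^esub>
          localize_map S (cech_elem S gs (J - {j})) (gs ! j) (c (J - {j})))"

definition cech_cycles ::
    "('a, 'b) ring_scheme \<Rightarrow> 'a list \<Rightarrow> nat \<Rightarrow> (nat set \<Rightarrow> ('a \<times> nat) set) set"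
  where "cech_cycles S gs i =
    {c \<in> carrier (cech S gs i). cech_diff S gs i c = \<zero>\<^bsub>cech S gs (Suc i)\<^esub>}"

definition cech_boundaries ::
    "('a, 'b) ring_scheme \<Rightarrow> 'a list \<Rightarrow> nat \<Rightarrow> (nat set \<Rightarrow> ('a \<times> nat) set) set"
  where "cech_boundaries S gs i =
    (case i of 0 \<Rightarrow> {\<zero>\<^bsub>cech S gs 0\<^esub>}
     | Suc k \<Rightarrow> cech_diff S gs k ` carrier (cech S gs k))"

definition local_cohomology ::
    "('a, 'b) ring_scheme \<Rightarrow> 'a list \<Rightarrow> nat \<Rightarrow> ('a, (nat set \<Rightarrow> ('a \<times> nat) set) set) module"
  where "local_cohomology S gs i =
    quot_module ((cech S gs i)\<lparr>carrier := cech_cycles S gs i\<rparr>) (cech_boundaries S gs i)"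

definition cech_frob :: "nat \<Rightarrow> ('a, 'b) ring_scheme \<Rightarrow> 'a list \<Rightarrow> nat
    \<Rightarrow> (nat set \<Rightarrow> ('a \<times> nat) set) \<Rightarrow> (nat set \<Rightarrow> ('a \<times> nat) set)"
  where "cech_frob p S gs i c =
    (\<lambda>J\<in>cech_index gs i. localize_frob p S (cech_elem S gs J) (c J))"

definition local_cohomology_frob :: "nat \<Rightarrow> ('a, 'b) ring_scheme \<Rightarrow> 'a list \<Rightarrow> nat
    \<Rightarrow> (nat set \<Rightarrow> ('a \<times> nat) set) set \<Rightarrow> (nat set \<Rightarrow> ('a \<times> nat) set) set"
  where "local_cohomology_frob p S gs i =
    quot_map ((cech S gs i)\<lparr>carrier := cech_cycles S gs i\<rparr>) (cech_boundaries S gs i)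
      (cech_frob p S gs i)"


section \<open>Classes of Frobenius singularities\<close>

text \<open>
  Up to an isomorphism compatible with the Frobenius actions, the cohomology of the Cech
  complex does not depend on the generators of the maximal ideal.  The predicates below
  avoid an arbitrary choice of generators by requiring the property for all of them.  They
  are meant for Noetherian local rings, where finite lists of generators exist.
\<close>

definition generates_max_ideal :: "('a, 'b) ring_scheme \<Rightarrow> 'a list \<Rightarrow> bool"
  where "generates_max_ideal S gs \<longleftrightarrow>
    set gs \<subseteq> carrier S \<and> Idl\<^bsub>S\<^esub> (set gs) = max_ideal S"

definition F_injective :: "nat \<Rightarrow> ('a, 'b) ring_scheme \<Rightarrow> bool"
  where "F_injective p S \<longleftrightarrow> (\<forall>gs i. generates_max_ideal S gs \<longrightarrow>
    injective_action (local_cohomology S gs i) (local_cohomology_frob p S gs i))"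

definition F_full :: "nat \<Rightarrow> ('a, 'b) ring_scheme \<Rightarrow> bool"
  where "F_full p S \<longleftrightarrow> (\<forall>gs i. generates_max_ideal S gs \<longrightarrow>
    full_action S (local_cohomology S gs i) (local_cohomology_frob p S gs i))"

definition F_anti_nilpotent :: "nat \<Rightarrow> ('a, 'b) ring_scheme \<Rightarrow> bool"
  where "F_anti_nilpotent p S \<longleftrightarrow> (\<forall>gs i. generates_max_ideal S gs \<longrightarrow>
    anti_nilpotent_action S (local_cohomology S gs i) (local_cohomology_frob p S gs i))"

end

theory Submission
  imports Defs
begin

text \<open>
  Let \<open>H\<^sup>i\<close> be the cohomology of the Cech complex \<open>C\<close> of \<open>R\<close> on generators of \<open>\<mm>\<close>, with its
  Frobenius action \<open>F\<close>.  The element \<open>x\<close> is regular on \<open>C\<close>, and \<open>C / x C\<close> is the Cech complex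
  of \<open>R / (x)\<close>.  The long exact sequence gives a connecting map \<open>\<delta>\<close> from the cohomology of
  \<open>R / (x)\<close> in degree \<open>i - 1\<close> to \<open>H\<^sup>i\<close>.  Its image is the socle \<open>(0 : x)\<close> of \<open>H\<^sup>i\<close>, and if
  \<open>d w = x v\<close> then \<open>d (F w) = F (x v) = x (x\<^sup>p\<^sup>-\<^sup>1 F v)\<close>.  So \<open>\<delta>\<close> carries the Frobenius action of
  \<open>R / (x)\<close> to the action \<open>G = x\<^sup>p\<^sup>-\<^sup>1 F\<close> on the socle.  Since \<open>x\<close> lies in \<open>\<mm>\<close>, every class in
  \<open>H\<^sup>i\<close> is killed by a power of \<open>x\<close>.  All three parts are inductions on this power which rest on
  the identity \<open>G (x\<^sup>n v) = x\<^sup>n w\<close> with \<open>w\<close> a multiple of \<open>F v\<close>.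

  \<^item> Anti-nilpotence.  Let \<open>N\<close> be \<open>F\<close>-stable, \<open>F u \<in> N\<close> and \<open>x\<^sup>n\<^sup>+\<^sup>1 u = 0\<close>.  By the identity, the
    part of the socle in \<open>x\<^sup>n N\<close> is \<open>G\<close>-stable and \<open>G (x\<^sup>n u)\<close> lies in it.  Anti-nilpotence of
    \<open>R / (x)\<close> gives \<open>x\<^sup>n u = x\<^sup>n v\<close> with \<open>v \<in> N\<close>, and the induction hypothesis applies to \<open>u - v\<close>.

  \<^item> Fullness.  If \<open>G\<close> spans the socle, then the socle lies in \<open>x\<^sup>n H\<^sup>i\<close> for every \<open>n\<close>, since \<open>G\<close>
    maps the part in \<open>x\<^sup>n H\<^sup>i\<close> into \<open>x\<^sup>n\<^sup>+\<^sup>1 H\<^sup>i\<close>.  If \<open>N\<close> is a submodule that contains \<open>F (H\<^sup>i)\<close>,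
    then by the identity the socle even lies in \<open>x\<^sup>n N\<close>.  For \<open>x\<^sup>n\<^sup>+\<^sup>1 u = 0\<close> this again gives
    \<open>x\<^sup>n u = x\<^sup>n v\<close> with \<open>v \<in> N\<close>, and induction shows \<open>u \<in> N\<close>.

  \<^item> Injectivity.  Fullness of \<open>R / (x)\<close> also makes multiplication by \<open>x\<close> surjective on each
    \<open>H\<^sup>i\<close>, so \<open>\<delta>\<close> is injective and \<open>G\<close> is injective on the socle.  If \<open>F u = 0\<close> and
    \<open>x\<^sup>n\<^sup>+\<^sup>1 u = 0\<close>, then \<open>x\<^sup>n u\<close> is a socle element killed by \<open>G\<close>, so \<open>x\<^sup>n u = 0\<close>.

  The arguments are carried out on cochains.  Cohomology classes are represented by cocycles, and
  the cohomology of \<open>R / (x)\<close> in degree \<open>k\<close> is presented as the quotient of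
  \<open>{w. d w \<in> x C}\<close> by \<open>B + x C\<close>, where \<open>B\<close> is the module of coboundaries in degree \<open>k\<close>.  The
  locale \<open>subquotient_presentation\<close> transfers the three properties along such presentations, the
  locale \<open>frobenius_deformation\<close> contains the inductions, and the rest verifies its hypotheses for
  the Cech complex.
\<close>

section \<open>Semilinear maps and quotient modules\<close>

lemma (in abelian_group) minus_eq_iff:
  assumes "a \<in> carrier G" "b \<in> carrier G" "c \<in> carrier G"
  shows "a \<ominus> b = c \<longleftrightarrow> a = b \<oplus> c"
proof
  assume "a \<ominus> b = c"
  then have "b \<oplus> c = b \<oplus> (a \<ominus> b)" by simp
  also have "\<dots> = a" using assms by (simp add: a_minus_def a_lcomm r_neg)
  finally show "a = b \<oplus> c" by simp
next
  assume a: "a = b \<oplus> c"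
  show "a \<ominus> b = c" using assms(2,3) unfolding a by (simp add: a_minus_def a_comm[of b c] a_assoc r_neg)
qed

lemma (in module) smult_minus:
  "r \<in> carrier R \<Longrightarrow> u \<in> carrier M \<Longrightarrow> v \<in> carrier M \<Longrightarrow> r \<odot>\<^bsub>M\<^esub> (u \<ominus>\<^bsub>M\<^esub> v) = r \<odot>\<^bsub>M\<^esub> u \<ominus>\<^bsub>M\<^esub> r \<odot>\<^bsub>M\<^esub> v"
  by (simp add: a_minus_def smult_r_distr smult_r_minus)

lemma (in module) pow_smult_pow_smult:
  "t \<in> carrier R \<Longrightarrow> u \<in> carrier M \<Longrightarrow> t [^] (m::nat) \<odot>\<^bsub>M\<^esub> (t [^] (n::nat) \<odot>\<^bsub>M\<^esub> u) = t [^] (m + n) \<odot>\<^bsub>M\<^esub> u"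
  by (simp add: smult_assoc1[symmetric] R.nat_pow_mult)

lemma (in module) submodule_zero: "submodule N R M \<Longrightarrow> \<zero>\<^bsub>M\<^esub> \<in> N"
  using submodule.axioms(1) subgroup.one_closed by fastforce

lemma (in module) submodule_abelian_subgroup:
  assumes "submodule N R M" shows "abelian_subgroup N M"
  using submodule.axioms(1)[OF assms] by (intro abelian_subgroupI3 additive_subgroupI M.abelian_group_axioms)

lemma (in module) submodule_minus:
  "submodule N R M \<Longrightarrow> a \<in> N \<Longrightarrow> b \<in> N \<Longrightarrow> a \<ominus>\<^bsub>M\<^esub> b \<in> N"
  by (simp add: a_minus_def submoduleE)

lemma (in module) submoduleI':
  assumes "H \<subseteq> carrier M" "\<zero>\<^bsub>M\<^esub> \<in> H"
    and "\<And>a b. a \<in> H \<Longrightarrow> b \<in> H \<Longrightarrow> a \<oplus>\<^bsub>M\<^esub> b \<in> H"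
    and sm: "\<And>r a. r \<in> carrier R \<Longrightarrow> a \<in> H \<Longrightarrow> r \<odot>\<^bsub>M\<^esub> a \<in> H"
  shows "submodule H R M"
proof (rule submoduleI)
  fix a assume "a \<in> H"
  then show "\<ominus>\<^bsub>M\<^esub> a \<in> H"
    using sm[of "\<ominus> \<one>" a] assms(1) smult_l_minus[of \<one> a] by auto
qed (use assms in auto)

lemma (in module) submodule_of_submodule:
  assumes "submodule Z R M"
  shows "submodule N R (M\<lparr>carrier := Z\<rparr>) \<longleftrightarrow> submodule N R M \<and> N \<subseteq> Z"
proof -
  interpret Z: module R "M\<lparr>carrier := Z\<rparr>"
    by (rule submodule.submodule_is_module[OF assms module_axioms])
  show ?thesis
  proof (intro iffI conjI)
    assume N: "submodule N R (M\<lparr>carrier := Z\<rparr>)"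
    show NZ: "N \<subseteq> Z" using Z.submoduleE(1)[OF N] by simp
    show "submodule N R M"
      using NZ submoduleE(1)[OF assms] Z.submodule_zero[OF N] Z.submoduleE(4,5)[OF N]
      by (intro submoduleI') auto
  next
    assume N: "submodule N R M \<and> N \<subseteq> Z"
    then show "submodule N R (M\<lparr>carrier := Z\<rparr>)"
      using submodule_zero submoduleE by (intro Z.submoduleI') auto
  qed
qed

text \<open>
  This covers differentials and cosets (scalars fixed), Frobenius actions (scalars raised to the
  power \<open>p\<close>), and reduction modulo \<open>x\<close> (scalars reduced).
\<close>

locale semilinear_map = M: module R M + N: module S N for R M S N +
  fixes \<sigma> f
  assumes scalar_closed: "r \<in> carrier R \<Longrightarrow> \<sigma> r \<in> carrier S"
    and map_closed: "u \<in> carrier M \<Longrightarrow> f u \<in> carrier N"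
    and map_add: "u \<in> carrier M \<Longrightarrow> v \<in> carrier M \<Longrightarrow> f (u \<oplus>\<^bsub>M\<^esub> v) = f u \<oplus>\<^bsub>N\<^esub> f v"
    and map_smult: "r \<in> carrier R \<Longrightarrow> u \<in> carrier M \<Longrightarrow> f (r \<odot>\<^bsub>M\<^esub> u) = \<sigma> r \<odot>\<^bsub>N\<^esub> f u"
begin

lemma map_zero: "f \<zero>\<^bsub>M\<^esub> = \<zero>\<^bsub>N\<^esub>"
  using map_add[of "\<zero>\<^bsub>M\<^esub>" "\<zero>\<^bsub>M\<^esub>"] map_closed[of "\<zero>\<^bsub>M\<^esub>"] N.M.add.l_cancel_one' by simp

lemma map_uminus: "u \<in> carrier M \<Longrightarrow> f (\<ominus>\<^bsub>M\<^esub> u) = \<ominus>\<^bsub>N\<^esub> f u"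
  by (rule N.M.minus_equality[symmetric]) (simp_all add: map_closed map_add[symmetric] map_zero M.M.l_neg)

lemma map_minus: "u \<in> carrier M \<Longrightarrow> v \<in> carrier M \<Longrightarrow> f (u \<ominus>\<^bsub>M\<^esub> v) = f u \<ominus>\<^bsub>N\<^esub> f v"
  by (simp add: a_minus_def map_add map_uminus)

lemma map_finsum:
  assumes "finite A" "g \<in> A \<rightarrow> carrier M"
  shows "f (\<Oplus>\<^bsub>M\<^esub>i\<in>A. g i) = (\<Oplus>\<^bsub>N\<^esub>i\<in>A. f (g i))"
  using assms
  by (induction A) (simp_all add: map_zero map_add Pi_def map_closed)

lemma vimage_submodule:
  assumes "submodule K S N" shows "submodule {u \<in> carrier M. f u \<in> K} R M"
  using N.submodule_zero[OF assms] N.submoduleE[OF assms]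
  by (intro M.submoduleI') (auto simp: map_zero map_add map_smult scalar_closed)

lemma image_submodule:
  assumes "submodule K R M" and surj: "\<sigma> ` carrier R = carrier S"
  shows "submodule (f ` K) S N"
proof (rule N.submoduleI')
  have K: "K \<subseteq> carrier M" using M.submoduleE[OF assms(1)] by simp
  show "f ` K \<subseteq> carrier N" using K map_closed by auto
  show "\<zero>\<^bsub>N\<^esub> \<in> f ` K" using M.submodule_zero[OF assms(1)] map_zero by (metis image_eqI)
  fix a b assume "a \<in> f ` K" "b \<in> f ` K"
  then show "a \<oplus>\<^bsub>N\<^esub> b \<in> f ` K"
    using K M.submoduleE(5)[OF assms(1)] map_add by (auto simp: image_iff subset_iff) metis
next
  have K: "K \<subseteq> carrier M" using M.submoduleE[OF assms(1)] by simp
  fix r a assume "r \<in> carrier S" "a \<in> f ` K"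
  then obtain s k where "r = \<sigma> s" "s \<in> carrier R" "a = f k" "k \<in> K"
    unfolding surj[symmetric] by blast
  then show "r \<odot>\<^bsub>N\<^esub> a \<in> f ` K"
    using K M.submoduleE(4)[OF assms(1)] map_smult by (metis image_eqI subsetD)
qed

end

lemma (in semilinear_map) restrict_semilinear:
  assumes "submodule Z R M" "submodule Y S N" "f ` Z \<subseteq> Y"
  shows "semilinear_map R (M\<lparr>carrier := Z\<rparr>) S (N\<lparr>carrier := Y\<rparr>) \<sigma> f"
proof -
  have "Z \<subseteq> carrier M" using M.submoduleE[OF assms(1)] by simp
  then show ?thesis
    using assms scalar_closed map_add map_smult
    by (intro semilinear_map.intro submodule.submodule_is_module[OF assms(1) M.module_axioms]
      submodule.submodule_is_module[OF assms(2) N.module_axioms] semilinear_map_axioms.intro)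
      (auto simp: subset_iff)
qed

lemma semilinear_map_comp:
  assumes "semilinear_map R M S N \<sigma> f" "semilinear_map S N T P \<tau> g"
  shows "semilinear_map R M T P (\<tau> \<circ> \<sigma>) (g \<circ> f)"
proof -
  interpret f: semilinear_map R M S N \<sigma> f by fact
  interpret g: semilinear_map S N T P \<tau> g by fact
  show ?thesis
    by unfold_locales (auto simp: f.scalar_closed g.scalar_closed f.map_closed g.map_closed
      f.map_add g.map_add f.map_smult g.map_smult)
qed

locale quotient_of_module = M: module S M for S M +
  fixes N
  assumes sub: "submodule N S M"
begin

sublocale G: abelian_subgroup N M
  by (rule M.submodule_abelian_subgroup[OF sub])

abbreviation coset where "coset u \<equiv> N +>\<^bsub>M\<^esub> u"

lemma coset_eq_iff:
  "u \<in> carrier M \<Longrightarrow> v \<in> carrier M \<Longrightarrow> coset u = coset v \<longleftrightarrow> u \<ominus>\<^bsub>M\<^esub> v \<in> N"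
  by (metis G.a_repr_independence' G.a_rcos_module G.a_rcos_self a_minus_def G.is_abelian_subgroup)

lemma coset_eq_zero_iff: "u \<in> carrier M \<Longrightarrow> coset u = N \<longleftrightarrow> u \<in> N"
  by (metis G.a_rcos_const G.a_rcos_self)

lemma mem_coset_iff:
  assumes "u \<in> carrier M" shows "v \<in> coset u \<longleftrightarrow> v \<in> carrier M \<and> coset v = coset u"
  by (metis G.a_elemrcos_carrier G.a_rcos_self G.a_repr_independence' assms)

lemma carrier_quot: "carrier (quot_module M N) = coset ` carrier M"
  by (auto simp: quot_module_def A_RCOSETS_def')

lemma zero_quot: "\<zero>\<^bsub>quot_module M N\<^esub> = N" by (simp add: quot_module_def)

lemma add_quot:
  "u \<in> carrier M \<Longrightarrow> v \<in> carrier M \<Longrightarrow>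
    coset u \<oplus>\<^bsub>quot_module M N\<^esub> coset v = coset (u \<oplus>\<^bsub>M\<^esub> v)"
  by (simp add: quot_module_def G.a_rcos_sum)

lemma union_cosets:
  assumes u: "u \<in> carrier M" and f: "\<And>v. v \<in> coset u \<Longrightarrow> f v = f u"
  shows "(\<Union>v\<in>coset u. f v) = f u"
  using f G.a_rcos_self[OF u] by blast

lemma smult_quot:
  assumes "r \<in> carrier S" and u: "u \<in> carrier M"
  shows "r \<odot>\<^bsub>quot_module M N\<^esub> coset u = coset (r \<odot>\<^bsub>M\<^esub> u)"
proof -
  have "coset (r \<odot>\<^bsub>M\<^esub> v) = coset (r \<odot>\<^bsub>M\<^esub> u)" if "v \<in> coset u" for v
  proof -
    have v: "v \<in> carrier M" "v \<ominus>\<^bsub>M\<^esub> u \<in> N" using that mem_coset_iff[OF u] coset_eq_iff[OF _ u] by auto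
    have "r \<odot>\<^bsub>M\<^esub> v \<ominus>\<^bsub>M\<^esub> r \<odot>\<^bsub>M\<^esub> u = r \<odot>\<^bsub>M\<^esub> (v \<ominus>\<^bsub>M\<^esub> u)"
      using v assms by (simp add: a_minus_def M.smult_r_distr M.smult_r_minus)
    then show ?thesis using v assms M.submoduleE(4)[OF sub] coset_eq_iff by simp
  qed
  then show ?thesis using union_cosets[OF u, of "\<lambda>v. coset (r \<odot>\<^bsub>M\<^esub> v)"] by (simp add: quot_module_def)
qed

lemma quot_module_is_module: "module S (quot_module M N)"
proof (rule moduleI)
  show "cring S" by (rule M.R.cring_axioms)
  show "abelian_group (quot_module M N)"
  proof (rule abelian_groupI)
    fix X assume "X \<in> carrier (quot_module M N)"
    then obtain u where u: "u \<in> carrier M" "X = coset u" by (auto simp: carrier_quot)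
    have "coset (\<ominus>\<^bsub>M\<^esub> u) \<oplus>\<^bsub>quot_module M N\<^esub> X = N"
      using u add_quot[of "\<ominus>\<^bsub>M\<^esub> u" u] by (simp add: M.M.l_neg coset_eq_zero_iff)
    then show "\<exists>Y\<in>carrier (quot_module M N). Y \<oplus>\<^bsub>quot_module M N\<^esub> X = \<zero>\<^bsub>quot_module M N\<^esub>"
      using u by (auto simp: carrier_quot zero_quot)
    show "\<zero>\<^bsub>quot_module M N\<^esub> \<oplus>\<^bsub>quot_module M N\<^esub> X = X"
      using u add_quot[of "\<zero>\<^bsub>M\<^esub>" u] coset_eq_zero_iff[of "\<zero>\<^bsub>M\<^esub>"] by (simp add: zero_quot)
  next
    show "\<zero>\<^bsub>quot_module M N\<^esub> \<in> carrier (quot_module M N)"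
      using coset_eq_zero_iff[of "\<zero>\<^bsub>M\<^esub>"] by (auto simp: carrier_quot zero_quot image_iff)
  qed (auto simp: carrier_quot add_quot M.M.a_ac)
qed (auto simp: carrier_quot add_quot smult_quot M.smult_l_distr M.smult_r_distr M.smult_assoc1)

lemma coset_semilinear: "semilinear_map S M S (quot_module M N) (\<lambda>r. r) coset"
  by (intro semilinear_map.intro M.module_axioms quot_module_is_module semilinear_map_axioms.intro)
    (auto simp: carrier_quot add_quot smult_quot)

text \<open>
  The union in \<open>quot_map\<close> is over equal cosets because the images of two representatives differ by
  an element of \<open>F ` N\<close>.
\<close>

lemma quot_map_coset:
  assumes F: "semilinear_map S M S M \<tau> F" and FN: "F ` N \<subseteq> N" and u: "u \<in> carrier M"
  shows "quot_map M N F (coset u) = coset (F u)"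
proof -
  interpret F: semilinear_map S M S M \<tau> F by fact
  have "coset (F v) = coset (F u)" if "v \<in> coset u" for v
  proof -
    have v: "v \<in> carrier M" "v \<ominus>\<^bsub>M\<^esub> u \<in> N" using that mem_coset_iff[OF u] coset_eq_iff[OF _ u] by auto
    then have "F v \<ominus>\<^bsub>M\<^esub> F u \<in> N" using u FN by (auto simp: F.map_minus[symmetric])
    then show ?thesis using v u F.map_closed coset_eq_iff by simp
  qed
  then show ?thesis using union_cosets[OF u, of "\<lambda>v. coset (F v)"] by (simp add: quot_map_def)
qed

lemma quot_map_semilinear:
  assumes F: "semilinear_map S M S M \<tau> F" and FN: "F ` N \<subseteq> N"
  shows "semilinear_map S (quot_module M N) S (quot_module M N) \<tau> (quot_map M N F)"
proof -
  interpret F: semilinear_map S M S M \<tau> F by fact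
  show ?thesis
    by (intro semilinear_map.intro quot_module_is_module semilinear_map_axioms.intro)
      (auto simp: carrier_quot add_quot smult_quot quot_map_coset[OF F FN] F.map_add F.map_smult
        F.scalar_closed F.map_closed)
qed

lemma injective_quot_map_iff:
  assumes F: "semilinear_map S M S M \<tau> F" and FN: "F ` N \<subseteq> N"
  shows "injective_action (quot_module M N) (quot_map M N F) \<longleftrightarrow>
    (\<forall>u\<in>carrier M. F u \<in> N \<longrightarrow> u \<in> N)"
proof -
  interpret F: semilinear_map S M S M \<tau> F by fact
  show ?thesis
  proof (intro iffI ballI impI)
    fix u assume inj: "injective_action (quot_module M N) (quot_map M N F)"
      and u: "u \<in> carrier M" "F u \<in> N"
    have "coset (F u) = N" "coset \<zero>\<^bsub>M\<^esub> = N"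
      using u F.map_closed coset_eq_zero_iff G.zero_closed by auto
    then have "quot_map M N F (coset u) = quot_map M N F (coset \<zero>\<^bsub>M\<^esub>)"
      using quot_map_coset[OF F FN, of u] quot_map_coset[OF F FN, of "\<zero>\<^bsub>M\<^esub>"] u(1) F.map_zero by simp
    then have "coset u = coset \<zero>\<^bsub>M\<^esub>"
      using inj u unfolding injective_action_def carrier_quot by (meson M.M.zero_closed image_eqI inj_onD)
    then show "u \<in> N" using u coset_eq_zero_iff G.zero_closed by (metis M.M.zero_closed)
  next
    assume *: "\<forall>u\<in>carrier M. F u \<in> N \<longrightarrow> u \<in> N"
    show "injective_action (quot_module M N) (quot_map M N F)"
      unfolding injective_action_def carrier_quot
    proof (intro inj_onI, elim imageE)
      fix X Y u v assume u: "X = coset u" "u \<in> carrier M" and v: "Y = coset v" "v \<in> carrier M"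
        and eq: "quot_map M N F X = quot_map M N F Y"
      have "F u \<ominus>\<^bsub>M\<^esub> F v \<in> N"
        using eq u v quot_map_coset[OF F FN] coset_eq_iff F.map_closed by metis
      then have "u \<ominus>\<^bsub>M\<^esub> v \<in> N" using * u v F.map_minus by auto
      then show "X = Y" using u v coset_eq_iff by blast
    qed
  qed
qed

end

section \<open>Frobenius actions on subquotients\<close>

text \<open>
  The three properties for the action that \<open>\<phi>\<close> induces on \<open>Z / B\<close>, expressed by representatives:
  the submodules of \<open>Z / B\<close> are the \<open>N / B\<close> for \<open>B \<subseteq> N \<subseteq> Z\<close>.
\<close>

definition injective_on_subquotient :: "'m set \<Rightarrow> 'm set \<Rightarrow> ('m \<Rightarrow> 'm) \<Rightarrow> bool"
  where "injective_on_subquotient Z B \<phi> \<longleftrightarrow> (\<forall>u\<in>Z. \<phi> u \<in> B \<longrightarrow> u \<in> B)"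

definition full_on_subquotient ::
    "('a, 'b) ring_scheme \<Rightarrow> ('a, 'm, 'c) module_scheme \<Rightarrow> 'm set \<Rightarrow> 'm set \<Rightarrow> ('m \<Rightarrow> 'm) \<Rightarrow> bool"
  where "full_on_subquotient R C Z B \<phi> \<longleftrightarrow>
    (\<forall>N. submodule N R C \<longrightarrow> B \<subseteq> N \<longrightarrow> \<phi> ` Z \<subseteq> N \<longrightarrow> Z \<subseteq> N)"

definition anti_nilpotent_on_subquotient ::
    "('a, 'b) ring_scheme \<Rightarrow> ('a, 'm, 'c) module_scheme \<Rightarrow> 'm set \<Rightarrow> 'm set \<Rightarrow> ('m \<Rightarrow> 'm) \<Rightarrow> bool"
  where "anti_nilpotent_on_subquotient R C Z B \<phi> \<longleftrightarrow>
    (\<forall>N. submodule N R C \<longrightarrow> B \<subseteq> N \<longrightarrow> N \<subseteq> Z \<longrightarrow> \<phi> ` N \<subseteq> N \<longrightarrow> injective_on_subquotient Z N \<phi>)"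

text \<open>
  Here \<open>\<pi>\<close> induces a bijection from \<open>W / B\<close> to \<open>Z / Y\<close> compatible with the actions \<open>\<phi>\<close> and \<open>\<psi>\<close>.
  As \<open>\<sigma>\<close> is onto, submodules over \<open>R\<close> and over \<open>S\<close> correspond, and the three properties can be
  tested on either side.
\<close>

locale subquotient_presentation = \<pi>: semilinear_map R C S D \<sigma> \<pi> + \<psi>: semilinear_map S D S D \<tau> \<psi>
  for R C S D \<sigma> \<pi> \<tau> \<psi> +
  fixes W B Z Y \<phi>
  assumes scalar_surj: "\<sigma> ` carrier R = carrier S"
    and W: "submodule W R C" and Z: "submodule Z S D" and Y: "submodule Y S D"
    and Y_subset: "Y \<subseteq> Z"
    and \<psi>_Z: "\<psi> ` Z \<subseteq> Z" and \<psi>_Y: "\<psi> ` Y \<subseteq> Y"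
    and \<pi>_W: "\<pi> ` W = Z"
    and \<pi>_B: "w \<in> W \<Longrightarrow> \<pi> w \<in> Y \<longleftrightarrow> w \<in> B" and B_subset: "B \<subseteq> W"
    and \<phi>_W: "\<phi> ` W \<subseteq> W" and \<pi>_\<phi>: "w \<in> W \<Longrightarrow> \<pi> (\<phi> w) = \<psi> (\<pi> w)"
begin

abbreviation DZ where "DZ \<equiv> D\<lparr>carrier := Z\<rparr>"
abbreviation H where "H \<equiv> quot_module DZ Y"
abbreviation F where "F \<equiv> quot_map DZ Y \<psi>"
abbreviation q where "q w \<equiv> Y +>\<^bsub>DZ\<^esub> \<pi> w"

lemma W_carrier: "w \<in> W \<Longrightarrow> w \<in> carrier C"
  using \<pi>.M.submoduleE(1)[OF W] by blast

sublocale Q: quotient_of_module S DZ Y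
  using submodule.submodule_is_module[OF Z \<pi>.N.module_axioms] \<pi>.N.submodule_of_submodule[OF Z] Y Y_subset
  by (simp add: quotient_of_module_def quotient_of_module_axioms_def)

lemma \<psi>_restrict: "semilinear_map S DZ S DZ \<tau> \<psi>"
  by (rule \<psi>.restrict_semilinear[OF Z Z \<psi>_Z])

sublocale F: semilinear_map S H S H \<tau> F
  by (rule Q.quot_map_semilinear[OF \<psi>_restrict \<psi>_Y])

sublocale q: semilinear_map R "C\<lparr>carrier := W\<rparr>" S H \<sigma> q
proof -
  have "semilinear_map R (C\<lparr>carrier := W\<rparr>) S DZ \<sigma> \<pi>"
    using \<pi>_W by (intro \<pi>.restrict_semilinear W Z) auto
  from semilinear_map_comp[OF this Q.coset_semilinear]
  show "semilinear_map R (C\<lparr>carrier := W\<rparr>) S H \<sigma> q" by (simp add: comp_def)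
qed

lemma q_surj: "q ` W = carrier H"
  using \<pi>_W by (auto simp: Q.carrier_quot)

lemma q_zero_iff: "w \<in> W \<Longrightarrow> q w = \<zero>\<^bsub>H\<^esub> \<longleftrightarrow> w \<in> B"
  using \<pi>_W \<pi>_B Q.coset_eq_zero_iff by (auto simp: Q.zero_quot)

lemma q_\<phi>: "w \<in> W \<Longrightarrow> q (\<phi> w) = F (q w)"
  using \<pi>_W \<pi>_\<phi> Q.quot_map_coset[OF \<psi>_restrict \<psi>_Y] by auto

lemma submodule_preimage:
  assumes "submodule N S H"
  shows "submodule {w \<in> W. q w \<in> N} R C"
  using q.vimage_submodule[OF assms] \<pi>.M.submodule_of_submodule[OF W] by simp

lemma B_subset_preimage:
  assumes "submodule N S H"
  shows "B \<subseteq> {w \<in> W. q w \<in> N}"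
proof
  fix w assume "w \<in> B"
  then have "w \<in> W" "q w = \<zero>\<^bsub>H\<^esub>" using q_zero_iff B_subset by auto
  then show "w \<in> {w \<in> W. q w \<in> N}" using F.M.submodule_zero[OF assms] by simp
qed

lemma submodule_image:
  assumes "submodule N R C" "N \<subseteq> W"
  shows "submodule (q ` N) S H"
  using q.image_submodule[OF _ scalar_surj] \<pi>.M.submodule_of_submodule[OF W] assms by simp

lemma q_mem_image_iff:
  assumes N: "submodule N R C" "N \<subseteq> W" "B \<subseteq> N" and w: "w \<in> W"
  shows "q w \<in> q ` N \<longleftrightarrow> w \<in> N"
proof
  assume "q w \<in> q ` N"
  then obtain n where n: "n \<in> N" "q w = q n" by auto
  have nW: "n \<in> W" using n N by auto
  have c: "w \<in> carrier C" "n \<in> carrier C" using w nW W_carrier by auto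
  have neg: "\<ominus>\<^bsub>C\<^esub> n \<in> N" "\<ominus>\<^bsub>C\<^esub> n \<in> W" using \<pi>.M.submoduleE(3)[OF N(1) n(1)] N by auto
  have "q (\<ominus>\<^bsub>C\<^esub> n) \<oplus>\<^bsub>H\<^esub> q n = q (\<ominus>\<^bsub>C\<^esub> n \<oplus>\<^bsub>C\<^esub> n)"
    using q.map_add[of "\<ominus>\<^bsub>C\<^esub> n" n] neg nW by simp
  also have "\<dots> = \<zero>\<^bsub>H\<^esub>" using q.map_zero c by (simp add: \<pi>.M.M.l_neg)
  finally have "q (\<ominus>\<^bsub>C\<^esub> n \<oplus>\<^bsub>C\<^esub> w) = \<zero>\<^bsub>H\<^esub>"
    using q.map_add[of "\<ominus>\<^bsub>C\<^esub> n" w] neg w n(2) by simp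
  then have "\<ominus>\<^bsub>C\<^esub> n \<oplus>\<^bsub>C\<^esub> w \<in> N"
    using q_zero_iff neg w \<pi>.M.submoduleE(5)[OF W] N(3) by blast
  then have "n \<oplus>\<^bsub>C\<^esub> (\<ominus>\<^bsub>C\<^esub> n \<oplus>\<^bsub>C\<^esub> w) \<in> N" using \<pi>.M.submoduleE(5)[OF N(1)] n by blast
  then show "w \<in> N" using c by (simp add: \<pi>.M.M.r_neg2)
qed auto

lemma anti_nilpotent_iff:
  "anti_nilpotent_action S H F \<longleftrightarrow> anti_nilpotent_on_subquotient R C W B \<phi>"
proof
  assume anti: "anti_nilpotent_action S H F"
  show "anti_nilpotent_on_subquotient R C W B \<phi>"
    unfolding anti_nilpotent_on_subquotient_def injective_on_subquotient_def
  proof (intro allI impI ballI)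
    fix N w assume N: "submodule N R C" "B \<subseteq> N" "N \<subseteq> W" "\<phi> ` N \<subseteq> N" and w: "w \<in> W" "\<phi> w \<in> N"
    note sub = submodule_image[OF N(1,3)]
    have stable: "F ` q ` N \<subseteq> q ` N" using N(3,4) q_\<phi> by (auto simp: subset_iff image_iff) metis
    have QNinj: "injective_action (quot_module H (q ` N)) (quot_map H (q ` N) F)"
      using anti sub stable unfolding anti_nilpotent_action_def F_stable_def by blast
    interpret QN: quotient_of_module S H "q ` N"
      by (intro quotient_of_module.intro quotient_of_module_axioms.intro F.M.module_axioms sub)
    have "\<forall>u\<in>carrier H. F u \<in> q ` N \<longrightarrow> u \<in> q ` N"
      using QNinj QN.injective_quot_map_iff[OF F.semilinear_map_axioms stable] by blast
    moreover have "q w \<in> carrier H" using q_surj w by auto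
    moreover have "F (q w) \<in> q ` N" unfolding q_\<phi>[OF w(1), symmetric] using w(2) by (rule imageI)
    ultimately show "w \<in> N" using q_mem_image_iff[OF N(1,3,2) w(1)] by blast
  qed
next
  assume anti: "anti_nilpotent_on_subquotient R C W B \<phi>"
  show "anti_nilpotent_action S H F"
    unfolding anti_nilpotent_action_def F_stable_def
  proof (intro allI impI)
    fix N assume N: "submodule N S H \<and> F ` N \<subseteq> N"
    interpret QN: quotient_of_module S H N
      using N by (simp add: quotient_of_module_def quotient_of_module_axioms_def F.M.module_axioms)
    let ?N = "{w \<in> W. q w \<in> N}"
    have "\<phi> ` ?N \<subseteq> ?N" using N \<phi>_W q_\<phi> by (auto simp: subset_iff image_iff)
    then have inj: "injective_on_subquotient W ?N \<phi>"
      using anti submodule_preimage B_subset_preimage N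
      unfolding anti_nilpotent_on_subquotient_def by auto
    have "u \<in> N" if u: "u \<in> carrier H" "F u \<in> N" for u
    proof -
      obtain w where w: "w \<in> W" "u = q w" using u q_surj by auto
      then show ?thesis using inj u q_\<phi> \<phi>_W unfolding injective_on_subquotient_def by auto
    qed
    then show "injective_action (quot_module H N) (quot_map H N F)"
      using QN.injective_quot_map_iff[OF F.semilinear_map_axioms] N by blast
  qed
qed

lemma injective_iff: "injective_action H F \<longleftrightarrow> injective_on_subquotient W B \<phi>"
proof -
  have "injective_action H F \<longleftrightarrow> (\<forall>u\<in>Z. \<psi> u \<in> Y \<longrightarrow> u \<in> Y)"
    using Q.injective_quot_map_iff[OF \<psi>_restrict \<psi>_Y] by simp
  also have "\<dots> \<longleftrightarrow> (\<forall>w\<in>W. \<psi> (\<pi> w) \<in> Y \<longrightarrow> \<pi> w \<in> Y)" using \<pi>_W by auto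
  also have "\<dots> \<longleftrightarrow> injective_on_subquotient W B \<phi>"
    unfolding injective_on_subquotient_def
    using \<pi>_\<phi> \<pi>_B \<phi>_W by (intro ball_cong refl) (metis image_subset_iff)
  finally show ?thesis .
qed

lemma span_eq_carrier_iff:
  assumes "X \<subseteq> carrier H"
  shows "module_span S H X = carrier H \<longleftrightarrow> (\<forall>N. submodule N S H \<longrightarrow> X \<subseteq> N \<longrightarrow> carrier H \<subseteq> N)"
  using assms F.M.carrier_is_submodule unfolding module_span_def by blast

text \<open>
  The definition of fullness allows any exponent \<open>e \<ge> 1\<close>.  The image of \<open>F ^^ e\<close> lies in the image
  of \<open>F\<close>, so the case \<open>e = 1\<close> is equivalent.
\<close>

lemma full_iff: "full_action S H F \<longleftrightarrow> full_on_subquotient R C W B \<phi>"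
proof
  assume "full_action S H F"
  then obtain e where e: "e \<ge> 1" "module_span S H ((F ^^ e) ` carrier H) = carrier H"
    unfolding full_action_def by blast
  have pow_closed: "(F ^^ k) u \<in> carrier H" if "u \<in> carrier H" for k u
    using that by (induction k) (auto simp: F.map_closed)
  show "full_on_subquotient R C W B \<phi>"
    unfolding full_on_subquotient_def
  proof (intro allI impI)
    fix N assume N: "submodule N R C" "B \<subseteq> N" "\<phi> ` W \<subseteq> N"
    let ?N = "N \<inter> W"
    have sub: "submodule ?N R C"
      using \<pi>.M.submoduleE[OF N(1)] \<pi>.M.submoduleE[OF W] \<pi>.M.submodule_zero N(1) W
      by (intro \<pi>.M.submoduleI') auto
    have "(F ^^ e) ` carrier H \<subseteq> F ` carrier H"
      using e(1) pow_closed by (cases e) auto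
    also have "\<dots> \<subseteq> q ` ?N"
    proof -
      have "F (q w) \<in> q ` ?N" if "w \<in> W" for w
        using that N(3) \<phi>_W by (subst q_\<phi>[symmetric]) auto
      then show ?thesis by (auto simp: q_surj[symmetric])
    qed
    finally have "carrier H \<subseteq> q ` ?N"
      using e(2) submodule_image[OF sub] pow_closed span_eq_carrier_iff[of "(F ^^ e) ` carrier H"] by blast
    then show "W \<subseteq> N"
      using q_mem_image_iff[OF sub] N(2) B_subset by (auto simp: q_surj[symmetric])
  qed
next
  assume full: "full_on_subquotient R C W B \<phi>"
  have "carrier H \<subseteq> N" if N: "submodule N S H" "F ` carrier H \<subseteq> N" for N
  proof -
    have "F (q w) \<in> N" if "w \<in> W" for w using that N(2) q_surj by blast
    then have "\<phi> ` W \<subseteq> {w \<in> W. q w \<in> N}" using \<phi>_W q_\<phi> by auto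
    then have "W \<subseteq> {w \<in> W. q w \<in> N}"
      using full submodule_preimage[OF N(1)] B_subset_preimage[OF N(1)]
      unfolding full_on_subquotient_def by blast
    then show ?thesis by (auto simp: q_surj[symmetric])
  qed
  then have "module_span S H ((F ^^ 1) ` carrier H) = carrier H"
    using F.map_closed by (subst span_eq_carrier_iff) auto
  then show "full_action S H F" unfolding full_action_def by blast
qed

end

section \<open>Deforming along a regular element\<close>

text \<open>
  One step \<open>d\<close> of a complex from \<open>C\<close> to \<open>D\<close>: \<open>Y\<close> stands for the coboundaries in \<open>C\<close> and \<open>Z\<close> for the
  cocycles in \<open>D\<close>, so \<open>Z / d ` C\<close> is the cohomology at \<open>D\<close>.
\<close>

locale frobenius_deformation =
  d: semilinear_map R C R D "\<lambda>r. r" d +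
  \<phi>: semilinear_map R C R C "\<lambda>r. r [^]\<^bsub>R\<^esub> p" \<phi> +
  \<psi>: semilinear_map R D R D "\<lambda>r. r [^]\<^bsub>R\<^esub> p" \<psi>
  for R (structure) and C D d and p :: nat and \<phi> \<psi> +
  fixes x Y Z
  assumes p: "p \<ge> 2"
    and x: "x \<in> carrier R"
    and d_\<phi>: "c \<in> carrier C \<Longrightarrow> d (\<phi> c) = \<psi> (d c)"
    and Y: "submodule Y R C" and d_Y: "y \<in> Y \<Longrightarrow> d y = \<zero>\<^bsub>D\<^esub>"
    and Z: "submodule Z R D" and d_Z: "c \<in> carrier C \<Longrightarrow> d c \<in> Z" and \<psi>_Z: "z \<in> Z \<Longrightarrow> \<psi> z \<in> Z"
    and x_regular: "u \<in> carrier D \<Longrightarrow> x \<odot>\<^bsub>D\<^esub> u = \<zero>\<^bsub>D\<^esub> \<Longrightarrow> u = \<zero>\<^bsub>D\<^esub>"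
    and Z_saturated: "u \<in> carrier D \<Longrightarrow> x \<odot>\<^bsub>D\<^esub> u \<in> Z \<Longrightarrow> u \<in> Z"
    and torsion: "z \<in> Z \<Longrightarrow> \<exists>n::nat. x [^] n \<odot>\<^bsub>D\<^esub> z \<in> d ` carrier C"
begin

abbreviation B where "B \<equiv> d ` carrier C"

text \<open>
  Representatives in \<open>C\<close> of the cocycles and the coboundaries of the complex modulo \<open>x\<close>.  The
  connecting map sends \<open>w\<close> with \<open>d w = x v\<close> to the class of \<open>v\<close>.
\<close>

definition mod_cycles where "mod_cycles = {w \<in> carrier C. \<exists>v\<in>carrier D. d w = x \<odot>\<^bsub>D\<^esub> v}"
definition mod_boundaries where "mod_boundaries = {w. \<exists>y\<in>Y. \<exists>c\<in>carrier C. w = y \<oplus>\<^bsub>C\<^esub> x \<odot>\<^bsub>C\<^esub> c}"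

lemmas closed = d.map_closed \<phi>.map_closed \<psi>.map_closed d.M.smult_closed d.N.smult_closed
  d.M.M.add.m_closed d.N.M.add.m_closed d.M.R.nat_pow_closed x d.M.R.m_closed

lemma Z_carrier: "z \<in> Z \<Longrightarrow> z \<in> carrier D"
  using d.N.submoduleE(1)[OF Z] by blast

lemma x_cancel:
  assumes "u \<in> carrier D" "v \<in> carrier D" "x \<odot>\<^bsub>D\<^esub> u = x \<odot>\<^bsub>D\<^esub> v"
  shows "u = v"
proof -
  have "x \<odot>\<^bsub>D\<^esub> (u \<ominus>\<^bsub>D\<^esub> v) = \<zero>\<^bsub>D\<^esub>"
    using assms x by (simp add: a_minus_def d.N.smult_r_distr d.N.smult_r_minus d.N.M.r_neg)
  then have "u \<ominus>\<^bsub>D\<^esub> v = \<zero>\<^bsub>D\<^esub>" using x_regular assms by simp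
  then show ?thesis using assms by (simp add: d.N.M.minus_eq_iff)
qed

lemmas pow_pow_smult = d.N.pow_smult_pow_smult[OF x]
lemmas pow_pow_smult_C = d.M.pow_smult_pow_smult[OF x]

lemma pow_Suc_smult:
  "u \<in> carrier D \<Longrightarrow> x [^] Suc n \<odot>\<^bsub>D\<^esub> u = x \<odot>\<^bsub>D\<^esub> (x [^] n \<odot>\<^bsub>D\<^esub> u)"
  using pow_pow_smult[of u 1 n] x by simp

text \<open>
  If the connecting image of \<open>w\<close> is \<open>x\<^sup>n v\<close>, then that of \<open>\<phi> w\<close> is \<open>x\<^sup>p\<^sup>-\<^sup>1 \<psi> (x\<^sup>n v)\<close>, which is again
  divisible by \<open>x\<^sup>n\<close>: it is \<open>x\<^sup>n\<close> times a multiple of \<open>\<psi> v\<close>.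
\<close>

lemma d_\<phi>_pow:
  assumes "w \<in> carrier C" "v \<in> carrier D" "c \<in> carrier C"
    and "d w = x [^] Suc n \<odot>\<^bsub>D\<^esub> v \<oplus>\<^bsub>D\<^esub> x \<odot>\<^bsub>D\<^esub> d c"
  shows "d (\<phi> w) = x [^] Suc n \<odot>\<^bsub>D\<^esub> (x [^] ((p - 1) * Suc n) \<odot>\<^bsub>D\<^esub> \<psi> v)
    \<oplus>\<^bsub>D\<^esub> x \<odot>\<^bsub>D\<^esub> d (x [^] (p - 1) \<odot>\<^bsub>C\<^esub> \<phi> c)"
proof -
  have e1: "Suc n * p = Suc n + (p - 1) * Suc n" using p by (cases p) (auto simp: algebra_simps)
  have e2: "p = Suc (p - 1)" using p by simp
  have "d (\<phi> w) = \<psi> (x [^] Suc n \<odot>\<^bsub>D\<^esub> v \<oplus>\<^bsub>D\<^esub> x \<odot>\<^bsub>D\<^esub> d c)" using assms d_\<phi> by simp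
  also have "\<dots> = (x [^] Suc n) [^] p \<odot>\<^bsub>D\<^esub> \<psi> v \<oplus>\<^bsub>D\<^esub> x [^] p \<odot>\<^bsub>D\<^esub> \<psi> (d c)"
    using assms(1-3) closed by (simp only: \<psi>.map_add \<psi>.map_smult d.N.smult_closed)
  also have "(x [^] Suc n) [^] p = x [^] (Suc n + (p - 1) * Suc n)"
    using x e1 by (simp only: d.M.R.nat_pow_pow)
  also have "\<dots> \<odot>\<^bsub>D\<^esub> \<psi> v = x [^] Suc n \<odot>\<^bsub>D\<^esub> (x [^] ((p - 1) * Suc n) \<odot>\<^bsub>D\<^esub> \<psi> v)"
    using pow_pow_smult[of "\<psi> v" "Suc n"] assms closed by simp
  also have "x [^] p \<odot>\<^bsub>D\<^esub> \<psi> (d c) = x \<odot>\<^bsub>D\<^esub> d (x [^] (p - 1) \<odot>\<^bsub>C\<^esub> \<phi> c)"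
    using assms(3) closed d_\<phi>[of c] pow_Suc_smult[of "\<psi> (d c)" "p - 1"] e2
    by (simp add: d.map_smult)
  finally show ?thesis .
qed

text \<open>
  The cocycles modulo \<open>x\<close> whose connecting image lies in \<open>x\<^sup>n N\<close>.  The term \<open>x d c\<close> accounts for
  coboundaries, and the exponent \<open>Suc n\<close> for the factor \<open>x\<close> that the connecting map removes.
\<close>

definition divisible_by where
  "divisible_by (n::nat) N = {w \<in> carrier C. \<exists>v\<in>N. \<exists>c\<in>carrier C. d w = x [^] Suc n \<odot>\<^bsub>D\<^esub> v \<oplus>\<^bsub>D\<^esub> x \<odot>\<^bsub>D\<^esub> d c}"

lemma divisible_byI:
  "w \<in> carrier C \<Longrightarrow> v \<in> N \<Longrightarrow> c \<in> carrier C \<Longrightarrow> d w = x [^] Suc n \<odot>\<^bsub>D\<^esub> v \<oplus>\<^bsub>D\<^esub> x \<odot>\<^bsub>D\<^esub> d c \<Longrightarrow> w \<in> divisible_by n N"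
  unfolding divisible_by_def by blast

lemma submodule_divisible_by:
  assumes N: "submodule N R D" shows "submodule (divisible_by n N) R C"
proof (rule d.M.submoduleI')
  have ND: "v \<in> carrier D" if "v \<in> N" for v using d.N.submoduleE(1)[OF N] that by blast
  show "divisible_by n N \<subseteq> carrier C" by (auto simp: divisible_by_def)
  show "\<zero>\<^bsub>C\<^esub> \<in> divisible_by n N"
    using x d.N.submodule_zero[OF N] by (intro divisible_byI[of _ "\<zero>\<^bsub>D\<^esub>" _ "\<zero>\<^bsub>C\<^esub>"]) (simp_all add: d.map_zero)
  fix a b assume "a \<in> divisible_by n N" "b \<in> divisible_by n N"
  then obtain v c v' c' where *: "a \<in> carrier C" "b \<in> carrier C" "v \<in> N" "v' \<in> N" "c \<in> carrier C" "c' \<in> carrier C"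
    "d a = x [^] Suc n \<odot>\<^bsub>D\<^esub> v \<oplus>\<^bsub>D\<^esub> x \<odot>\<^bsub>D\<^esub> d c"
    "d b = x [^] Suc n \<odot>\<^bsub>D\<^esub> v' \<oplus>\<^bsub>D\<^esub> x \<odot>\<^bsub>D\<^esub> d c'" unfolding divisible_by_def by auto
  have "d (a \<oplus>\<^bsub>C\<^esub> b) = x [^] Suc n \<odot>\<^bsub>D\<^esub> (v \<oplus>\<^bsub>D\<^esub> v') \<oplus>\<^bsub>D\<^esub> x \<odot>\<^bsub>D\<^esub> d (c \<oplus>\<^bsub>C\<^esub> c')"
    using *(1-6) ND[OF *(3)] ND[OF *(4)] closed
    by (simp add: d.map_add *(7,8) d.N.smult_r_distr d.N.M.a_ac del: d.M.R.nat_pow_Suc)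
  then show "a \<oplus>\<^bsub>C\<^esub> b \<in> divisible_by n N"
    using * d.N.submoduleE(5)[OF N] by (intro divisible_byI[of _ "v \<oplus>\<^bsub>D\<^esub> v'" _ "c \<oplus>\<^bsub>C\<^esub> c'"]) auto
next
  have ND: "v \<in> carrier D" if "v \<in> N" for v using d.N.submoduleE(1)[OF N] that by blast
  fix r a assume r: "r \<in> carrier R" and "a \<in> divisible_by n N"
  then obtain v c where *: "a \<in> carrier C" "v \<in> N" "c \<in> carrier C"
    "d a = x [^] Suc n \<odot>\<^bsub>D\<^esub> v \<oplus>\<^bsub>D\<^esub> x \<odot>\<^bsub>D\<^esub> d c" unfolding divisible_by_def by auto
  have comm: "r \<odot>\<^bsub>D\<^esub> (s \<odot>\<^bsub>D\<^esub> u) = s \<odot>\<^bsub>D\<^esub> (r \<odot>\<^bsub>D\<^esub> u)" if "s \<in> carrier R" "u \<in> carrier D" for s u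
    using that r by (simp add: d.N.smult_assoc1[symmetric] d.M.R.m_comm)
  have "d (r \<odot>\<^bsub>C\<^esub> a) = x [^] Suc n \<odot>\<^bsub>D\<^esub> (r \<odot>\<^bsub>D\<^esub> v) \<oplus>\<^bsub>D\<^esub> x \<odot>\<^bsub>D\<^esub> d (r \<odot>\<^bsub>C\<^esub> c)"
    using *(1-3) ND[OF *(2)] r closed
    by (simp add: d.map_smult *(4) d.N.smult_r_distr comm del: d.M.R.nat_pow_Suc)
  then show "r \<odot>\<^bsub>C\<^esub> a \<in> divisible_by n N"
    using * r d.N.submoduleE(4)[OF N] by (intro divisible_byI[of _ "r \<odot>\<^bsub>D\<^esub> v" _ "r \<odot>\<^bsub>C\<^esub> c"]) auto
qed

lemma mod_boundaries_subset_divisible_by: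
  assumes N: "submodule N R D" shows "mod_boundaries \<subseteq> divisible_by n N"
proof
  fix w assume "w \<in> mod_boundaries"
  then obtain y c where w: "y \<in> Y" "c \<in> carrier C" "w = y \<oplus>\<^bsub>C\<^esub> x \<odot>\<^bsub>C\<^esub> c" unfolding mod_boundaries_def by blast
  then have "y \<in> carrier C" using d.M.submoduleE(1)[OF Y] by blast
  then show "w \<in> divisible_by n N"
    using w x d_Y d.N.submodule_zero[OF N] closed
    by (intro divisible_byI[of _ "\<zero>\<^bsub>D\<^esub>" _ c]) (auto simp: d.map_add d.map_smult)
qed

lemma divisible_by_subset_mod_cycles:
  assumes "N \<subseteq> carrier D" shows "divisible_by n N \<subseteq> mod_cycles"
proof
  fix w assume "w \<in> divisible_by n N"
  then obtain v c where *: "w \<in> carrier C" "v \<in> carrier D" "c \<in> carrier C"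
    "d w = x [^] Suc n \<odot>\<^bsub>D\<^esub> v \<oplus>\<^bsub>D\<^esub> x \<odot>\<^bsub>D\<^esub> d c"
    using assms unfolding divisible_by_def by auto
  then have "d w = x \<odot>\<^bsub>D\<^esub> (x [^] n \<odot>\<^bsub>D\<^esub> v \<oplus>\<^bsub>D\<^esub> d c)"
    using closed by (simp only: pow_Suc_smult d.N.smult_r_distr)
  then show "w \<in> mod_cycles" unfolding mod_cycles_def using * closed by auto
qed

lemma connecting_divisible:
  assumes u: "u \<in> Z" and N: "N \<subseteq> Z" and w: "w \<in> divisible_by n N"
    and dw: "d w = x [^] Suc n \<odot>\<^bsub>D\<^esub> u"
  shows "\<exists>v\<in>N. x [^] n \<odot>\<^bsub>D\<^esub> (u \<ominus>\<^bsub>D\<^esub> v) \<in> B"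
proof -
  obtain v c where *: "v \<in> N" "c \<in> carrier C"
    "d w = x [^] Suc n \<odot>\<^bsub>D\<^esub> v \<oplus>\<^bsub>D\<^esub> x \<odot>\<^bsub>D\<^esub> d c" using w unfolding divisible_by_def by auto
  have v: "v \<in> carrier D" and uD: "u \<in> carrier D" using *(1) N u Z_carrier by auto
  have "x \<odot>\<^bsub>D\<^esub> (x [^] n \<odot>\<^bsub>D\<^esub> u) = x [^] Suc n \<odot>\<^bsub>D\<^esub> v \<oplus>\<^bsub>D\<^esub> x \<odot>\<^bsub>D\<^esub> d c"
    unfolding pow_Suc_smult[OF uD, symmetric] dw[symmetric] by (rule *(3))
  also have "\<dots> = x \<odot>\<^bsub>D\<^esub> (x [^] n \<odot>\<^bsub>D\<^esub> v \<oplus>\<^bsub>D\<^esub> d c)"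
    unfolding pow_Suc_smult[OF v] using * v closed by (simp add: d.N.smult_r_distr)
  finally have "x [^] n \<odot>\<^bsub>D\<^esub> u = x [^] n \<odot>\<^bsub>D\<^esub> v \<oplus>\<^bsub>D\<^esub> d c"
    by (rule x_cancel[rotated 2]) (use v uD * closed in auto)
  then have "x [^] n \<odot>\<^bsub>D\<^esub> (u \<ominus>\<^bsub>D\<^esub> v) = d c"
    using v uD * closed by (simp add: d.N.smult_minus d.N.M.minus_eq_iff)
  then show ?thesis using * by auto
qed

text \<open>
  Induction on the power of \<open>x\<close> that kills the class of \<open>u\<close>.  In the step, \<open>w\<close> is a cocycle modulo
  \<open>x\<close> whose connecting image is the socle element \<open>x\<^sup>n u\<close>.
\<close>

lemma torsion_induct [consumes 1, case_names zero step]: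
  assumes u: "u \<in> Z"
    and zero: "\<And>u. u \<in> B \<Longrightarrow> P u"
    and step: "\<And>u n w. u \<in> Z \<Longrightarrow> w \<in> mod_cycles \<Longrightarrow> d w = x [^] Suc n \<odot>\<^bsub>D\<^esub> u \<Longrightarrow>
      (\<And>u'. u' \<in> Z \<Longrightarrow> x [^] n \<odot>\<^bsub>D\<^esub> u' \<in> B \<Longrightarrow> P u') \<Longrightarrow> P u"
  shows "P u"
proof -
  have "u \<in> Z \<Longrightarrow> x [^] n \<odot>\<^bsub>D\<^esub> u \<in> B \<Longrightarrow> P u" for n :: nat and u
  proof (induction n arbitrary: u)
    case 0
    then show ?case using zero Z_carrier by auto
  next
    case (Suc n)
    then obtain w where w: "w \<in> carrier C" "d w = x [^] Suc n \<odot>\<^bsub>D\<^esub> u" by (metis imageE)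
    then have "w \<in> mod_cycles" unfolding mod_cycles_def using pow_Suc_smult Suc.prems Z_carrier closed by auto
    then show ?case using step Suc w by blast
  qed
  then show ?thesis using torsion u by blast
qed

lemma B_subset_Z: "B \<subseteq> Z" using d_Z by auto

text \<open>
  By \<open>d_\<phi>_pow\<close> the submodule \<open>divisible_by n N\<close> is \<open>\<phi>\<close>-stable, and it contains \<open>\<phi> w\<close> if \<open>w\<close> has
  connecting image \<open>x\<^sup>n u\<close> with \<open>\<psi> u \<in> N\<close>.  So it contains \<open>w\<close>, so subtracting an element
  of \<open>N\<close> from \<open>u\<close> leaves a class killed by a smaller power of \<open>x\<close>.
\<close>

theorem anti_nilpotent:
  assumes anti: "anti_nilpotent_on_subquotient R C mod_cycles mod_boundaries \<phi>"
  shows "anti_nilpotent_on_subquotient R D Z B \<psi>"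
  unfolding anti_nilpotent_on_subquotient_def injective_on_subquotient_def
proof (intro allI impI ballI)
  fix N u assume N: "submodule N R D" "B \<subseteq> N" "N \<subseteq> Z" "\<psi> ` N \<subseteq> N"
  have ND: "v \<in> carrier D" if "v \<in> N" for v using N(3) that Z_carrier by auto
  have N_smult: "r \<odot>\<^bsub>D\<^esub> v \<in> N" if "r \<in> carrier R" "v \<in> N" for r v
    using d.N.submoduleE(4)[OF N(1)] that by auto
  assume "u \<in> Z" "\<psi> u \<in> N"
  then show "u \<in> N"
  proof (induction u rule: torsion_induct)
    case (zero u) then show ?case using N by auto
  next
    case (step u n w)
    let ?N = "divisible_by n N"
    have "\<phi> ` ?N \<subseteq> ?N"
    proof safe
      fix w assume "w \<in> ?N"
      then obtain v c where *: "w \<in> carrier C" "v \<in> N" "c \<in> carrier C"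
        "d w = x [^] Suc n \<odot>\<^bsub>D\<^esub> v \<oplus>\<^bsub>D\<^esub> x \<odot>\<^bsub>D\<^esub> d c" unfolding divisible_by_def by auto
      moreover have "x [^] ((p - 1) * Suc n) \<odot>\<^bsub>D\<^esub> \<psi> v \<in> N"
        using N(4) * N_smult closed by blast
      ultimately show "\<phi> w \<in> ?N"
        using d_\<phi>_pow[OF *(1) ND[OF *(2)] *(3,4)] closed by (intro divisible_byI) auto
    qed
    then have inj: "injective_on_subquotient mod_cycles ?N \<phi>"
      using anti submodule_divisible_by[OF N(1)] mod_boundaries_subset_divisible_by[OF N(1)]
        divisible_by_subset_mod_cycles[OF d.N.submoduleE(1)[OF N(1)]]
      unfolding anti_nilpotent_on_subquotient_def by simp
    have "d w = x [^] Suc n \<odot>\<^bsub>D\<^esub> u \<oplus>\<^bsub>D\<^esub> x \<odot>\<^bsub>D\<^esub> d \<zero>\<^bsub>C\<^esub>" and wC: "w \<in> carrier C"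
      using step Z_carrier closed by (auto simp: d.map_zero mod_cycles_def simp del: d.M.R.nat_pow_Suc)
    from d_\<phi>_pow[OF wC Z_carrier[OF step(1)] _ this(1)]
    have "\<phi> w \<in> ?N"
      using step.prems wC closed N_smult by (intro divisible_byI) auto
    then have "w \<in> ?N" using inj step unfolding injective_on_subquotient_def by blast
    from connecting_divisible[OF step(1) N(3) this step(3)] obtain v where
      v: "v \<in> N" "x [^] n \<odot>\<^bsub>D\<^esub> (u \<ominus>\<^bsub>D\<^esub> v) \<in> B" by blast
    \<comment> \<open>The induction hypothesis applies to \<open>u - v\<close>, which still has its image under \<open>\<psi>\<close> in \<open>N\<close>.\<close>
    have vZ: "v \<in> Z" using v N by auto
    have "\<psi> (u \<ominus>\<^bsub>D\<^esub> v) \<in> N"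
      using N(4) v(1) step.prems Z_carrier[OF step(1)] ND[OF v(1)] d.N.submodule_minus[OF N(1)]
      by (auto simp: \<psi>.map_minus)
    then have "u \<ominus>\<^bsub>D\<^esub> v \<in> N"
      using step.IH v vZ step(1) d.N.submodule_minus[OF Z] by blast
    then have "u \<ominus>\<^bsub>D\<^esub> v \<oplus>\<^bsub>D\<^esub> v \<in> N" using v d.N.submoduleE(5)[OF N(1)] by blast
    then show ?case
      using Z_carrier[OF step(1)] ND[OF v(1)] by (simp add: a_minus_def d.N.M.a_assoc d.N.M.l_neg)
  qed
qed

text \<open>
  If all connecting images are divisible by \<open>x\<^sup>n\<close>, then those of \<open>\<phi> ` mod_cycles\<close> are divisible by
  \<open>x\<^sup>n\<^sup>+\<^sup>1\<close>, as \<open>p \<ge> 2\<close>.  By fullness modulo \<open>x\<close> all connecting images are then divisible by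
  \<open>x\<^sup>n\<^sup>+\<^sup>1\<close>.  Hence every element of the socle is infinitely divisible by \<open>x\<close>.
\<close>

lemma socle_divisible:
  assumes full: "full_on_subquotient R C mod_cycles mod_boundaries \<phi>"
    and u: "u \<in> Z" "x \<odot>\<^bsub>D\<^esub> u \<in> B"
  shows "\<exists>v\<in>Z. u \<ominus>\<^bsub>D\<^esub> x [^] (n::nat) \<odot>\<^bsub>D\<^esub> v \<in> B"
proof -
  have cycles_divisible: "mod_cycles \<subseteq> divisible_by n (carrier D)" for n
  proof (induction n)
    case 0
    show ?case
    proof
      fix w assume "w \<in> mod_cycles"
      then obtain v where v: "w \<in> carrier C" "v \<in> carrier D" "d w = x \<odot>\<^bsub>D\<^esub> v" unfolding mod_cycles_def by auto
      then show "w \<in> divisible_by 0 (carrier D)"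
        using x by (intro divisible_byI[of _ v _ "\<zero>\<^bsub>C\<^esub>"]) (auto simp: d.map_zero)
    qed
  next
    case (Suc n)
    have "\<phi> ` mod_cycles \<subseteq> divisible_by (Suc n) (carrier D)"
    proof safe
      fix w assume "w \<in> mod_cycles"
      then obtain v c where *: "w \<in> carrier C" "v \<in> carrier D" "c \<in> carrier C"
        "d w = x [^] Suc n \<odot>\<^bsub>D\<^esub> v \<oplus>\<^bsub>D\<^esub> x \<odot>\<^bsub>D\<^esub> d c" using Suc.IH unfolding divisible_by_def by blast
      have "(p - 1) * Suc n \<noteq> 0" using p by simp
      then obtain k where k: "(p - 1) * Suc n = Suc k" by (metis not0_implies_Suc)
      have "x [^] Suc n \<odot>\<^bsub>D\<^esub> (x [^] ((p - 1) * Suc n) \<odot>\<^bsub>D\<^esub> \<psi> v) =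
        x [^] Suc (Suc n) \<odot>\<^bsub>D\<^esub> (x [^] k \<odot>\<^bsub>D\<^esub> \<psi> v)"
        unfolding k using pow_pow_smult[of "\<psi> v" "Suc n" "Suc k"] pow_pow_smult[of "\<psi> v" "Suc (Suc n)" k]
          \<psi>.map_closed[OF *(2)] by (simp only: add_Suc add_Suc_right)
      then show "\<phi> w \<in> divisible_by (Suc n) (carrier D)"
        using d_\<phi>_pow[OF *] * closed by (intro divisible_byI) auto
    qed
    then show ?case
      using full submodule_divisible_by[OF d.N.carrier_is_submodule]
        mod_boundaries_subset_divisible_by[OF d.N.carrier_is_submodule] unfolding full_on_subquotient_def by blast
  qed
  obtain w where w: "w \<in> carrier C" "d w = x \<odot>\<^bsub>D\<^esub> u" using u(2) by (metis imageE)
  have uD: "u \<in> carrier D" using u Z_carrier by auto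
  then have "w \<in> mod_cycles" using w unfolding mod_cycles_def by auto
  then obtain v c where *: "v \<in> carrier D" "c \<in> carrier C"
    "d w = x [^] Suc n \<odot>\<^bsub>D\<^esub> v \<oplus>\<^bsub>D\<^esub> x \<odot>\<^bsub>D\<^esub> d c" using cycles_divisible[of n] unfolding divisible_by_def by blast
  have "x \<odot>\<^bsub>D\<^esub> u = x \<odot>\<^bsub>D\<^esub> (x [^] n \<odot>\<^bsub>D\<^esub> v \<oplus>\<^bsub>D\<^esub> d c)"
    using w(2)[symmetric] *(3) unfolding pow_Suc_smult[OF *(1)]
    using *(1,2) closed by (simp add: d.N.smult_r_distr)
  then have "u = x [^] n \<odot>\<^bsub>D\<^esub> v \<oplus>\<^bsub>D\<^esub> d c"
    by (rule x_cancel[rotated 2]) (use * uD closed in auto)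
  then have eq: "x [^] n \<odot>\<^bsub>D\<^esub> v = u \<ominus>\<^bsub>D\<^esub> d c" and eq2: "u \<ominus>\<^bsub>D\<^esub> x [^] n \<odot>\<^bsub>D\<^esub> v = d c"
    using * uD closed d.N.M.a_comm d.N.M.minus_eq_iff[of u "d c" "x [^] n \<odot>\<^bsub>D\<^esub> v"]
      d.N.M.minus_eq_iff[of u "x [^] n \<odot>\<^bsub>D\<^esub> v" "d c"] by simp_all
  have "x [^] n \<odot>\<^bsub>D\<^esub> v \<in> Z"
    unfolding eq using u d_Z * by (intro d.N.submodule_minus[OF Z]) auto
  then have "v \<in> Z"
  proof (induction n)
    case 0 then show ?case using * by simp
  next
    case (Suc n)
    then show ?case using Z_saturated[of "x [^] n \<odot>\<^bsub>D\<^esub> v"] *(1) closed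
      unfolding pow_Suc_smult[OF *(1)] by simp
  qed
  then show ?thesis using eq2 * by auto
qed

text \<open>
  By \<open>socle_divisible\<close> a connecting image can be written as \<open>x\<^sup>n v\<close>.  Then \<open>d_\<phi>_pow\<close> places
  \<open>\<phi> ` mod_cycles\<close> in \<open>divisible_by n N\<close> for every submodule \<open>N\<close> that contains \<open>\<psi> ` Z\<close>, and
  fullness modulo \<open>x\<close> extends this to all of \<open>mod_cycles\<close>.
\<close>

theorem full:
  assumes full: "full_on_subquotient R C mod_cycles mod_boundaries \<phi>"
  shows "full_on_subquotient R D Z B \<psi>"
  unfolding full_on_subquotient_def
proof (intro allI impI subsetI)
  fix N u assume N: "submodule N R D" "B \<subseteq> N" "\<psi> ` Z \<subseteq> N"
  let ?N = "N \<inter> Z"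
  have sub: "submodule ?N R D"
    using d.N.submoduleE[OF N(1)] d.N.submoduleE[OF Z] d.N.submodule_zero N(1) Z
    by (intro d.N.submoduleI') auto
  assume "u \<in> Z"
  then show "u \<in> N"
  proof (induction u rule: torsion_induct)
    case (zero u) then show ?case using N by auto
  next
    case (step u n w)
    have "\<phi> ` mod_cycles \<subseteq> divisible_by n ?N"
    proof safe
      fix w assume "w \<in> mod_cycles"
      then obtain v where v: "w \<in> carrier C" "v \<in> carrier D" "d w = x \<odot>\<^bsub>D\<^esub> v" unfolding mod_cycles_def by auto
      then have xv: "x \<odot>\<^bsub>D\<^esub> v \<in> B" by (metis image_eqI)
      then have vZ: "v \<in> Z" using Z_saturated v B_subset_Z by auto
      obtain v1 where v1: "v1 \<in> Z" "v \<ominus>\<^bsub>D\<^esub> x [^] n \<odot>\<^bsub>D\<^esub> v1 \<in> B"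
        using socle_divisible[OF full vZ xv] by blast
      then obtain c where c: "c \<in> carrier C" "v \<ominus>\<^bsub>D\<^esub> x [^] n \<odot>\<^bsub>D\<^esub> v1 = d c" by auto
      have v1D: "v1 \<in> carrier D" using v1 Z_carrier by auto
      have "x [^] n \<odot>\<^bsub>D\<^esub> v1 \<oplus>\<^bsub>D\<^esub> d c = v"
        using c v v1D closed by (subst (asm) d.N.M.minus_eq_iff) auto
      then have "d w = x [^] Suc n \<odot>\<^bsub>D\<^esub> v1 \<oplus>\<^bsub>D\<^esub> x \<odot>\<^bsub>D\<^esub> d c"
        unfolding pow_Suc_smult[OF v1D] using v v1D c(1) closed by (simp add: d.N.smult_r_distr[symmetric])
      note * = d_\<phi>_pow[OF v(1) v1D c(1) this]
      have "x [^] ((p - 1) * Suc n) \<odot>\<^bsub>D\<^esub> \<psi> v1 \<in> ?N"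
        using N(3) v1 \<psi>_Z d.N.submoduleE(4)[OF sub] closed by blast
      then show "\<phi> w \<in> divisible_by n ?N" using * v c closed by (intro divisible_byI) auto
    qed
    then have "w \<in> divisible_by n ?N"
      using full submodule_divisible_by[OF sub] mod_boundaries_subset_divisible_by[OF sub] step(2)
      unfolding full_on_subquotient_def by blast
    from connecting_divisible[OF step(1) _ this step(3)] obtain v where
      v: "v \<in> N" "v \<in> Z" "x [^] n \<odot>\<^bsub>D\<^esub> (u \<ominus>\<^bsub>D\<^esub> v) \<in> B" by auto
    then have "u \<ominus>\<^bsub>D\<^esub> v \<in> N"
      using step.IH step(1) d.N.submodule_minus[OF Z] by blast
    then have "u \<ominus>\<^bsub>D\<^esub> v \<oplus>\<^bsub>D\<^esub> v \<in> N" using v d.N.submoduleE(5)[OF N(1)] by blast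
    then show ?case
      using Z_carrier[OF step(1)] Z_carrier[OF v(2)] by (simp add: a_minus_def d.N.M.a_assoc d.N.M.l_neg)
  qed
qed

text \<open>
  Surjectivity of multiplication by \<open>x\<close> in cohomology: the socle element \<open>x\<^sup>n u\<close> is divisible by
  \<open>x\<^sup>n\<^sup>+\<^sup>1\<close>, which reduces the claim to a class killed by \<open>x\<^sup>n\<close>.
\<close>

theorem divisible:
  assumes full: "full_on_subquotient R C mod_cycles mod_boundaries \<phi>" and u: "u \<in> Z"
  shows "\<exists>v\<in>Z. u \<ominus>\<^bsub>D\<^esub> x \<odot>\<^bsub>D\<^esub> v \<in> B"
  using u
proof (induction u rule: torsion_induct)
  case (zero u)
  then have "u \<in> carrier D" using B_subset_Z Z_carrier by auto
  then have "u \<ominus>\<^bsub>D\<^esub> x \<odot>\<^bsub>D\<^esub> \<zero>\<^bsub>D\<^esub> = u" using x by (simp add: d.N.M.minus_eq_iff)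
  then show ?case using d.N.submodule_zero[OF Z] zero by (metis (no_types, lifting))
next
  case (step u n w)
  have uD: "u \<in> carrier D" using step Z_carrier by auto
  have xu: "x [^] n \<odot>\<^bsub>D\<^esub> u \<in> Z" using d.N.submoduleE(4)[OF Z] closed step by blast
  moreover have "x \<odot>\<^bsub>D\<^esub> (x [^] n \<odot>\<^bsub>D\<^esub> u) \<in> B"
    using step(2,3) pow_Suc_smult[OF uD] unfolding mod_cycles_def by (auto simp del: d.M.R.nat_pow_Suc) (metis image_eqI)
  ultimately obtain v where v: "v \<in> Z" "x [^] n \<odot>\<^bsub>D\<^esub> u \<ominus>\<^bsub>D\<^esub> x [^] Suc n \<odot>\<^bsub>D\<^esub> v \<in> B"
    using socle_divisible[OF full] by meson
  have vD: "v \<in> carrier D" using v Z_carrier by auto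
  have xv: "x \<odot>\<^bsub>D\<^esub> v \<in> Z" using d.N.submoduleE(4)[OF Z] x v by blast
  have "x [^] n \<odot>\<^bsub>D\<^esub> (u \<ominus>\<^bsub>D\<^esub> x \<odot>\<^bsub>D\<^esub> v) \<in> B"
    using v(2) uD vD closed pow_pow_smult[of v n 1] by (simp add: d.N.smult_minus)
  then obtain v' where v': "v' \<in> Z" "u \<ominus>\<^bsub>D\<^esub> x \<odot>\<^bsub>D\<^esub> v \<ominus>\<^bsub>D\<^esub> x \<odot>\<^bsub>D\<^esub> v' \<in> B"
    using step.IH[of "u \<ominus>\<^bsub>D\<^esub> x \<odot>\<^bsub>D\<^esub> v"] d.N.submodule_minus[OF Z step(1) xv] by blast
  have "u \<ominus>\<^bsub>D\<^esub> x \<odot>\<^bsub>D\<^esub> (v \<oplus>\<^bsub>D\<^esub> v') = u \<ominus>\<^bsub>D\<^esub> x \<odot>\<^bsub>D\<^esub> v \<ominus>\<^bsub>D\<^esub> x \<odot>\<^bsub>D\<^esub> v'"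
    using uD vD Z_carrier[OF v'(1)] closed
    by (simp add: a_minus_def d.N.smult_r_distr d.N.M.minus_add d.N.M.a_ac)
  then show ?case using v v' d.N.submoduleE(5)[OF Z] by metis
qed

text \<open>
  The assumption on cycles says that the connecting map is injective: \<open>w\<close> is a coboundary modulo
  \<open>x\<close> as soon as its connecting image is one.
\<close>

theorem injective:
  assumes inj: "injective_on_subquotient mod_cycles mod_boundaries \<phi>"
    and cycles: "\<And>c. c \<in> carrier C \<Longrightarrow> d c = \<zero>\<^bsub>D\<^esub> \<Longrightarrow> c \<in> mod_boundaries"
  shows "injective_on_subquotient Z B \<psi>"
  unfolding injective_on_subquotient_def
proof (intro ballI impI)
  fix u assume "u \<in> Z" "\<psi> u \<in> B"
  then show "u \<in> B"
  proof (induction u rule: torsion_induct)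
    case (zero u) then show ?case by blast
  next
    case (step u n w)
    have uD: "u \<in> carrier D" and wC: "w \<in> carrier C" using step Z_carrier mod_cycles_def by auto
    obtain c where c: "c \<in> carrier C" "\<psi> u = d c" using step.prems by auto
    obtain k where k: "Suc n * p = Suc k" using p by (cases "Suc n * p") auto
    \<comment> \<open>Up to a coboundary modulo \<open>x\<close>, \<open>\<phi> w\<close> is a cycle, since \<open>\<psi> u\<close> is a boundary.\<close>
    have "d (\<phi> w) = (x [^] Suc n) [^] p \<odot>\<^bsub>D\<^esub> d c"
      using wC uD d_\<phi> step(3) c closed \<psi>.map_smult by (simp del: d.M.R.nat_pow_Suc)
    also have "\<dots> = d (x [^] Suc k \<odot>\<^bsub>C\<^esub> c)"
      unfolding k[symmetric] using c x by (simp only: d.map_smult d.M.R.nat_pow_pow d.M.R.nat_pow_closed)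
    finally have "d (\<phi> w \<ominus>\<^bsub>C\<^esub> x [^] Suc k \<odot>\<^bsub>C\<^esub> c) = \<zero>\<^bsub>D\<^esub>"
      using wC c(1) closed by (simp only: d.map_minus d.N.M.minus_eq_iff d.N.M.zero_closed d.N.M.r_zero)
    then have "\<phi> w \<ominus>\<^bsub>C\<^esub> x [^] Suc k \<odot>\<^bsub>C\<^esub> c \<in> mod_boundaries"
      using cycles wC c closed by (simp del: d.M.R.nat_pow_Suc)
    then obtain y b where y: "y \<in> Y" "b \<in> carrier C"
      "\<phi> w \<ominus>\<^bsub>C\<^esub> x [^] Suc k \<odot>\<^bsub>C\<^esub> c = y \<oplus>\<^bsub>C\<^esub> x \<odot>\<^bsub>C\<^esub> b" unfolding mod_boundaries_def by blast
    have yC: "y \<in> carrier C" using y d.M.submoduleE(1)[OF Y] by auto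
    have "\<phi> w = (\<phi> w \<ominus>\<^bsub>C\<^esub> x [^] Suc k \<odot>\<^bsub>C\<^esub> c) \<oplus>\<^bsub>C\<^esub> x [^] Suc k \<odot>\<^bsub>C\<^esub> c"
      using wC c closed by (simp add: a_minus_def d.M.M.a_assoc d.M.M.l_neg del: d.M.R.nat_pow_Suc)
    also have "\<dots> = y \<oplus>\<^bsub>C\<^esub> x \<odot>\<^bsub>C\<^esub> (b \<oplus>\<^bsub>C\<^esub> x [^] k \<odot>\<^bsub>C\<^esub> c)"
      using y yC c closed pow_pow_smult_C[of c 1 k]
      by (simp add: d.M.smult_r_distr d.M.M.a_assoc del: d.M.R.nat_pow_Suc)
    finally have "\<phi> w \<in> mod_boundaries" unfolding mod_boundaries_def using y c closed by blast
    then have "w \<in> mod_boundaries" using inj step unfolding injective_on_subquotient_def by blast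
    then obtain y' b' where y': "y' \<in> Y" "b' \<in> carrier C" "w = y' \<oplus>\<^bsub>C\<^esub> x \<odot>\<^bsub>C\<^esub> b'"
      unfolding mod_boundaries_def by blast
    have "y' \<in> carrier C" using y' d.M.submoduleE(1)[OF Y] by auto
    then have "x \<odot>\<^bsub>D\<^esub> (x [^] n \<odot>\<^bsub>D\<^esub> u) = x \<odot>\<^bsub>D\<^esub> d b'"
      using y'(1,2) d_Y[OF y'(1)] closed step(3)[symmetric]
      unfolding pow_Suc_smult[OF uD, symmetric] y'(3) by (simp add: d.map_add d.map_smult)
    then have "x [^] n \<odot>\<^bsub>D\<^esub> u = d b'" by (rule x_cancel[rotated 2]) (use uD y'(2) closed in auto)
    then have "x [^] n \<odot>\<^bsub>D\<^esub> u \<in> B" using y' by auto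
    then show ?case using step.IH step.prems step(1) by blast
  qed
qed

end

section \<open>The Frobenius endomorphism\<close>

lemma (in cring) binomial_theorem:
  assumes a: "a \<in> carrier R" and b: "b \<in> carrier R"
  shows "(a \<oplus> b) [^] n = (\<Oplus>k\<in>{..n}. [(n choose k)] \<cdot> (a [^] k \<otimes> b [^] (n - k)))"
proof (induction n)
  case 0
  then show ?case using assms by (simp add: finsum_0)
next
  case (Suc n)
  let ?t = "\<lambda>m k j. [(m choose k)] \<cdot> (a [^] k \<otimes> b [^] (j :: nat))"
  have "(a \<oplus> b) [^] Suc n =
      (\<Oplus>k\<in>{..n}. ?t n k (n - k)) \<otimes> a \<oplus> (\<Oplus>k\<in>{..n}. ?t n k (n - k)) \<otimes> b"
    using assms by (simp add: Suc.IH r_distr)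
  also have "(\<Oplus>k\<in>{..n}. ?t n k (n - k)) \<otimes> a =
      (\<Oplus>k\<in>{..n}. [(n choose k)] \<cdot> (a [^] Suc k \<otimes> b [^] (n - k)))"
  proof (subst finsum_ldistr)
    show "(\<Oplus>k\<in>{..n}. ?t n k (n - k) \<otimes> a) = (\<Oplus>k\<in>{..n}. [(n choose k)] \<cdot> (a [^] Suc k \<otimes> b [^] (n - k)))"
    proof (intro finsum_cong' refl)
      fix k
      have "a [^] k \<otimes> b [^] (n - k) \<otimes> a = a [^] Suc k \<otimes> b [^] (n - k)"
        using assms by (simp add: m_assoc m_comm[of _ a])
      then show "?t n k (n - k) \<otimes> a = [(n choose k)] \<cdot> (a [^] Suc k \<otimes> b [^] (n - k))"
        using assms by (subst add_pow_ldistr) auto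
    qed (use assms in auto)
  qed (use assms in auto)
  also have "(\<Oplus>k\<in>{..n}. ?t n k (n - k)) \<otimes> b = (\<Oplus>k\<in>{..Suc n}. ?t n k (Suc n - k))"
  proof -
    have "?t n k (n - k) \<otimes> b = ?t n k (Suc n - k)" if "k \<le> n" for k
      using assms that by (simp add: add_pow_ldistr m_assoc Suc_diff_le)
    then have "(\<Oplus>k\<in>{..n}. ?t n k (n - k) \<otimes> b) = (\<Oplus>k\<in>{..n}. ?t n k (Suc n - k))"
      using assms by (intro finsum_cong') auto
    moreover have "?t n (Suc n) (Suc n - Suc n) = \<zero>" using assms by (simp add: binomial_eq_0)
    ultimately show ?thesis using assms by (subst finsum_ldistr, simp, simp, simp, subst finsum_Suc) auto
  qed
  also have "\<dots> = (\<Oplus>k\<in>{..n}. ?t n (Suc k) (n - k)) \<oplus> b [^] Suc n"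
    using assms by (subst finsum_Suc2) auto
  also have "(\<Oplus>k\<in>{..n}. [(n choose k)] \<cdot> (a [^] Suc k \<otimes> b [^] (n - k))) \<oplus>
      ((\<Oplus>k\<in>{..n}. ?t n (Suc k) (n - k)) \<oplus> b [^] Suc n) =
      (\<Oplus>k\<in>{..n}. [(n choose k)] \<cdot> (a [^] Suc k \<otimes> b [^] (n - k)) \<oplus> ?t n (Suc k) (n - k)) \<oplus> b [^] Suc n"
    using assms by (subst finsum_addf) (auto simp: a_assoc)
  also have "(\<Oplus>k\<in>{..n}. [(n choose k)] \<cdot> (a [^] Suc k \<otimes> b [^] (n - k)) \<oplus> ?t n (Suc k) (n - k)) =
      (\<Oplus>k\<in>{..n}. ?t (Suc n) (Suc k) (n - k))"
    using assms by (intro finsum_cong') (auto simp: add.nat_pow_mult)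
  also have "\<dots> \<oplus> b [^] Suc n = (\<Oplus>k\<in>{..Suc n}. ?t (Suc n) k (Suc n - k))"
    using assms by (subst finsum_Suc2) auto
  finally show ?case .
qed

locale char_p_ring = cring R for R (structure) +
  fixes p :: nat
  assumes prime: "prime p" and char_p: "[p] \<cdot> \<one> = \<zero>"
begin

lemma multiple_of_p: "a \<in> carrier R \<Longrightarrow> p dvd m \<Longrightarrow> [m] \<cdot> a = \<zero>"
proof -
  assume a: "a \<in> carrier R" and "p dvd m"
  then obtain q where m: "m = p * q" by auto
  have "[p] \<cdot> a = [p] \<cdot> (\<one> \<otimes> a)" using a by simp
  also have "\<dots> = \<zero>" using a char_p by (subst add_pow_ldistr[symmetric]) auto
  finally have "[p] \<cdot> a = \<zero>" .
  then show ?thesis using a unfolding m by (simp add: add.nat_pow_pow[symmetric])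
qed

lemma frobenius_add:
  assumes "a \<in> carrier R" "b \<in> carrier R"
  shows "(a \<oplus> b) [^] p = a [^] p \<oplus> b [^] p"
proof -
  let ?t = "\<lambda>k. [(p choose k)] \<cdot> (a [^] k \<otimes> b [^] (p - k))"
  have t: "?t k \<in> carrier R" for k using assms by auto
  obtain q where q: "p = Suc q" using prime by (metis not0_implies_Suc not_prime_0)
  have "finsum R ?t {..j} = b [^] p" if "j \<le> q" for j
    using that
  proof (induction j)
    case 0
    then show ?case using assms by (simp add: finsum_0)
  next
    case (Suc j)
    have "p dvd (p choose Suc j)" using prime Suc.prems q by (intro dvd_choose_prime) auto
    then have "?t (Suc j) = \<zero>" using assms by (intro multiple_of_p) auto
    then show ?case using Suc t assms by (subst finsum_Suc) auto
  qed
  then have lower: "finsum R ?t {..q} = b [^] p" by simp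
  have "(a \<oplus> b) [^] p = finsum R ?t {..p}" by (rule binomial_theorem[OF assms])
  also have "{..p} = {..Suc q}" by (simp only: q)
  also have "finsum R ?t {..Suc q} = ?t (Suc q) \<oplus> finsum R ?t {..q}"
    using t by (intro finsum_Suc) blast
  also have "?t (Suc q) = ?t p" by (simp only: q)
  also have "\<dots> = a [^] p" using assms by simp
  finally show ?thesis unfolding lower .
qed

lemma frobenius_neg_one: "(\<ominus> \<one>) [^] p = \<ominus> \<one>"
proof -
  have "p > 0" using prime prime_gt_0_nat by blast
  then have "\<one> \<oplus> (\<ominus> \<one>) [^] p = \<zero>"
    using frobenius_add[of \<one> "\<ominus> \<one>"] by (simp add: r_neg nat_pow_zero)
  then show ?thesis using minus_equality[of "(\<ominus> \<one>) [^] p" \<one>] by (simp add: a_comm)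
qed

lemma frobenius_iterate_add:
  assumes "a \<in> carrier R" "b \<in> carrier R"
  shows "(a \<oplus> b) [^] (p ^ e) = a [^] (p ^ e) \<oplus> b [^] (p ^ e)"
proof (induction e)
  case 0 then show ?case using assms by simp
next
  case (Suc e)
  then show ?case using assms frobenius_add[of "a [^] (p ^ e)" "b [^] (p ^ e)"]
    by (simp add: nat_pow_pow[symmetric] mult.commute[of p])
qed

end

section \<open>Localization\<close>

lemma (in cring) pow_mult_pow_mult:
  "f \<in> carrier R \<Longrightarrow> a \<in> carrier R \<Longrightarrow> f [^] (i::nat) \<otimes> (f [^] (j::nat) \<otimes> a) = f [^] (i + j) \<otimes> a"
  by (simp add: m_assoc[symmetric] nat_pow_mult)

locale localization = cring R for R (structure) +
  fixes f
  assumes f: "f \<in> carrier R"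
begin

abbreviation frac where "frac a n \<equiv> fraction R f a n"
abbreviation L where "L \<equiv> localize R f"

lemma frac_self: "a \<in> carrier R \<Longrightarrow> (a, n) \<in> frac a n"
  by (auto simp: fraction_def)

lemma frac_subset:
  assumes a: "a \<in> carrier R" and b: "b \<in> carrier R"
    and eq: "f [^] (k + m) \<otimes> a = f [^] (k + n) \<otimes> b"
  shows "frac a n \<subseteq> frac b m"
proof (clarsimp simp: fraction_def)
  fix c q l assume c: "c \<in> carrier R" and h: "f [^] (l + q) \<otimes> a = f [^] ((l::nat) + n) \<otimes> c"
  have "f [^] (l + q + k + n) \<otimes> b = f [^] (l + q) \<otimes> (f [^] (k + n) \<otimes> b)"
    using f b by (simp add: pow_mult_pow_mult add_ac)
  also have "\<dots> = f [^] (k + m) \<otimes> (f [^] (l + q) \<otimes> a)"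
    using f a by (simp add: eq[symmetric] pow_mult_pow_mult add_ac)
  also have "\<dots> = f [^] (l + n + k + m) \<otimes> c"
    using f c by (simp add: h pow_mult_pow_mult add_ac)
  finally have "f [^] (l + k + n + q) \<otimes> b = f [^] (l + k + n + m) \<otimes> c" by (simp add: add_ac)
  then show "\<exists>k. f [^] (k + q) \<otimes> b = f [^] ((k::nat) + m) \<otimes> c" by blast
qed

lemma frac_eqI:
  assumes "a \<in> carrier R" "b \<in> carrier R" "f [^] (k + m) \<otimes> a = f [^] (k + n) \<otimes> b"
  shows "frac a n = frac b m"
  using frac_subset[OF assms] frac_subset[OF assms(2,1) assms(3)[symmetric]] by (rule subset_antisym)

lemma frac_eqD:
  assumes "frac a n = frac b m" "b \<in> carrier R"
  shows "\<exists>k::nat. f [^] (k + m) \<otimes> a = f [^] (k + n) \<otimes> b"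
  using frac_self[OF assms(2), of m] unfolding assms(1)[symmetric] by (auto simp: fraction_def)

lemma frac_zero_iff:
  assumes a: "a \<in> carrier R"
  shows "frac a n = frac \<zero> m \<longleftrightarrow> (\<exists>k::nat. f [^] k \<otimes> a = \<zero>)"
proof
  assume "frac a n = frac \<zero> m"
  from frac_eqD[OF this] show "\<exists>k::nat. f [^] k \<otimes> a = \<zero>" using f by auto
next
  assume "\<exists>k::nat. f [^] k \<otimes> a = \<zero>"
  then obtain k :: nat where k: "f [^] k \<otimes> a = \<zero>" by blast
  have "f [^] (k + m) \<otimes> a = f [^] m \<otimes> (f [^] k \<otimes> a)" using f a by (simp add: pow_mult_pow_mult add_ac)
  then have "f [^] (k + m) \<otimes> a = f [^] (k + n) \<otimes> \<zero>" using f k by simp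
  then show "frac a n = frac \<zero> m" using a by (intro frac_eqI) auto
qed

lemma frac_expand:
  "a \<in> carrier R \<Longrightarrow> frac (f [^] k \<otimes> a) (n + k) = frac a n"
  using f by (intro frac_eqI[where k = 0]) (auto simp: pow_mult_pow_mult)

lemma frac_reps:
  assumes a: "a \<in> carrier R" and bm: "(b, m) \<in> frac a n"
  obtains k :: nat where "b \<in> carrier R" "f [^] (k + m) \<otimes> a = f [^] (k + n) \<otimes> b"
  using bm by (auto simp: fraction_def)

text \<open>
  The operations on fractions are unions over all representatives; this evaluates such a union at
  one representative.
\<close>

lemma union_reps:
  assumes a: "a \<in> carrier R"
    and h: "\<And>b m k. b \<in> carrier R \<Longrightarrow> f [^] (k + m) \<otimes> a = f [^] ((k::nat) + n) \<otimes> b \<Longrightarrow> h b m = h a n"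
  shows "(\<Union>(b, m)\<in>frac a n. h b m) = h a n"
proof
  show "(\<Union>(b, m)\<in>frac a n. h b m) \<subseteq> h a n"
  proof (clarsimp)
    fix b m u assume "(b, m) \<in> frac a n" "u \<in> h b m"
    then show "u \<in> h a n" using h frac_reps[OF a] by metis
  qed
  show "h a n \<subseteq> (\<Union>(b, m)\<in>frac a n. h b m)" using frac_self[OF a, of n] by fastforce
qed

lemma carrier_L: "carrier L = {frac a n | a n. a \<in> carrier R}"
  by (simp add: localize_def)

lemma frac_closed [simp]: "a \<in> carrier R \<Longrightarrow> frac a n \<in> carrier L"
  by (auto simp: carrier_L)

lemma zero_L: "\<zero>\<^bsub>L\<^esub> = frac \<zero> 0"
  by (simp add: localize_def)

lemma smult_frac:
  assumes "r \<in> carrier R" "a \<in> carrier R"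
  shows "r \<odot>\<^bsub>L\<^esub> frac a n = frac (r \<otimes> a) n"
proof -
  have "(\<Union>(b, m)\<in>frac a n. frac (r \<otimes> b) m) = frac (r \<otimes> a) n"
  proof (rule union_reps)
    fix b m k assume b: "b \<in> carrier R" and eq: "f [^] (k + m) \<otimes> a = f [^] ((k::nat) + n) \<otimes> b"
    have "f [^] (k + n) \<otimes> (r \<otimes> b) = r \<otimes> (f [^] (k + n) \<otimes> b)" using assms b f by (simp add: m_lcomm)
    also have "\<dots> = f [^] (k + m) \<otimes> (r \<otimes> a)" using assms b f by (simp add: eq[symmetric] m_lcomm)
    finally show "frac (r \<otimes> b) m = frac (r \<otimes> a) n" using assms b by (intro frac_eqI) auto
  qed (use assms in auto)
  then show ?thesis by (simp add: localize_def)
qed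

lemma add_frac_general:
  assumes a: "a \<in> carrier R" and b: "b \<in> carrier R"
  shows "frac a n \<oplus>\<^bsub>L\<^esub> frac b m = frac (f [^] m \<otimes> a \<oplus> f [^] n \<otimes> b) (n + m)"
proof -
  let ?h = "\<lambda>a n b m. frac (f [^] m \<otimes> a \<oplus> f [^] n \<otimes> b) (n + m)"
  have change: "?h a' n' b m = ?h a n b m"
    if "a \<in> carrier R" "b \<in> carrier R" "a' \<in> carrier R" "f [^] (k + n') \<otimes> a = f [^] ((k::nat) + n) \<otimes> a'"
    for a n b m a' n' k
  proof (rule frac_eqI[where k = k])
    have "f [^] (k + (n + m)) \<otimes> (f [^] m \<otimes> a') = f [^] (m + m) \<otimes> (f [^] (k + n) \<otimes> a')"
      using that f by (simp add: pow_mult_pow_mult add_ac)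
    also have "\<dots> = f [^] (k + (n' + m)) \<otimes> (f [^] m \<otimes> a)"
      unfolding that(4)[symmetric] using that(1-3) f by (simp add: pow_mult_pow_mult add_ac)
    finally show "f [^] (k + (n + m)) \<otimes> (f [^] m \<otimes> a' \<oplus> f [^] n' \<otimes> b) =
        f [^] (k + (n' + m)) \<otimes> (f [^] m \<otimes> a \<oplus> f [^] n \<otimes> b)"
      using that f by (simp add: r_distr) (simp add: pow_mult_pow_mult add_ac)
  qed (use that f in auto)
  have sym: "?h a n b m = ?h b m a n" if "a \<in> carrier R" "b \<in> carrier R" for a n b m
    using that f by (simp add: a_comm add.commute)
  have "(\<Union>(a', n')\<in>frac a n. \<Union>(b', m')\<in>frac b m. ?h a' n' b' m') = (\<Union>(b', m')\<in>frac b m. ?h a n b' m')"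
  proof (rule union_reps[OF a])
    fix a' n' k assume *: "a' \<in> carrier R" "f [^] (k + n') \<otimes> a = f [^] ((k::nat) + n) \<otimes> a'"
    have "?h a' n' b' m' = ?h a n b' m'" if "(b', m') \<in> frac b m" for b' m'
      using change[OF a _ *] that by (auto simp: fraction_def)
    then show "(\<Union>(b', m')\<in>frac b m. ?h a' n' b' m') = (\<Union>(b', m')\<in>frac b m. ?h a n b' m')"
      by (intro SUP_cong) auto
  qed
  also have "\<dots> = ?h a n b m"
  proof (rule union_reps[OF b])
    fix b' m' k assume *: "b' \<in> carrier R" "f [^] (k + m') \<otimes> b = f [^] ((k::nat) + m) \<otimes> b'"
    have "?h a n b' m' = ?h b' m' a n" using sym a * by blast
    also have "\<dots> = ?h b m a n" using change[OF b a *] .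
    also have "\<dots> = ?h a n b m" using sym a b by blast
    finally show "?h a n b' m' = ?h a n b m" .
  qed
  finally show ?thesis by (simp add: localize_def)
qed

lemma add_frac:
  assumes "a \<in> carrier R" "b \<in> carrier R"
  shows "frac a n \<oplus>\<^bsub>L\<^esub> frac b n = frac (a \<oplus> b) n"
  using assms f frac_expand[of "a \<oplus> b" n n] by (simp add: add_frac_general r_distr)

lemma fraction_cases:
  assumes "X \<in> carrier L" obtains a n where "a \<in> carrier R" "X = frac a n"
  using assms by (auto simp: carrier_L)

lemma common_denominator:
  assumes "X \<in> carrier L" "Y \<in> carrier L"
  obtains a b n where "a \<in> carrier R" "b \<in> carrier R" "X = frac a n" "Y = frac b n"
proof -
  obtain a n b m where *: "a \<in> carrier R" "X = frac a n" "b \<in> carrier R" "Y = frac b m"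
    using assms fraction_cases by metis
  show ?thesis
    using that[of "f [^] m \<otimes> a" "f [^] n \<otimes> b" "n + m"] * f frac_expand[of a m n] frac_expand[of b n m]
    by (simp add: add.commute)
qed

lemma common_denominator3:
  assumes "X \<in> carrier L" "Y \<in> carrier L" "U \<in> carrier L"
  obtains a b c n where "a \<in> carrier R" "b \<in> carrier R" "c \<in> carrier R"
    "X = frac a n" "Y = frac b n" "U = frac c n"
proof -
  obtain a b n where ab: "a \<in> carrier R" "b \<in> carrier R" "X = frac a n" "Y = frac b n"
    using assms common_denominator by metis
  obtain c m where c: "c \<in> carrier R" "U = frac c m" using assms fraction_cases by metis
  show ?thesis
    using that[of "f [^] m \<otimes> a" "f [^] m \<otimes> b" "f [^] n \<otimes> c" "n + m"] ab c f
      frac_expand[of a m n] frac_expand[of b m n] frac_expand[of c n m]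
    by (simp add: add.commute)
qed

lemma zero_L_frac: "\<zero>\<^bsub>L\<^esub> = frac \<zero> n"
  using frac_zero_iff[of \<zero> 0 n] f by (auto simp: zero_L)

sublocale L: module R L
proof (rule moduleI)
  show "abelian_group L"
  proof (rule abelian_groupI)
    fix X Y U assume X: "X \<in> carrier L" and Y: "Y \<in> carrier L" and U: "U \<in> carrier L"
    obtain a b c n where *: "a \<in> carrier R" "b \<in> carrier R" "c \<in> carrier R"
      "X = frac a n" "Y = frac b n" "U = frac c n" using common_denominator3[OF X Y U] .
    show "X \<oplus>\<^bsub>L\<^esub> Y \<in> carrier L" "X \<oplus>\<^bsub>L\<^esub> Y = Y \<oplus>\<^bsub>L\<^esub> X"
      "X \<oplus>\<^bsub>L\<^esub> Y \<oplus>\<^bsub>L\<^esub> U = X \<oplus>\<^bsub>L\<^esub> (Y \<oplus>\<^bsub>L\<^esub> U)"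
      using *(1-3) unfolding *(4-6) by (simp_all add: add_frac a_ac)
  next
    show "\<zero>\<^bsub>L\<^esub> \<in> carrier L" by (simp add: zero_L)
    fix X assume "X \<in> carrier L"
    then obtain a n where *: "a \<in> carrier R" "X = frac a n" by (rule fraction_cases)
    show "\<zero>\<^bsub>L\<^esub> \<oplus>\<^bsub>L\<^esub> X = X" using *(1) unfolding *(2) zero_L_frac[of n] by (simp add: add_frac)
    have "frac (\<ominus> a) n \<oplus>\<^bsub>L\<^esub> X = \<zero>\<^bsub>L\<^esub>"
      using *(1) unfolding *(2) zero_L_frac[of n] by (simp add: add_frac l_neg)
    then show "\<exists>Y\<in>carrier L. Y \<oplus>\<^bsub>L\<^esub> X = \<zero>\<^bsub>L\<^esub>" by (rule bexI) (use *(1) in simp)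
  qed
next
  fix X assume X: "X \<in> carrier L"
  obtain a n where *: "a \<in> carrier R" "X = frac a n" using fraction_cases[OF X] .
  show "\<one> \<odot>\<^bsub>L\<^esub> X = X" using *(1) unfolding *(2) by (simp add: smult_frac)
  fix r assume r: "r \<in> carrier R"
  show "r \<odot>\<^bsub>L\<^esub> X \<in> carrier L" using *(1) r unfolding *(2) by (simp add: smult_frac)
  fix s assume s: "s \<in> carrier R"
  show "(r \<oplus> s) \<odot>\<^bsub>L\<^esub> X = r \<odot>\<^bsub>L\<^esub> X \<oplus>\<^bsub>L\<^esub> s \<odot>\<^bsub>L\<^esub> X"
    "(r \<otimes> s) \<odot>\<^bsub>L\<^esub> X = r \<odot>\<^bsub>L\<^esub> (s \<odot>\<^bsub>L\<^esub> X)"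
    using *(1) r s unfolding *(2) by (simp_all add: smult_frac add_frac l_distr m_assoc)
next
  fix r X Y assume r: "r \<in> carrier R" and X: "X \<in> carrier L" and Y: "Y \<in> carrier L"
  obtain a b n where *: "a \<in> carrier R" "b \<in> carrier R" "X = frac a n" "Y = frac b n"
    using common_denominator[OF X Y] .
  show "r \<odot>\<^bsub>L\<^esub> (X \<oplus>\<^bsub>L\<^esub> Y) = r \<odot>\<^bsub>L\<^esub> X \<oplus>\<^bsub>L\<^esub> r \<odot>\<^bsub>L\<^esub> Y"
    using *(1,2) r unfolding *(3,4) by (simp add: add_frac smult_frac r_distr)
qed (rule is_cring)

lemma regular_on_localization:
  assumes x: "x \<in> carrier R" and reg: "\<And>a. a \<in> carrier R \<Longrightarrow> x \<otimes> a = \<zero> \<Longrightarrow> a = \<zero>"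
    and X: "X \<in> carrier L" and zero: "x \<odot>\<^bsub>L\<^esub> X = \<zero>\<^bsub>L\<^esub>"
  shows "X = \<zero>\<^bsub>L\<^esub>"
proof -
  obtain a n where *: "a \<in> carrier R" "X = frac a n" using fraction_cases[OF X] .
  then obtain k :: nat where "f [^] k \<otimes> (x \<otimes> a) = \<zero>"
    using zero x frac_zero_iff by (auto simp: smult_frac zero_L)
  then have "x \<otimes> (f [^] k \<otimes> a) = \<zero>" using f x * by (simp add: m_lcomm)
  then have "f [^] k \<otimes> a = \<zero>" using reg f * by simp
  then show ?thesis using * frac_zero_iff by (auto simp: zero_L)
qed

end

locale localization_map = localization R f + fg: localization R "f \<otimes> g" for R (structure) and f g +
  assumes g: "g \<in> carrier R"
begin

lemma localize_map_frac:
  assumes a: "a \<in> carrier R"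
  shows "localize_map R f g (frac a n) = fg.frac (a \<otimes> g [^] n) n"
  unfolding localize_map_def
proof (rule union_reps[OF a])
  fix b m k assume b: "b \<in> carrier R" and eq: "f [^] (k + m) \<otimes> a = f [^] ((k::nat) + n) \<otimes> b"
  have *: "(f \<otimes> g) [^] (k + i) \<otimes> (c \<otimes> g [^] j) = g [^] (k + i + j) \<otimes> (f [^] (k + i) \<otimes> c)"
    if "c \<in> carrier R" for c and i j :: nat
  proof -
    have "(f \<otimes> g) [^] (k + i) \<otimes> (c \<otimes> g [^] j) = (f [^] (k + i) \<otimes> g [^] (k + i)) \<otimes> (c \<otimes> g [^] j)"
      using f g by (simp add: nat_pow_distrib)
    also have "\<dots> = (g [^] (k + i) \<otimes> g [^] j) \<otimes> (f [^] (k + i) \<otimes> c)"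
      using f g that by (simp add: m_ac)
    finally show ?thesis using g by (simp add: nat_pow_mult)
  qed
  show "fg.frac (b \<otimes> g [^] m) m = fg.frac (a \<otimes> g [^] n) n"
    using a b g by (intro fg.frac_eqI[where k = k]) (auto simp: * eq add_ac)
qed

lemma localize_map_semilinear:
  "semilinear_map R (localize R f) R (localize R (f \<otimes> g)) (\<lambda>r. r) (localize_map R f g)"
proof (intro semilinear_map.intro L.module_axioms fg.L.module_axioms semilinear_map_axioms.intro)
  fix X Y r assume X: "X \<in> carrier L" and Y: "Y \<in> carrier L"
  obtain a b n where *: "a \<in> carrier R" "b \<in> carrier R" "X = frac a n" "Y = frac b n"
    using common_denominator[OF X Y] .
  then show "localize_map R f g (X \<oplus>\<^bsub>L\<^esub> Y) = localize_map R f g X \<oplus>\<^bsub>fg.L\<^esub> localize_map R f g Y"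
    using g by (simp add: add_frac fg.add_frac localize_map_frac l_distr)
next
  fix X assume X: "X \<in> carrier L"
  obtain a n where *: "a \<in> carrier R" "X = frac a n" using fraction_cases[OF X] .
  then show "localize_map R f g X \<in> carrier fg.L"
    using g by (simp add: localize_map_frac)
  fix r assume r: "r \<in> carrier R"
  then show "localize_map R f g (r \<odot>\<^bsub>L\<^esub> X) = r \<odot>\<^bsub>fg.L\<^esub> localize_map R f g X"
    using g * by (simp add: smult_frac fg.smult_frac localize_map_frac m_assoc)
qed

text \<open>
  Kernel and cokernel of the localization map at \<open>g\<close> are \<open>g\<close>-power torsion.  This is why Cech
  cohomology is torsion.
\<close>

lemma localize_map_eq_zero:
  assumes X: "X \<in> carrier L" and zero: "localize_map R f g X = \<zero>\<^bsub>fg.L\<^esub>"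
  shows "\<exists>k::nat. g [^] k \<odot>\<^bsub>L\<^esub> X = \<zero>\<^bsub>L\<^esub>"
proof -
  obtain a n where *: "a \<in> carrier R" "X = frac a n" using fraction_cases[OF X] .
  have "fg.frac (a \<otimes> g [^] n) n = fg.frac \<zero> 0" using zero * by (simp add: localize_map_frac fg.zero_L)
  then obtain k :: nat where k: "(f \<otimes> g) [^] k \<otimes> (a \<otimes> g [^] n) = \<zero>"
    using fg.frac_zero_iff * g by auto
  have "f [^] k \<otimes> (g [^] (k + n) \<otimes> a) = (f \<otimes> g) [^] k \<otimes> (a \<otimes> g [^] n)"
    using f g * by (simp add: nat_pow_distrib nat_pow_mult[symmetric] m_ac)
  then have "frac (g [^] (k + n) \<otimes> a) n = frac \<zero> 0" using k frac_zero_iff * g by auto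
  then have "g [^] (k + n) \<odot>\<^bsub>L\<^esub> X = \<zero>\<^bsub>L\<^esub>" using * g by (simp add: smult_frac zero_L)
  then show ?thesis by blast
qed

lemma localize_map_lift:
  assumes X: "X \<in> carrier fg.L"
  shows "\<exists>n::nat. \<exists>Y\<in>carrier L. localize_map R f g Y = g [^] n \<odot>\<^bsub>fg.L\<^esub> X"
proof -
  obtain a n where *: "a \<in> carrier R" "X = fg.frac a n" using fg.fraction_cases[OF X] .
  then have "localize_map R f g (frac a n) = g [^] n \<odot>\<^bsub>fg.L\<^esub> X"
    using g by (simp add: localize_map_frac fg.smult_frac m_comm)
  then show ?thesis using * by (metis frac_closed)
qed

end

lemma (in cring) localization_mapI:
  "f \<in> carrier R \<Longrightarrow> g \<in> carrier R \<Longrightarrow> localization_map R f g"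
  by unfold_locales auto

lemma (in cring) localize_map_comp_commute:
  assumes f: "f \<in> carrier R" and g: "g \<in> carrier R" and h: "h \<in> carrier R"
    and X: "X \<in> carrier (localize R f)"
  shows "localize_map R (f \<otimes> g) h (localize_map R f g X) = localize_map R (f \<otimes> h) g (localize_map R f h X)"
proof -
  interpret fg: localization_map R f g using f g by (rule localization_mapI)
  interpret fh: localization_map R f h using f h by (rule localization_mapI)
  interpret fgh: localization_map R "f \<otimes> g" h using f g h by (intro localization_mapI) auto
  interpret fhg: localization_map R "f \<otimes> h" g using f g h by (intro localization_mapI) auto
  obtain a n where *: "a \<in> carrier R" "X = fg.frac a n" using fg.fraction_cases[OF X] .
  have "f \<otimes> g \<otimes> h = f \<otimes> h \<otimes> g" "a \<otimes> g [^] n \<otimes> h [^] n = a \<otimes> h [^] n \<otimes> g [^] n"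
    using f g h * by (simp_all add: m_ac)
  then show ?thesis
    using * g h by (simp add: fg.localize_map_frac fh.localize_map_frac fgh.localize_map_frac fhg.localize_map_frac)
qed

context char_p_ring begin

lemma localize_frob_frac:
  assumes f: "f \<in> carrier R" and a: "a \<in> carrier R"
  shows "localize_frob p R f (fraction R f a n) = fraction R f (a [^] p) (p * n)"
proof -
  interpret localization R f using f by unfold_locales
  show ?thesis
    unfolding localize_frob_def
  proof (rule union_reps[OF a])
    fix b m k assume b: "b \<in> carrier R" and eq: "f [^] (k + m) \<otimes> a = f [^] ((k::nat) + n) \<otimes> b"
    have *: "f [^] (p * k + p * i) \<otimes> c [^] p = (f [^] (k + i) \<otimes> c) [^] p" if "c \<in> carrier R" for c i
      using that f by (simp add: nat_pow_distrib nat_pow_pow distrib_left mult.commute[of _ p])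
    show "frac (b [^] p) (p * m) = frac (a [^] p) (p * n)"
      using a b by (intro frac_eqI[where k = "p * k"]) (auto simp: * eq)
  qed
qed

lemma localize_frob_semilinear:
  assumes f: "f \<in> carrier R"
  shows "semilinear_map R (localize R f) R (localize R f) (\<lambda>r. r [^] p) (localize_frob p R f)"
proof -
  interpret localization R f using f by unfold_locales
  show ?thesis
  proof (intro semilinear_map.intro L.module_axioms semilinear_map_axioms.intro)
    fix X Y assume X: "X \<in> carrier L" and Y: "Y \<in> carrier L"
    obtain a b n where *: "a \<in> carrier R" "b \<in> carrier R" "X = frac a n" "Y = frac b n"
      using common_denominator[OF X Y] .
    then show "localize_frob p R f (X \<oplus>\<^bsub>L\<^esub> Y) = localize_frob p R f X \<oplus>\<^bsub>L\<^esub> localize_frob p R f Y"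
      by (simp add: add_frac localize_frob_frac[OF f] frobenius_add)
  next
    fix X assume X: "X \<in> carrier L"
    obtain a n where *: "a \<in> carrier R" "X = frac a n" using fraction_cases[OF X] .
    then show "localize_frob p R f X \<in> carrier L"
      by (simp add: localize_frob_frac[OF f])
    fix r assume r: "r \<in> carrier R"
    then show "localize_frob p R f (r \<odot>\<^bsub>L\<^esub> X) = r [^] p \<odot>\<^bsub>L\<^esub> localize_frob p R f X"
      using * by (simp add: smult_frac localize_frob_frac[OF f] nat_pow_distrib)
  qed auto
qed

lemma localize_map_frob:
  assumes f: "f \<in> carrier R" and g: "g \<in> carrier R" and X: "X \<in> carrier (localize R f)"
  shows "localize_map R f g (localize_frob p R f X) = localize_frob p R (f \<otimes> g) (localize_map R f g X)"
proof -
  interpret localization_map R f g using f g by (rule localization_mapI)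
  obtain a n where *: "a \<in> carrier R" "X = frac a n" using fraction_cases[OF X] .
  then show ?thesis
    using f g by (simp add: localize_frob_frac localize_map_frac nat_pow_distrib nat_pow_pow mult.commute)
qed

end

section \<open>Localization and ring homomorphisms\<close>

definition localize_hom ::
    "('c, 'd) ring_scheme \<Rightarrow> ('a \<Rightarrow> 'c) \<Rightarrow> 'a \<Rightarrow> ('a \<times> nat) set \<Rightarrow> ('c \<times> nat) set"
  where "localize_hom S \<sigma> f X = (\<Union>(a, n)\<in>X. fraction S (\<sigma> f) (\<sigma> a) n)"

locale localization_hom = ring_hom_cring R S \<sigma> + Rf: localization R f + Sf: localization S "\<sigma> f"
  for R S \<sigma> f
begin

lemma localize_hom_frac:
  assumes a: "a \<in> carrier R"
  shows "localize_hom S \<sigma> f (Rf.frac a n) = Sf.frac (\<sigma> a) n"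
  unfolding localize_hom_def
proof (rule Rf.union_reps[OF a])
  fix b m k assume b: "b \<in> carrier R"
    and eq: "f [^]\<^bsub>R\<^esub> (k + m) \<otimes>\<^bsub>R\<^esub> a = f [^]\<^bsub>R\<^esub> ((k::nat) + n) \<otimes>\<^bsub>R\<^esub> b"
  have "\<sigma> (f [^]\<^bsub>R\<^esub> (k + m) \<otimes>\<^bsub>R\<^esub> a) = \<sigma> (f [^]\<^bsub>R\<^esub> ((k::nat) + n) \<otimes>\<^bsub>R\<^esub> b)" using eq by simp
  then show "Sf.frac (\<sigma> b) m = Sf.frac (\<sigma> a) n"
    using a b Rf.f by (intro Sf.frac_eqI[where k = k]) (auto simp: ring.hom_nat_pow)
qed

lemma localize_hom_semilinear:
  "semilinear_map R (localize R f) S (localize S (\<sigma> f)) \<sigma> (localize_hom S \<sigma> f)"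
proof (intro semilinear_map.intro Rf.L.module_axioms Sf.L.module_axioms semilinear_map_axioms.intro)
  fix X Y r assume X: "X \<in> carrier Rf.L" and Y: "Y \<in> carrier Rf.L"
  obtain a b n where *: "a \<in> carrier R" "b \<in> carrier R" "X = Rf.frac a n" "Y = Rf.frac b n"
    using Rf.common_denominator[OF X Y] .
  then show "localize_hom S \<sigma> f (X \<oplus>\<^bsub>Rf.L\<^esub> Y) = localize_hom S \<sigma> f X \<oplus>\<^bsub>Sf.L\<^esub> localize_hom S \<sigma> f Y"
    by (simp add: Rf.add_frac Sf.add_frac localize_hom_frac)
next
  fix X assume X: "X \<in> carrier Rf.L"
  obtain a n where *: "a \<in> carrier R" "X = Rf.frac a n" using Rf.fraction_cases[OF X] .
  then show "localize_hom S \<sigma> f X \<in> carrier Sf.L"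
    by (simp add: localize_hom_frac)
  fix r assume r: "r \<in> carrier R"
  then show "localize_hom S \<sigma> f (r \<odot>\<^bsub>Rf.L\<^esub> X) = \<sigma> r \<odot>\<^bsub>Sf.L\<^esub> localize_hom S \<sigma> f X"
    using * by (simp add: Rf.smult_frac Sf.smult_frac localize_hom_frac)
qed auto

lemma localize_hom_surj:
  assumes surj: "\<sigma> ` carrier R = carrier S" and X: "X \<in> carrier Sf.L"
  shows "\<exists>Y\<in>carrier Rf.L. localize_hom S \<sigma> f Y = X"
proof -
  obtain a n where *: "a \<in> carrier S" "X = Sf.frac a n" using Sf.fraction_cases[OF X] .
  then obtain b where "b \<in> carrier R" "a = \<sigma> b" using surj by auto
  then show ?thesis using * localize_hom_frac by (metis Rf.frac_closed)
qed

text \<open>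
  A fraction \<open>a / f\<^sup>n\<close> that vanishes after reduction has a numerator with \<open>f\<^sup>k a \<in> x R\<close>, and it can
  be expanded by \<open>f\<^sup>k\<close>.
\<close>

lemma localize_hom_kernel:
  assumes x: "x \<in> carrier R" and ker: "\<And>a. a \<in> carrier R \<Longrightarrow> \<sigma> a = \<zero>\<^bsub>S\<^esub> \<Longrightarrow> \<exists>b\<in>carrier R. a = x \<otimes>\<^bsub>R\<^esub> b"
    and X: "X \<in> carrier Rf.L" and zero: "localize_hom S \<sigma> f X = \<zero>\<^bsub>Sf.L\<^esub>"
  shows "\<exists>Y\<in>carrier Rf.L. X = x \<odot>\<^bsub>Rf.L\<^esub> Y"
proof -
  obtain a n where *: "a \<in> carrier R" "X = Rf.frac a n" using Rf.fraction_cases[OF X] .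
  have "Sf.frac (\<sigma> a) n = Sf.frac \<zero>\<^bsub>S\<^esub> 0" using zero * by (simp add: localize_hom_frac Sf.zero_L)
  then obtain k :: nat where "\<sigma> f [^]\<^bsub>S\<^esub> k \<otimes>\<^bsub>S\<^esub> \<sigma> a = \<zero>\<^bsub>S\<^esub>" using Sf.frac_zero_iff * by auto
  then have "\<sigma> (f [^]\<^bsub>R\<^esub> k \<otimes>\<^bsub>R\<^esub> a) = \<zero>\<^bsub>S\<^esub>" using Rf.f * by (simp add: ring.hom_nat_pow)
  then obtain b where b: "b \<in> carrier R" "f [^]\<^bsub>R\<^esub> k \<otimes>\<^bsub>R\<^esub> a = x \<otimes>\<^bsub>R\<^esub> b"
    using ker[of "f [^]\<^bsub>R\<^esub> k \<otimes>\<^bsub>R\<^esub> a"] Rf.f * by blast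
  have "X = Rf.frac (x \<otimes>\<^bsub>R\<^esub> b) (n + k)" using Rf.frac_expand[of a k n] * b by simp
  also have "\<dots> = x \<odot>\<^bsub>Rf.L\<^esub> Rf.frac b (n + k)" using x b by (simp add: Rf.smult_frac)
  finally show ?thesis by (rule bexI) (use b(1) in simp)
qed

end

lemma (in ring_hom_cring) localization_homI:
  "f \<in> carrier R \<Longrightarrow> localization_hom R S h f"
  by unfold_locales auto

lemma (in ring_hom_cring) localize_hom_map:
  assumes f: "f \<in> carrier R" and g: "g \<in> carrier R" and X: "X \<in> carrier (localize R f)"
  shows "localize_hom S h (f \<otimes>\<^bsub>R\<^esub> g) (localize_map R f g X) = localize_map S (h f) (h g) (localize_hom S h f X)"
proof -
  interpret f: localization_hom R S h f using f by (rule localization_homI)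
  interpret fg: localization_hom R S h "f \<otimes>\<^bsub>R\<^esub> g" using f g by (intro localization_homI) auto
  interpret R: localization_map R f g using f g by (rule R.localization_mapI)
  interpret S: localization_map S "h f" "h g" using f g by (intro S.localization_mapI) auto
  obtain a n where *: "a \<in> carrier R" "X = f.Rf.frac a n" using f.Rf.fraction_cases[OF X] .
  then show ?thesis
    using f g S.localize_map_frac[of "h a" n] fg.localize_hom_frac[of "a \<otimes>\<^bsub>R\<^esub> g [^]\<^bsub>R\<^esub> n" n]
    by (simp add: R.localize_map_frac f.localize_hom_frac ring.hom_nat_pow)
qed

lemma (in ring_hom_cring) localize_hom_frob:
  assumes "char_p_ring R p" "char_p_ring S p"
    and f: "f \<in> carrier R" and X: "X \<in> carrier (localize R f)"
  shows "localize_hom S h f (localize_frob p R f X) = localize_frob p S (h f) (localize_hom S h f X)"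
proof -
  interpret f: localization_hom R S h f using f by (rule localization_homI)
  obtain a n where *: "a \<in> carrier R" "X = f.Rf.frac a n" using f.Rf.fraction_cases[OF X] .
  then show ?thesis
    using f char_p_ring.localize_frob_frac[OF assms(1) f] char_p_ring.localize_frob_frac[OF assms(2), of "h f"]
    by (simp add: f.localize_hom_frac ring.hom_nat_pow)
qed

section \<open>The Cech complex\<close>

text \<open>
  The cancellation behind \<open>d d = 0\<close>: removing \<open>j\<close> and then \<open>k\<close> cancels against removing \<open>k\<close> and
  then \<open>j\<close>.
\<close>

lemma (in abelian_group) finsum_antisymmetric:
  assumes "finite J" and "\<And>j k. j \<in> J \<Longrightarrow> k \<in> J \<Longrightarrow> j \<noteq> k \<Longrightarrow> a j k \<in> carrier G"
    and "\<And>j k. j \<in> J \<Longrightarrow> k \<in> J \<Longrightarrow> j \<noteq> k \<Longrightarrow> a j k \<oplus> a k j = \<zero>"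
  shows "(\<Oplus>j\<in>J. \<Oplus>k\<in>J - {j}. a j k) = \<zero>"
  using assms
proof (induction J)
  case empty
  then show ?case by simp
next
  case (insert i J)
  have cl: "a j k \<in> carrier G" if "j \<in> insert i J" "k \<in> insert i J" "j \<noteq> k" for j k
    using that insert.prems(1) by blast
  have inner: "(\<Oplus>k\<in>insert i J - {j}. a j k) = a j i \<oplus> (\<Oplus>k\<in>J - {j}. a j k)" if "j \<in> J" for j
  proof -
    have "insert i J - {j} = insert i (J - {j})" using that insert.hyps by auto
    moreover have "j \<noteq> i" using that insert.hyps by auto
    ultimately show ?thesis
      using that insert.hyps cl by (simp only:) (intro finsum_insert, auto)
  qed
  have "(\<Oplus>j\<in>insert i J. \<Oplus>k\<in>insert i J - {j}. a j k) =
      (\<Oplus>k\<in>insert i J - {i}. a i k) \<oplus> (\<Oplus>j\<in>J. \<Oplus>k\<in>insert i J - {j}. a j k)"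
    using insert.hyps cl by (intro finsum_insert) (auto intro!: finsum_closed)
  also have "insert i J - {i} = J" using insert.hyps by auto
  also have "(\<Oplus>j\<in>J. \<Oplus>k\<in>insert i J - {j}. a j k) = (\<Oplus>j\<in>J. a j i \<oplus> (\<Oplus>k\<in>J - {j}. a j k))"
    using insert.hyps cl by (intro finsum_cong') (auto simp: inner intro!: a_closed finsum_closed)
  also have "\<dots> = (\<Oplus>j\<in>J. a j i) \<oplus> (\<Oplus>j\<in>J. \<Oplus>k\<in>J - {j}. a j k)"
    using insert.hyps cl by (intro finsum_addf) (auto intro!: finsum_closed)
  also have "(\<Oplus>j\<in>J. \<Oplus>k\<in>J - {j}. a j k) = \<zero>" using insert by auto
  also have "(\<Oplus>k\<in>J. a i k) \<oplus> ((\<Oplus>j\<in>J. a j i) \<oplus> \<zero>) = (\<Oplus>k\<in>J. a i k \<oplus> a k i)"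
  proof -
    have "(\<Oplus>j\<in>J. a j i) \<in> carrier G" using insert.hyps cl by (intro finsum_closed) auto
    then show ?thesis using insert.hyps cl by (subst finsum_addf) auto
  qed
  also have "\<dots> = (\<Oplus>k\<in>J. \<zero>)"
    using insert.hyps insert.prems(2) by (intro finsum_cong') auto
  finally show ?case by simp
qed

locale cech_complex = char_p_ring R p for R (structure) and p +
  fixes gs :: "'a list"
  assumes gs_carrier: "set gs \<subseteq> carrier R"
begin

abbreviation I where "I \<equiv> cech_index gs"
abbreviation g where "g \<equiv> cech_elem R gs"
abbreviation L where "L J \<equiv> localize R (g J)"
abbreviation C where "C \<equiv> cech R gs"
abbreviation d where "d \<equiv> cech_diff R gs"
abbreviation frob where "frob \<equiv> cech_frob p R gs"

lemma finite_index: "finite (I i)"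
  by (rule finite_subset[of _ "Pow {..<length gs}"]) (auto simp: cech_index_def)

lemma index_finite: "J \<in> I i \<Longrightarrow> finite J"
  by (auto simp: cech_index_def intro: finite_subset)

lemma gs_nth: "J \<in> I i \<Longrightarrow> j \<in> J \<Longrightarrow> gs ! j \<in> carrier R"
  using gs_carrier by (auto simp: cech_index_def subset_iff)

lemma index_remove: "J \<in> I (Suc i) \<Longrightarrow> j \<in> J \<Longrightarrow> J - {j} \<in> I i"
  by (auto simp: cech_index_def card_Diff_singleton)

lemma index_insert: "J \<in> I i \<Longrightarrow> j < length gs \<Longrightarrow> j \<notin> J \<Longrightarrow> insert j J \<in> I (Suc i)"
  using index_finite[of J i] by (auto simp: cech_index_def)

lemma g_closed: "J \<in> I i \<Longrightarrow> g J \<in> carrier R"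
  unfolding cech_elem_def using gs_nth by (intro finprod_closed) auto

lemma g_remove:
  assumes "J \<in> I i" "j \<in> J" shows "g J = g (J - {j}) \<otimes> gs ! j"
proof -
  have "(\<Otimes>k\<in>insert j (J - {j}). gs ! k) = gs ! j \<otimes> (\<Otimes>k\<in>J - {j}. gs ! k)"
    using assms index_finite gs_nth by (intro finprod_insert) auto
  moreover have "(\<Otimes>k\<in>J - {j}. gs ! k) \<in> carrier R" using assms gs_nth by (intro finprod_closed) auto
  ultimately show ?thesis
    unfolding cech_elem_def using assms gs_nth[OF assms] by (simp add: insert_absorb m_comm)
qed

lemma L_module: "J \<in> I i \<Longrightarrow> module R (L J)"
proof -
  assume "J \<in> I i"
  then interpret J: localization R "g J" using g_closed by unfold_locales
  show ?thesis by (rule J.L.module_axioms)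
qed

lemma carrier_C: "c \<in> carrier (C i) \<longleftrightarrow> (\<forall>J\<in>I i. c J \<in> carrier (L J)) \<and> c \<in> extensional (I i)"
  by (simp add: cech_def PiE_iff)

lemma C_nth: "c \<in> carrier (C i) \<Longrightarrow> J \<in> I i \<Longrightarrow> c J \<in> carrier (L J)"
  by (simp add: carrier_C)

lemma C_ext:
  "c \<in> carrier (C i) \<Longrightarrow> c' \<in> carrier (C i) \<Longrightarrow> (\<And>J. J \<in> I i \<Longrightarrow> c J = c' J) \<Longrightarrow> c = c'"
  unfolding carrier_C by (auto intro: extensionalityI)

lemma zero_C: "\<zero>\<^bsub>C i\<^esub> = (\<lambda>J\<in>I i. \<zero>\<^bsub>L J\<^esub>)"
  and add_C: "c \<oplus>\<^bsub>C i\<^esub> c' = (\<lambda>J\<in>I i. c J \<oplus>\<^bsub>L J\<^esub> c' J)"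
  and smult_C: "r \<odot>\<^bsub>C i\<^esub> c = (\<lambda>J\<in>I i. r \<odot>\<^bsub>L J\<^esub> c J)"
  by (simp_all add: cech_def)

lemma C_module: "module R (C i)"
proof (rule moduleI)
  show "cring R" by (rule is_cring)
  have G: "abelian_group (L J)" if "J \<in> I i" for J using L_module[OF that] by (simp add: module_def)
  note G' = abelian_group.axioms(1)[OF G]
  show "abelian_group (C i)"
  proof (rule abelian_groupI)
    fix a b c assume abc: "a \<in> carrier (C i)" "b \<in> carrier (C i)" "c \<in> carrier (C i)"
    show ab: "a \<oplus>\<^bsub>C i\<^esub> b \<in> carrier (C i)"
      using abc G' by (auto simp: carrier_C add_C intro: abelian_monoid.a_closed)
    show "a \<oplus>\<^bsub>C i\<^esub> b = b \<oplus>\<^bsub>C i\<^esub> a"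
      using abc G' unfolding add_C carrier_C by (intro restrict_ext abelian_monoid.a_comm) auto
    show "a \<oplus>\<^bsub>C i\<^esub> b \<oplus>\<^bsub>C i\<^esub> c = a \<oplus>\<^bsub>C i\<^esub> (b \<oplus>\<^bsub>C i\<^esub> c)"
      using abc G' unfolding add_C carrier_C by (intro restrict_ext) (simp add: abelian_monoid.a_assoc)
  next
    show "\<zero>\<^bsub>C i\<^esub> \<in> carrier (C i)"
      using G' by (auto simp: carrier_C zero_C intro: abelian_monoid.zero_closed)
    fix a assume a: "a \<in> carrier (C i)"
    show "\<zero>\<^bsub>C i\<^esub> \<oplus>\<^bsub>C i\<^esub> a = a"
    proof (rule extensionalityI)
      show "a \<in> extensional (I i)" using a by (simp add: carrier_C)
    qed (use a in \<open>simp_all add: add_C zero_C carrier_C abelian_monoid.l_zero[OF G']\<close>)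
    define b where "b = (\<lambda>J\<in>I i. \<ominus>\<^bsub>L J\<^esub> a J)"
    have "b \<in> carrier (C i)"
      using a G unfolding b_def carrier_C by (auto intro: abelian_group.a_inv_closed)
    moreover have "b \<oplus>\<^bsub>C i\<^esub> a = \<zero>\<^bsub>C i\<^esub>"
      unfolding add_C zero_C using a by (intro restrict_ext) (simp add: b_def carrier_C abelian_group.l_neg[OF G])
    ultimately show "\<exists>b\<in>carrier (C i). b \<oplus>\<^bsub>C i\<^esub> a = \<zero>\<^bsub>C i\<^esub>" by blast
  qed
  fix a assume a: "a \<in> carrier (C i)"
  show "\<one> \<odot>\<^bsub>C i\<^esub> a = a"
  proof (rule extensionalityI)
    show "a \<in> extensional (I i)" using a by (simp add: carrier_C)
  qed (use a in \<open>simp_all add: smult_C carrier_C module.smult_one[OF L_module]\<close>)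
  fix r assume r: "r \<in> carrier R"
  show "r \<odot>\<^bsub>C i\<^esub> a \<in> carrier (C i)"
    using a r L_module by (auto simp: smult_C carrier_C intro: module.smult_closed)
  fix s assume s: "s \<in> carrier R"
  show "(r \<oplus> s) \<odot>\<^bsub>C i\<^esub> a = r \<odot>\<^bsub>C i\<^esub> a \<oplus>\<^bsub>C i\<^esub> s \<odot>\<^bsub>C i\<^esub> a"
    unfolding smult_C add_C using a r s L_module
    by (intro restrict_ext) (simp add: carrier_C module.smult_l_distr[OF L_module])
  show "(r \<otimes> s) \<odot>\<^bsub>C i\<^esub> a = r \<odot>\<^bsub>C i\<^esub> (s \<odot>\<^bsub>C i\<^esub> a)"
    unfolding smult_C using a r s L_module
    by (intro restrict_ext) (simp add: carrier_C module.smult_assoc1[OF L_module])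
next
  fix r a b assume "r \<in> carrier R" "a \<in> carrier (C i)" "b \<in> carrier (C i)"
  then show "r \<odot>\<^bsub>C i\<^esub> (a \<oplus>\<^bsub>C i\<^esub> b) = r \<odot>\<^bsub>C i\<^esub> a \<oplus>\<^bsub>C i\<^esub> r \<odot>\<^bsub>C i\<^esub> b"
    unfolding smult_C add_C using L_module
    by (intro restrict_ext) (simp add: carrier_C module.smult_r_distr[OF L_module])
qed

sublocale C: module R "C i" for i by (rule C_module)

lemma localize_map_semilinear_index:
  assumes "J \<in> I (Suc i)" "j \<in> J"
  shows "semilinear_map R (L (J - {j})) R (L J) (\<lambda>r. r) (localize_map R (g (J - {j})) (gs ! j))"
proof -
  interpret m: localization_map R "g (J - {j})" "gs ! j"
    using g_closed[OF index_remove[OF assms]] gs_nth[OF assms] by (rule localization_mapI)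
  show ?thesis unfolding g_remove[OF assms] by (rule m.localize_map_semilinear)
qed

definition sign :: "nat set \<Rightarrow> nat \<Rightarrow> 'a" where
  "sign J j = (\<ominus> \<one>) [^] card {k \<in> J. k < j}"

lemma sign_closed: "sign J j \<in> carrier R"
  by (simp add: sign_def)

lemma sign_square: "sign J j \<otimes> sign J j = \<one>"
proof -
  have "(\<ominus> \<one>) [^] n \<otimes> (\<ominus> \<one>) [^] n = \<one>" for n :: nat
    by (subst nat_pow_distrib[symmetric]) (auto simp: l_minus)
  then show ?thesis by (simp add: sign_def)
qed

text \<open>
  Signs are fixed by Frobenius since \<open>(- 1)\<^sup>p = - 1\<close> in characteristic \<open>p\<close>, also for \<open>p = 2\<close>.
\<close>

lemma sign_frob: "sign J j [^] p = sign J j"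
  unfolding sign_def using nat_pow_pow[of "\<ominus> \<one>" "card {k \<in> J. k < j}" p]
    nat_pow_pow[of "\<ominus> \<one>" p "card {k \<in> J. k < j}"] by (simp add: frobenius_neg_one mult.commute)

lemma sign_antisymmetric:
  assumes "finite J" "j \<in> J" "k \<in> J" "j \<noteq> k"
  shows "sign J j \<otimes> sign (J - {j}) k \<oplus> sign J k \<otimes> sign (J - {k}) j = \<zero>"
proof -
  have *: "sign J j \<otimes> sign (J - {j}) k \<oplus> sign J k \<otimes> sign (J - {k}) j = \<zero>"
    if "j \<in> J" "k \<in> J" "k < j" for j k
  proof -
    have "{l \<in> J. l < j} = insert k {l \<in> J - {k}. l < j}" using that by auto
    moreover have "finite {l \<in> J - {k}. l < j}" using assms by simp
    ultimately have 1: "card {l \<in> J. l < j} = Suc (card {l \<in> J - {k}. l < j})" by simp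
    have 2: "{l \<in> J - {j}. l < k} = {l \<in> J. l < k}" using that by auto
    have "sign J j = \<ominus> sign (J - {k}) j" "sign (J - {j}) k = sign J k"
      unfolding sign_def 1 2 by (simp_all add: r_minus)
    then show ?thesis
      using sign_closed[of J k] sign_closed[of "J - {k}" j] by (simp add: l_minus m_comm[of "sign J k"] l_neg)
  qed
  show ?thesis
  proof (cases "k < j")
    case True then show ?thesis using * assms by blast
  next
    case False
    then have "sign J k \<otimes> sign (J - {k}) j \<oplus> sign J j \<otimes> sign (J - {j}) k = \<zero>" using *[of k j] assms by simp
    then show ?thesis using sign_closed by (subst a_comm) auto
  qed
qed

definition face :: "nat set \<Rightarrow> nat \<Rightarrow> (nat set \<Rightarrow> ('a \<times> nat) set) \<Rightarrow> ('a \<times> nat) set" where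
  "face J j c = sign J j \<odot>\<^bsub>L J\<^esub> localize_map R (g (J - {j})) (gs ! j) (c (J - {j}))"

lemma cech_diff_face: "J \<in> I (Suc i) \<Longrightarrow> d i c J = (\<Oplus>\<^bsub>L J\<^esub>j\<in>J. face J j c)"
  by (simp add: cech_diff_def face_def sign_def)

lemma face_semilinear:
  assumes J: "J \<in> I (Suc i)" and j: "j \<in> J"
  shows "semilinear_map R (C i) R (L J) (\<lambda>r. r) (face J j)"
proof -
  interpret m: semilinear_map R "L (J - {j})" R "L J" "\<lambda>r. r" "localize_map R (g (J - {j})) (gs ! j)"
    by (rule localize_map_semilinear_index[OF J j])
  note J' = index_remove[OF J j]
  show ?thesis
  proof (intro semilinear_map.intro C_module L_module[OF J] semilinear_map_axioms.intro)
    fix u v assume uv: "u \<in> carrier (C i)" "v \<in> carrier (C i)"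
    show "face J j u \<in> carrier (L J)"
      using uv J' C_nth m.map_closed sign_closed by (simp add: face_def)
    show "face J j (u \<oplus>\<^bsub>C i\<^esub> v) = face J j u \<oplus>\<^bsub>L J\<^esub> face J j v"
      using uv J' C_nth[OF _ J'] m.map_closed sign_closed
      by (simp add: face_def add_C m.map_add m.N.smult_r_distr)
  next
    fix r u assume "r \<in> carrier R" "u \<in> carrier (C i)"
    then show "face J j (r \<odot>\<^bsub>C i\<^esub> u) = r \<odot>\<^bsub>L J\<^esub> face J j u"
      using J' C_nth[OF _ J'] m.map_closed sign_closed
      by (simp add: face_def smult_C m.map_smult m.N.smult_assoc1[symmetric] m_comm)
  qed auto
qed

lemma d_semilinear: "semilinear_map R (C i) R (C (Suc i)) (\<lambda>r. r) (d i)"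
proof (intro semilinear_map.intro C_module semilinear_map_axioms.intro)
  have fl: "face J j u \<in> carrier (L J)" if "J \<in> I (Suc i)" "j \<in> J" "u \<in> carrier (C i)" for J j u
    using semilinear_map.map_closed[OF face_semilinear] that by blast
  have G: "abelian_monoid (L J)" if "J \<in> I (Suc i)" for J
    using L_module[OF that] by (simp add: module_def abelian_group_def)
  {
    fix u assume u: "u \<in> carrier (C i)"
    show "d i u \<in> carrier (C (Suc i))"
      unfolding carrier_C
    proof (intro conjI ballI)
      show "d i u \<in> extensional (I (Suc i))" by (simp add: cech_diff_def)
      fix J assume "J \<in> I (Suc i)"
      then show "d i u J \<in> carrier (L J)"
        using G fl u by (simp add: cech_diff_face) (intro abelian_monoid.finsum_closed, auto)
    qed
  }
  note closed = this
  {
    fix u v assume uv: "u \<in> carrier (C i)" "v \<in> carrier (C i)"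
    show "d i (u \<oplus>\<^bsub>C i\<^esub> v) = d i u \<oplus>\<^bsub>C (Suc i)\<^esub> d i v"
    proof (rule C_ext)
      fix J assume J: "J \<in> I (Suc i)"
      interpret LJ: module R "L J" by (rule L_module[OF J])
      have "d i (u \<oplus>\<^bsub>C i\<^esub> v) J = (\<Oplus>\<^bsub>L J\<^esub>j\<in>J. face J j u \<oplus>\<^bsub>L J\<^esub> face J j v)"
        unfolding cech_diff_face[OF J] using fl[OF J] uv semilinear_map.map_add[OF face_semilinear[OF J]]
        by (intro LJ.M.finsum_cong') auto
      also have "\<dots> = d i u J \<oplus>\<^bsub>L J\<^esub> d i v J"
        unfolding cech_diff_face[OF J] using fl[OF J] uv by (intro LJ.M.finsum_addf) auto
      finally show "d i (u \<oplus>\<^bsub>C i\<^esub> v) J = (d i u \<oplus>\<^bsub>C (Suc i)\<^esub> d i v) J" using J by (simp add: add_C)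
    qed (use uv closed in auto)
  }
  {
    fix r u assume ru: "r \<in> carrier R" "u \<in> carrier (C i)"
    show "d i (r \<odot>\<^bsub>C i\<^esub> u) = r \<odot>\<^bsub>C (Suc i)\<^esub> d i u"
    proof (rule C_ext)
      fix J assume J: "J \<in> I (Suc i)"
      interpret LJ: module R "L J" by (rule L_module[OF J])
      have "d i (r \<odot>\<^bsub>C i\<^esub> u) J = (\<Oplus>\<^bsub>L J\<^esub>j\<in>J. r \<odot>\<^bsub>L J\<^esub> face J j u)"
        unfolding cech_diff_face[OF J] using fl[OF J] ru semilinear_map.map_smult[OF face_semilinear[OF J]]
        by (intro LJ.M.finsum_cong') auto
      also have "\<dots> = r \<odot>\<^bsub>L J\<^esub> d i u J"
        unfolding cech_diff_face[OF J] using fl[OF J] ru index_finite[OF J]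
        by (intro LJ.finsum_smult_ldistr[symmetric]) auto
      finally show "d i (r \<odot>\<^bsub>C i\<^esub> u) J = (r \<odot>\<^bsub>C (Suc i)\<^esub> d i u) J" using J by (simp add: smult_C)
    qed (use ru closed in auto)
  }
qed auto

sublocale d: semilinear_map R "C i" R "C (Suc i)" "\<lambda>r. r" "d i" for i
  by (rule d_semilinear)

lemma frob_semilinear: "semilinear_map R (C i) R (C i) (\<lambda>r. r [^] p) (frob i)"
proof (intro semilinear_map.intro C_module semilinear_map_axioms.intro)
  fix u v r assume u: "u \<in> carrier (C i)"
  note F = localize_frob_semilinear[OF g_closed]
  show closed: "frob i u \<in> carrier (C i)"
    using u semilinear_map.map_closed[OF F] by (auto simp: cech_frob_def carrier_C)
  show "frob i (u \<oplus>\<^bsub>C i\<^esub> v) = frob i u \<oplus>\<^bsub>C i\<^esub> frob i v" if v: "v \<in> carrier (C i)"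
    unfolding cech_frob_def add_C using u v semilinear_map.map_add[OF F] by (intro restrict_ext) (auto simp: carrier_C)
  show "frob i (r \<odot>\<^bsub>C i\<^esub> u) = r [^] p \<odot>\<^bsub>C i\<^esub> frob i u" if r: "r \<in> carrier R"
    unfolding cech_frob_def smult_C using u r semilinear_map.map_smult[OF F] by (intro restrict_ext) (auto simp: carrier_C)
qed auto

sublocale frob: semilinear_map R "C i" R "C i" "\<lambda>r. r [^] p" "frob i" for i
  by (rule frob_semilinear)

lemma face_frob:
  assumes J: "J \<in> I (Suc i)" and j: "j \<in> J" and c: "c \<in> carrier (C i)"
  shows "face J j (frob i c) = localize_frob p R (g J) (face J j c)"
proof -
  interpret m: semilinear_map R "L (J - {j})" R "L J" "\<lambda>r. r" "localize_map R (g (J - {j})) (gs ! j)"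
    by (rule localize_map_semilinear_index[OF J j])
  interpret F: semilinear_map R "L J" R "L J" "\<lambda>r. r [^] p" "localize_frob p R (g J)"
    by (rule localize_frob_semilinear[OF g_closed[OF J]])
  note J' = index_remove[OF J j]
  show ?thesis
    using localize_map_frob[OF g_closed[OF J'] gs_nth[OF J j] C_nth[OF c J']] J' C_nth[OF c J'] sign_closed
    by (simp add: face_def cech_frob_def F.map_smult m.map_closed sign_frob g_remove[OF J j, symmetric])
qed

lemma d_frob:
  assumes c: "c \<in> carrier (C i)"
  shows "d i (frob i c) = frob (Suc i) (d i c)"
proof (rule C_ext)
  fix J assume J: "J \<in> I (Suc i)"
  interpret LJ: module R "L J" by (rule L_module[OF J])
  interpret F: semilinear_map R "L J" R "L J" "\<lambda>r. r [^] p" "localize_frob p R (g J)"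
    by (rule localize_frob_semilinear[OF g_closed[OF J]])
  have fl: "face J j c \<in> carrier (L J)" if "j \<in> J" for j
    using semilinear_map.map_closed[OF face_semilinear[OF J]] that c by blast
  have "d i (frob i c) J = (\<Oplus>\<^bsub>L J\<^esub>j\<in>J. localize_frob p R (g J) (face J j c))"
    unfolding cech_diff_face[OF J] using fl face_frob[OF J _ c] F.map_closed by (intro LJ.M.finsum_cong') auto
  also have "\<dots> = localize_frob p R (g J) (d i c J)"
    unfolding cech_diff_face[OF J] using fl index_finite[OF J] by (intro F.map_finsum[symmetric]) auto
  finally show "d i (frob i c) J = frob (Suc i) (d i c) J" using J by (simp add: cech_frob_def)
qed (use c d.map_closed frob.map_closed in auto)

lemma d_d:
  assumes c: "c \<in> carrier (C i)"
  shows "d (Suc i) (d i c) = \<zero>\<^bsub>C (Suc (Suc i))\<^esub>"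
proof (rule C_ext)
  fix J assume J: "J \<in> I (Suc (Suc i))"
  interpret LJ: module R "L J" by (rule L_module[OF J])
  let ?M = "\<lambda>j k. localize_map R (g (J - {j})) (gs ! j)
    (localize_map R (g (J - {j} - {k})) (gs ! k) (c (J - {j} - {k})))"
  let ?a = "\<lambda>j k. (sign J j \<otimes> sign (J - {j}) k) \<odot>\<^bsub>L J\<^esub> ?M j k"
  have M_closed: "?M j k \<in> carrier (L J)" if "j \<in> J" "k \<in> J" "j \<noteq> k" for j k
    using semilinear_map.map_closed[OF localize_map_semilinear_index[OF J, of j]]
      semilinear_map.map_closed[OF localize_map_semilinear_index[OF index_remove[OF J], of j k]]
      C_nth[OF c] index_remove[OF index_remove[OF J]] that by simp
  have face_d: "face J j (d i c) = (\<Oplus>\<^bsub>L J\<^esub>k\<in>J - {j}. ?a j k)" if j: "j \<in> J" for j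
  proof -
    note J' = index_remove[OF J j]
    interpret m: semilinear_map R "L (J - {j})" R "L J" "\<lambda>r. r" "localize_map R (g (J - {j})) (gs ! j)"
      by (rule localize_map_semilinear_index[OF J j])
    have fl: "face (J - {j}) k c \<in> carrier (L (J - {j}))" if "k \<in> J - {j}" for k
      using semilinear_map.map_closed[OF face_semilinear[OF J']] that c by blast
    have "face J j (d i c) =
        sign J j \<odot>\<^bsub>L J\<^esub> (\<Oplus>\<^bsub>L J\<^esub>k\<in>J - {j}. localize_map R (g (J - {j})) (gs ! j) (face (J - {j}) k c))"
      unfolding face_def[of J] cech_diff_face[OF J'] using index_finite[OF J'] fl by (subst m.map_finsum) auto
    also have "\<dots> = (\<Oplus>\<^bsub>L J\<^esub>k\<in>J - {j}. sign J j \<odot>\<^bsub>L J\<^esub> localize_map R (g (J - {j})) (gs ! j) (face (J - {j}) k c))"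
      using index_finite[OF J'] fl m.map_closed sign_closed by (intro LJ.finsum_smult_ldistr) auto
    also have "\<dots> = (\<Oplus>\<^bsub>L J\<^esub>k\<in>J - {j}. ?a j k)"
    proof (intro LJ.M.finsum_cong' refl)
      fix k assume k: "k \<in> J - {j}"
      have "localize_map R (g (J - {j} - {k})) (gs ! k) (c (J - {j} - {k})) \<in> carrier (L (J - {j}))"
        using semilinear_map.map_closed[OF localize_map_semilinear_index[OF J' k]]
          C_nth[OF c] index_remove[OF J' k] by simp
      then show "sign J j \<odot>\<^bsub>L J\<^esub> localize_map R (g (J - {j})) (gs ! j) (face (J - {j}) k c) = ?a j k"
        using M_closed[OF j, of k] k sign_closed by (simp add: face_def m.map_smult LJ.smult_assoc1)
    qed (use j M_closed sign_closed in auto)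
    finally show ?thesis .
  qed
  have "d (Suc i) (d i c) J = (\<Oplus>\<^bsub>L J\<^esub>j\<in>J. \<Oplus>\<^bsub>L J\<^esub>k\<in>J - {j}. ?a j k)"
    unfolding cech_diff_face[OF J] using face_d M_closed sign_closed
    by (intro LJ.M.finsum_cong' LJ.M.finsum_closed) auto
  also have "\<dots> = \<zero>\<^bsub>L J\<^esub>"
  proof (rule LJ.M.finsum_antisymmetric)
    show "finite J" by (rule index_finite[OF J])
    fix j k assume jk: "j \<in> J" "k \<in> J" "j \<noteq> k"
    show "?a j k \<in> carrier (L J)" using M_closed[OF jk] sign_closed by simp
    have comm: "J - {k} - {j} = J - {j} - {k}" by auto
    have K: "J - {j} - {k} \<in> I i" using jk J index_remove by simp
    have 1: "g (J - {j}) = g (J - {j} - {k}) \<otimes> gs ! k"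
      using g_remove[of "J - {j}" "Suc i" k] index_remove[OF J] jk by simp
    have 2: "g (J - {k}) = g (J - {j} - {k}) \<otimes> gs ! j"
      using g_remove[of "J - {k}" "Suc i" j] index_remove[OF J] jk comm by simp
    have "?M j k = ?M k j"
      unfolding comm 1 2 using K jk gs_nth[OF J] C_nth[OF c K] g_closed by (intro localize_map_comp_commute) auto
    then have "?a j k \<oplus>\<^bsub>L J\<^esub> ?a k j =
        (sign J j \<otimes> sign (J - {j}) k \<oplus> sign J k \<otimes> sign (J - {k}) j) \<odot>\<^bsub>L J\<^esub> ?M j k"
      using M_closed[OF jk] sign_closed by (simp add: LJ.smult_l_distr)
    then show "?a j k \<oplus>\<^bsub>L J\<^esub> ?a k j = \<zero>\<^bsub>L J\<^esub>"
      using sign_antisymmetric[OF index_finite[OF J] jk] M_closed[OF jk] by simp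
  qed
  finally show "d (Suc i) (d i c) J = \<zero>\<^bsub>C (Suc (Suc i))\<^esub> J" using J by (simp add: zero_C)
qed (use c d.map_closed in auto)

abbreviation Z where "Z \<equiv> cech_cycles R gs"
abbreviation B where "B \<equiv> cech_boundaries R gs"

lemma Z_submodule: "submodule (Z i) R (C i)"
proof -
  have "submodule {\<zero>\<^bsub>C (Suc i)\<^esub>} R (C (Suc i))" by (intro C.submoduleI') auto
  from d.vimage_submodule[OF this] show ?thesis by (simp add: cech_cycles_def)
qed

lemma B_0: "B 0 = {\<zero>\<^bsub>C 0\<^esub>}" and B_Suc: "B (Suc i) = d i ` carrier (C i)"
  by (simp_all add: cech_boundaries_def)

lemma B_submodule: "submodule (B i) R (C i)"
proof (cases i)
  case 0
  have "submodule {\<zero>\<^bsub>C 0\<^esub>} R (C 0)" by (intro C.submoduleI') auto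
  then show ?thesis using 0 by (simp add: B_0)
next
  case (Suc k)
  then show ?thesis using d.image_submodule[OF C.carrier_is_submodule] by (simp add: B_Suc)
qed

lemma B_subset_Z: "B i \<subseteq> Z i"
  by (cases i) (auto simp: B_0 B_Suc cech_cycles_def d.map_zero d.map_closed d_d)

lemma frob_Z: "frob i ` Z i \<subseteq> Z i"
  using frob.map_closed frob.map_zero by (auto simp: cech_cycles_def d_frob)

lemma frob_B: "frob i ` B i \<subseteq> B i"
proof (cases i)
  case 0
  then show ?thesis by (simp add: B_0 frob.map_zero)
next
  case (Suc k)
  have "frob (Suc k) (d k c) \<in> d k ` carrier (C k)" if "c \<in> carrier (C k)" for c
    using that frob.map_closed by (simp add: d_frob[symmetric])
  then show ?thesis using Suc by (auto simp: B_Suc)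
qed

end

section \<open>Cech cohomology is torsion\<close>

lemma uniform_exponent:
  assumes "finite A" and "\<And>a. a \<in> A \<Longrightarrow> \<exists>n::nat. P a n"
    and mono: "\<And>a n m. a \<in> A \<Longrightarrow> P a n \<Longrightarrow> n \<le> m \<Longrightarrow> P a m"
  shows "\<exists>N. \<forall>a\<in>A. P a N"
proof -
  obtain n where n: "\<And>a. a \<in> A \<Longrightarrow> P a (n a)" using assms(2) by metis
  have "P a (\<Sum>b\<in>A. n b)" if "a \<in> A" for a
    using mono[OF that n[OF that]] member_le_sum[OF that, of n] assms(1) by simp
  then show ?thesis by blast
qed

context cech_complex begin

text \<open>
  Let \<open>j \<notin> J\<close>.  In the component of \<open>d e = 0\<close> at \<open>J \<union> {j}\<close> all faces but one contain the position
  \<open>j\<close> and vanish.  The remaining one is, up to sign, the image of \<open>e J\<close> in the localization at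
  \<open>g\<^sub>j\<close>, so \<open>e J\<close> is killed by a power of \<open>g\<^sub>j\<close>.
\<close>

lemma supported_cycle_torsion:
  assumes e: "e \<in> carrier (C i)" "d i e = \<zero>\<^bsub>C (Suc i)\<^esub>" and j: "j < length gs"
    and supp: "\<And>J. J \<in> I i \<Longrightarrow> j \<in> J \<Longrightarrow> e J = \<zero>\<^bsub>L J\<^esub>"
  shows "\<exists>n::nat. (gs ! j) [^] n \<odot>\<^bsub>C i\<^esub> e = \<zero>\<^bsub>C i\<^esub>"
proof -
  let ?t = "gs ! j"
  have t: "?t \<in> carrier R" using j gs_carrier by auto
  have "\<exists>N. \<forall>J\<in>I i. ?t [^] (N::nat) \<odot>\<^bsub>L J\<^esub> e J = \<zero>\<^bsub>L J\<^esub>"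
  proof (rule uniform_exponent[OF finite_index])
    fix J assume J: "J \<in> I i"
    interpret LJ: module R "L J" by (rule L_module[OF J])
    show "\<exists>n::nat. ?t [^] n \<odot>\<^bsub>L J\<^esub> e J = \<zero>\<^bsub>L J\<^esub>"
    proof (cases "j \<in> J")
      case True
      then show ?thesis using supp[OF J] t by auto
    next
      case False
      let ?K = "insert j J"
      have K: "?K \<in> I (Suc i)" by (rule index_insert[OF J j False])
      have KJ: "?K - {j} = J" using False by simp
      interpret LK: module R "L ?K" by (rule L_module[OF K])
      have fl: "face ?K k e \<in> carrier (L ?K)" if "k \<in> ?K" for k
        using semilinear_map.map_closed[OF face_semilinear[OF K that]] e by blast
      have face_zero: "face ?K k e = \<zero>\<^bsub>L ?K\<^esub>" if k: "k \<in> J" for k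
      proof -
        have kK: "k \<in> ?K" using k by simp
        have "j \<in> ?K - {k}" using k False by auto
        then have "e (?K - {k}) = \<zero>\<^bsub>L (?K - {k})\<^esub>" using supp index_remove[OF K kK] by blast
        then show ?thesis
          using semilinear_map.map_zero[OF localize_map_semilinear_index[OF K kK]] sign_closed
          by (simp add: face_def)
      qed
      have "\<zero>\<^bsub>L ?K\<^esub> = d i e ?K" using e(2) K by (simp add: zero_C)
      also have "\<dots> = face ?K j e \<oplus>\<^bsub>L ?K\<^esub> (\<Oplus>\<^bsub>L ?K\<^esub>k\<in>J. face ?K k e)"
        unfolding cech_diff_face[OF K] using False fl index_finite[OF J] by (intro LK.M.finsum_insert) auto
      also have "(\<Oplus>\<^bsub>L ?K\<^esub>k\<in>J. face ?K k e) = (\<Oplus>\<^bsub>L ?K\<^esub>k\<in>J. \<zero>\<^bsub>L ?K\<^esub>)"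
        using face_zero by (intro LK.M.finsum_cong') auto
      finally have face_j: "face ?K j e = \<zero>\<^bsub>L ?K\<^esub>" using fl[of j] by simp
      interpret m: localization_map R "g J" ?t
        using g_closed[OF J] t by (rule localization_mapI)
      have gK: "g ?K = g J \<otimes> ?t" using g_remove[OF K, of j] KJ by simp
      let ?m = "localize_map R (g J) ?t (e J)"
      have m: "?m \<in> carrier (L ?K)"
        using semilinear_map.map_closed[OF m.localize_map_semilinear] C_nth[OF e(1) J] gK by simp
      have "?m = (sign ?K j \<otimes> sign ?K j) \<odot>\<^bsub>L ?K\<^esub> ?m" using m by (simp add: sign_square)
      also have "\<dots> = sign ?K j \<odot>\<^bsub>L ?K\<^esub> face ?K j e"
        using m sign_closed KJ by (simp add: face_def LK.smult_assoc1)
      also have "\<dots> = \<zero>\<^bsub>L ?K\<^esub>" using face_j sign_closed by simp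
      finally show ?thesis using m.localize_map_eq_zero[of "e J"] C_nth[OF e(1) J] gK by simp
    qed
    fix n m :: nat assume "?t [^] n \<odot>\<^bsub>L J\<^esub> e J = \<zero>\<^bsub>L J\<^esub>" "n \<le> m"
    then show "?t [^] m \<odot>\<^bsub>L J\<^esub> e J = \<zero>\<^bsub>L J\<^esub>"
      using LJ.pow_smult_pow_smult[of ?t "e J" "m - n" n] t C_nth[OF e(1) J] by simp
  qed
  then obtain N :: nat where "\<forall>J\<in>I i. ?t [^] N \<odot>\<^bsub>L J\<^esub> e J = \<zero>\<^bsub>L J\<^esub>" by blast
  then have "?t [^] N \<odot>\<^bsub>C i\<^esub> e = \<zero>\<^bsub>C i\<^esub>" unfolding smult_C zero_C by (intro restrict_ext) blast
  then show ?thesis by blast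
qed

text \<open>
  After multiplication by a power of \<open>g\<^sub>j\<close>, a component \<open>c J\<close> with \<open>j \<in> J\<close> comes from the
  localization without \<open>g\<^sub>j\<close>.  The lifts form \<open>b\<close>, which is supported on the index sets without
  \<open>j\<close>, so only one face contributes to \<open>d b\<close> at \<open>J\<close>.
\<close>

lemma contracting_cochain:
  assumes c: "c \<in> carrier (C (Suc i))" and j: "j < length gs"
  shows "\<exists>N::nat. \<exists>b\<in>carrier (C i). \<forall>J\<in>I (Suc i). j \<in> J \<longrightarrow> d i b J = (gs ! j) [^] N \<odot>\<^bsub>L J\<^esub> c J"
proof -
  let ?t = "gs ! j"
  have t: "?t \<in> carrier R" using j gs_carrier by auto
  let ?m = "\<lambda>J. localize_map R (g (J - {j})) ?t"
  let ?A = "{J \<in> I (Suc i). j \<in> J}"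
  have m: "semilinear_map R (L (J - {j})) R (L J) (\<lambda>r. r) (?m J)" if "J \<in> ?A" for J
    using that localize_map_semilinear_index by auto
  have "\<exists>N. \<forall>J\<in>?A. \<exists>Y\<in>carrier (L (J - {j})). ?m J Y = ?t [^] (N::nat) \<odot>\<^bsub>L J\<^esub> c J"
  proof (rule uniform_exponent)
    show "finite ?A" using finite_index by simp
    fix J assume "J \<in> ?A"
    then have J: "J \<in> I (Suc i)" "j \<in> J" by auto
    interpret m: localization_map R "g (J - {j})" ?t
      using g_closed[OF index_remove[OF J]] t by (rule localization_mapI)
    show "\<exists>n. \<exists>Y\<in>carrier (L (J - {j})). ?m J Y = ?t [^] (n::nat) \<odot>\<^bsub>L J\<^esub> c J"
      using m.localize_map_lift[of "c J"] C_nth[OF c J(1)] unfolding g_remove[OF J, symmetric] by blast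
  next
    fix J and n n' :: nat assume J: "J \<in> ?A" and n: "n \<le> n'"
      and "\<exists>Y\<in>carrier (L (J - {j})). ?m J Y = ?t [^] n \<odot>\<^bsub>L J\<^esub> c J"
    then obtain Y where Y: "Y \<in> carrier (L (J - {j}))" "?m J Y = ?t [^] n \<odot>\<^bsub>L J\<^esub> c J" by blast
    interpret m: semilinear_map R "L (J - {j})" R "L J" "\<lambda>r. r" "?m J" by (rule m[OF J])
    have "?m J (?t [^] (n' - n) \<odot>\<^bsub>L (J - {j})\<^esub> Y) = ?t [^] n' \<odot>\<^bsub>L J\<^esub> c J"
      using Y(1) t n J C_nth[OF c, of J] m.N.pow_smult_pow_smult[of ?t "c J" "n' - n" n]
      by (simp add: m.map_smult Y(2))
    moreover have "?t [^] (n' - n) \<odot>\<^bsub>L (J - {j})\<^esub> Y \<in> carrier (L (J - {j}))" using Y t by simp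
    ultimately show "\<exists>Y\<in>carrier (L (J - {j})). ?m J Y = ?t [^] n' \<odot>\<^bsub>L J\<^esub> c J" by (rule bexI)
  qed
  then obtain N :: nat where
    "\<forall>J\<in>?A. \<exists>Y. Y \<in> carrier (L (J - {j})) \<and> ?m J Y = ?t [^] N \<odot>\<^bsub>L J\<^esub> c J"
    unfolding Bex_def by (rule exE)
  from bchoice[OF this] obtain Y where
    Y': "\<forall>J\<in>?A. Y J \<in> carrier (L (J - {j})) \<and> ?m J (Y J) = ?t [^] N \<odot>\<^bsub>L J\<^esub> c J"
    by (rule exE)
  have Y: "Y J \<in> carrier (L (J - {j}))" "?m J (Y J) = ?t [^] N \<odot>\<^bsub>L J\<^esub> c J" if "J \<in> ?A" for J
    using bspec[OF Y' that] by simp_all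
  define b where "b = (\<lambda>J\<in>I i. if j \<in> J then \<zero>\<^bsub>L J\<^esub>
    else sign (insert j J) j \<odot>\<^bsub>L J\<^esub> Y (insert j J))"
  have b: "b \<in> carrier (C i)"
    unfolding carrier_C
  proof (intro conjI ballI)
    show "b \<in> extensional (I i)" by (simp add: b_def)
    fix J assume J: "J \<in> I i"
    interpret LJ: module R "L J" by (rule L_module[OF J])
    show "b J \<in> carrier (L J)"
    proof (cases "j \<in> J")
      case True then show ?thesis using J by (simp add: b_def)
    next
      case False
      then show ?thesis
        using J Y(1)[of "insert j J"] index_insert[OF J j False] sign_closed by (simp add: b_def)
    qed
  qed
  have "d i b J = ?t [^] N \<odot>\<^bsub>L J\<^esub> c J" if J: "J \<in> I (Suc i)" "j \<in> J" for J
  proof -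
    have JA: "J \<in> ?A" using J by auto
    interpret LJ: module R "L J" by (rule L_module[OF J(1)])
    interpret m: semilinear_map R "L (J - {j})" R "L J" "\<lambda>r. r" "?m J" by (rule m[OF JA])
    have fl: "face J k b \<in> carrier (L J)" if "k \<in> J" for k
      using semilinear_map.map_closed[OF face_semilinear[OF J(1) that]] b by blast
    have face_zero: "face J k b = \<zero>\<^bsub>L J\<^esub>" if k: "k \<in> J - {j}" for k
    proof -
      have kJ: "k \<in> J" using k by simp
      have "b (J - {k}) = \<zero>\<^bsub>L (J - {k})\<^esub>"
        using k J index_remove[OF J(1) kJ] by (simp add: b_def)
      then show ?thesis
        using semilinear_map.map_zero[OF localize_map_semilinear_index[OF J(1) kJ]] sign_closed
        by (simp add: face_def)
    qed
    have "d i b J = (\<Oplus>\<^bsub>L J\<^esub>k\<in>insert j (J - {j}). face J k b)"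
      unfolding cech_diff_face[OF J(1)] using J(2) by (simp add: insert_absorb)
    also have "\<dots> = face J j b \<oplus>\<^bsub>L J\<^esub> (\<Oplus>\<^bsub>L J\<^esub>k\<in>J - {j}. face J k b)"
      using fl J index_finite[OF J(1)] by (intro LJ.M.finsum_insert) auto
    also have "(\<Oplus>\<^bsub>L J\<^esub>k\<in>J - {j}. face J k b) = (\<Oplus>\<^bsub>L J\<^esub>k\<in>J - {j}. \<zero>\<^bsub>L J\<^esub>)"
      using face_zero by (intro LJ.M.finsum_cong') auto
    also have "face J j b \<oplus>\<^bsub>L J\<^esub> (\<Oplus>\<^bsub>L J\<^esub>k\<in>J - {j}. \<zero>\<^bsub>L J\<^esub>) = face J j b" using fl[OF J(2)] by simp
    also have "\<dots> = sign J j \<odot>\<^bsub>L J\<^esub> ?m J (sign J j \<odot>\<^bsub>L (J - {j})\<^esub> Y J)"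
      using J index_remove[OF J] by (simp add: face_def b_def insert_absorb)
    also have "\<dots> = (sign J j \<otimes> sign J j) \<odot>\<^bsub>L J\<^esub> ?m J (Y J)"
      using Y(1)[OF JA] sign_closed m.map_closed by (simp add: m.map_smult LJ.smult_assoc1)
    also have "\<dots> = ?t [^] N \<odot>\<^bsub>L J\<^esub> c J"
      unfolding Y(2)[OF JA] sign_square using C_nth[OF c J(1)] t by simp
    finally show ?thesis .
  qed
  then show ?thesis using b by blast
qed

text \<open>
  After multiplication by a power of \<open>g\<^sub>j\<close>, subtracting the boundary of a contracting cochain leaves
  a cocycle supported on the index sets without \<open>j\<close>.
\<close>

lemma generator_torsion:
  assumes c: "c \<in> Z i" and j: "j < length gs"
  shows "\<exists>n::nat. (gs ! j) [^] n \<odot>\<^bsub>C i\<^esub> c \<in> B i"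
proof -
  let ?t = "gs ! j"
  have t: "?t \<in> carrier R" using j gs_carrier by auto
  have cC: "c \<in> carrier (C i)" and dc: "d i c = \<zero>\<^bsub>C (Suc i)\<^esub>" using c by (auto simp: cech_cycles_def)
  show ?thesis
  proof (cases i)
    case 0
    have "\<exists>n::nat. ?t [^] n \<odot>\<^bsub>C i\<^esub> c = \<zero>\<^bsub>C i\<^esub>"
      using 0 by (intro supported_cycle_torsion cC dc j) (auto simp: cech_index_def dest: finite_subset)
    then show ?thesis using 0 by (simp add: B_0)
  next
    case (Suc k)
    obtain N :: nat and b where b: "b \<in> carrier (C k)"
      "\<And>J. J \<in> I i \<Longrightarrow> j \<in> J \<Longrightarrow> d k b J = ?t [^] N \<odot>\<^bsub>L J\<^esub> c J"
      using contracting_cochain[OF _ j, of c k] cC Suc by metis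
    \<comment> \<open>The components of \<open>e\<close> at the index sets that contain \<open>j\<close> vanish by the choice of \<open>b\<close>.\<close>
    define e where "e = ?t [^] N \<odot>\<^bsub>C i\<^esub> c \<ominus>\<^bsub>C i\<^esub> d k b"
    have db: "d k b \<in> B i" using b Suc by (simp add: B_Suc)
    have "?t [^] N \<odot>\<^bsub>C i\<^esub> c \<in> Z i" using C.submoduleE(4)[OF Z_submodule] c t by simp
    then have eZ: "e \<in> Z i" unfolding e_def using db B_subset_Z C.submodule_minus[OF Z_submodule] by blast
    have dbC: "d k b \<in> carrier (C i)" using b d.map_closed Suc by blast
    have decomp: "?t [^] N \<odot>\<^bsub>C i\<^esub> c = d k b \<oplus>\<^bsub>C i\<^esub> e"
      using C.M.minus_eq_iff[of "?t [^] N \<odot>\<^bsub>C i\<^esub> c" i "d k b" e] eZ cC dbC t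
      by (auto simp: e_def cech_cycles_def)
    have "e J = \<zero>\<^bsub>L J\<^esub>" if J: "J \<in> I i" "j \<in> J" for J
    proof -
      interpret LJ: module R "L J" by (rule L_module[OF J(1)])
      have eJ: "e J \<in> carrier (L J)" using eZ J C_nth by (auto simp: cech_cycles_def)
      have "?t [^] N \<odot>\<^bsub>L J\<^esub> c J = d k b J \<oplus>\<^bsub>L J\<^esub> e J"
        using fun_cong[OF decomp, of J] J by (simp add: smult_C add_C)
      then show ?thesis using b(2)[OF J] eJ C_nth[OF dbC J(1)] LJ.M.add.l_cancel_one' by simp
    qed
    then obtain n :: nat where n: "?t [^] n \<odot>\<^bsub>C i\<^esub> e = \<zero>\<^bsub>C i\<^esub>"
      using supported_cycle_torsion[of e i j] eZ j unfolding cech_cycles_def by blast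
    have "?t [^] (n + N) \<odot>\<^bsub>C i\<^esub> c = ?t [^] n \<odot>\<^bsub>C i\<^esub> (d k b \<oplus>\<^bsub>C i\<^esub> e)"
      using C.pow_smult_pow_smult[of ?t c i n N] t cC decomp by simp
    also have "\<dots> = ?t [^] n \<odot>\<^bsub>C i\<^esub> d k b"
      using n dbC eZ t by (simp add: C.smult_r_distr cech_cycles_def)
    also have "\<dots> \<in> B i" using C.submoduleE(4)[OF B_submodule] db t by simp
    finally show ?thesis by blast
  qed
qed

text \<open>
  The ring elements that kill each cohomology class by some power form an ideal.  For sums, take
  exponents \<open>p\<^sup>e\<close>, since raising to the power \<open>p\<^sup>e\<close> is additive in characteristic \<open>p\<close>.
\<close>

theorem ideal_torsion:
  assumes r: "r \<in> Idl (set gs)" and c: "c \<in> Z i"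
  shows "\<exists>n::nat. r [^] n \<odot>\<^bsub>C i\<^esub> c \<in> B i"
proof -
  let ?A = "{r \<in> carrier R. \<forall>c\<in>Z i. \<exists>n::nat. r [^] n \<odot>\<^bsub>C i\<^esub> c \<in> B i}"
  have Zc: "c \<in> carrier (C i)" if "c \<in> Z i" for c using that by (simp add: cech_cycles_def)
  have Bsm: "r \<odot>\<^bsub>C i\<^esub> b \<in> B i" if "r \<in> carrier R" "b \<in> B i" for r b
    using C.submoduleE(4)[OF B_submodule] that by blast
  have mult: "s \<otimes> r \<in> ?A" if sr: "s \<in> carrier R" "r \<in> ?A" for r s
  proof (clarsimp, intro conjI ballI)
    show "s \<otimes> r \<in> carrier R" using sr by auto
    fix c assume c: "c \<in> Z i"
    then obtain n :: nat where n: "r [^] n \<odot>\<^bsub>C i\<^esub> c \<in> B i" using sr(2) by blast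
    have "(s \<otimes> r) [^] n \<odot>\<^bsub>C i\<^esub> c = s [^] n \<odot>\<^bsub>C i\<^esub> (r [^] n \<odot>\<^bsub>C i\<^esub> c)"
      using sr Zc[OF c] by (simp add: nat_pow_distrib C.smult_assoc1)
    also have "\<dots> \<in> B i" by (rule Bsm[OF _ n]) (use sr(1) in simp)
    finally show "\<exists>n::nat. (s \<otimes> r) [^] n \<odot>\<^bsub>C i\<^esub> c \<in> B i" by (rule exI)
  qed
  have add: "r \<oplus> s \<in> ?A" if rs: "r \<in> ?A" "s \<in> ?A" for r s
  proof (clarsimp, intro conjI ballI)
    show "r \<oplus> s \<in> carrier R" using rs by auto
    fix c assume c: "c \<in> Z i"
    have rsR: "r \<in> carrier R" "s \<in> carrier R" using rs by auto
    obtain n m :: nat where n: "r [^] n \<odot>\<^bsub>C i\<^esub> c \<in> B i" "s [^] m \<odot>\<^bsub>C i\<^esub> c \<in> B i" using rs c by blast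
    let ?e = "n + m"
    have "?e < p ^ ?e" using prime_gt_1_nat[OF prime] by (simp add: power_gt_expt)
    then have le: "n \<le> p ^ ?e" "m \<le> p ^ ?e" by auto
    have "r [^] (p ^ ?e) \<odot>\<^bsub>C i\<^esub> c \<in> B i" "s [^] (p ^ ?e) \<odot>\<^bsub>C i\<^esub> c \<in> B i"
      using Bsm[OF _ n(1), of "r [^] (p ^ ?e - n)"] Bsm[OF _ n(2), of "s [^] (p ^ ?e - m)"] rsR Zc[OF c] le
      by (simp_all add: C.pow_smult_pow_smult)
    then have "(r \<oplus> s) [^] (p ^ ?e) \<odot>\<^bsub>C i\<^esub> c \<in> B i"
      using rsR Zc[OF c] C.submoduleE(5)[OF B_submodule] by (simp add: frobenius_iterate_add C.smult_l_distr)
    then show "\<exists>n::nat. (r \<oplus> s) [^] n \<odot>\<^bsub>C i\<^esub> c \<in> B i" by blast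
  qed
  have zero: "\<zero> \<in> ?A"
  proof (clarsimp)
    fix c assume "c \<in> Z i"
    then have "\<zero> [^] (1::nat) \<odot>\<^bsub>C i\<^esub> c \<in> B i" using C.submodule_zero[OF B_submodule] Zc by simp
    then show "\<exists>n::nat. \<zero> [^] n \<odot>\<^bsub>C i\<^esub> c \<in> B i" by blast
  qed
  have "ideal ?A R"
  proof (rule idealI)
    show "ring R" by (rule ring_axioms)
    have "\<ominus> r \<in> ?A" if "r \<in> ?A" for r
      using mult[of "\<ominus> \<one>" r] that by (simp add: l_minus)
    then show "subgroup ?A (add_monoid R)"
      using add zero by (intro add.subgroupI) (auto simp: a_inv_def[symmetric])
    fix a s assume "a \<in> ?A" "s \<in> carrier R"
    then show "s \<otimes> a \<in> ?A" by (rule mult[rotated])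
    then show "a \<otimes> s \<in> ?A" using \<open>a \<in> ?A\<close> \<open>s \<in> carrier R\<close> m_comm[of a s] by simp
  qed
  moreover have "set gs \<subseteq> ?A"
    using generator_torsion gs_carrier by (auto simp: in_set_conv_nth)
  ultimately have "Idl (set gs) \<subseteq> ?A" by (rule genideal_minimal)
  then show ?thesis using r c by blast
qed

lemma C_regular:
  assumes x: "x \<in> carrier R" and reg: "\<And>a. a \<in> carrier R \<Longrightarrow> x \<otimes> a = \<zero> \<Longrightarrow> a = \<zero>"
    and u: "u \<in> carrier (C i)" and zero: "x \<odot>\<^bsub>C i\<^esub> u = \<zero>\<^bsub>C i\<^esub>"
  shows "u = \<zero>\<^bsub>C i\<^esub>"
proof (rule C_ext)
  fix J assume J: "J \<in> I i"
  interpret LJ: localization R "g J" using g_closed[OF J] by unfold_locales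
  have "x \<odot>\<^bsub>L J\<^esub> u J = \<zero>\<^bsub>L J\<^esub>" using fun_cong[OF zero, of J] J by (simp add: smult_C zero_C)
  then have "u J = \<zero>\<^bsub>L J\<^esub>" using LJ.regular_on_localization[OF x reg C_nth[OF u J]] by blast
  then show "u J = \<zero>\<^bsub>C i\<^esub> J" using J by (simp add: zero_C)
qed (use u in auto)

end

section \<open>Reduction modulo a regular element\<close>

lemma (in module) identity_semilinear: "semilinear_map R M R M (\<lambda>r. r) (\<lambda>u. u)"
  by unfold_locales auto

context cech_complex begin

sublocale cohomology: subquotient_presentation R "C i" R "C i" "\<lambda>r. r" "\<lambda>u. u" "\<lambda>r. r [^] p" "frob i"
  "Z i" "B i" "Z i" "B i" "frob i" for i
proof (intro subquotient_presentation.intro subquotient_presentation_axioms.intro)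
  show "semilinear_map R (C i) R (C i) (\<lambda>r. r) (\<lambda>u. u)" by (rule C.identity_semilinear)
  show "semilinear_map R (C i) R (C i) (\<lambda>r. r [^] p) (frob i)" by (rule frob_semilinear)
qed (use Z_submodule B_submodule B_subset_Z frob_Z frob_B in auto)

lemma local_cohomology_injective_iff:
  "injective_action (local_cohomology R gs i) (local_cohomology_frob p R gs i) \<longleftrightarrow>
    injective_on_subquotient (Z i) (B i) (frob i)"
  unfolding local_cohomology_def local_cohomology_frob_def by (rule cohomology.injective_iff)

lemma local_cohomology_full_iff:
  "full_action R (local_cohomology R gs i) (local_cohomology_frob p R gs i) \<longleftrightarrow>
    full_on_subquotient R (C i) (Z i) (B i) (frob i)"
  unfolding local_cohomology_def local_cohomology_frob_def by (rule cohomology.full_iff)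

lemma local_cohomology_anti_nilpotent_iff:
  "anti_nilpotent_action R (local_cohomology R gs i) (local_cohomology_frob p R gs i) \<longleftrightarrow>
    anti_nilpotent_on_subquotient R (C i) (Z i) (B i) (frob i)"
  unfolding local_cohomology_def local_cohomology_frob_def by (rule cohomology.anti_nilpotent_iff)

end

text \<open>
  The situation \<open>S = R / (x)\<close> with \<open>x\<close> regular and in the ideal of the Cech complex.
\<close>

locale regular_reduction = R: cech_complex R p gs + S: char_p_ring S p + \<sigma>: ring_hom_cring R S \<sigma>
  for R p gs S \<sigma> +
  fixes x
  assumes surj: "\<sigma> ` carrier R = carrier S"
    and kernel: "a \<in> carrier R \<Longrightarrow> \<sigma> a = \<zero>\<^bsub>S\<^esub> \<longleftrightarrow> (\<exists>b\<in>carrier R. a = x \<otimes>\<^bsub>R\<^esub> b)"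
    and x_ideal: "x \<in> Idl\<^bsub>R\<^esub> (set gs)"
    and regular: "a \<in> carrier R \<Longrightarrow> x \<otimes>\<^bsub>R\<^esub> a = \<zero>\<^bsub>R\<^esub> \<Longrightarrow> a = \<zero>\<^bsub>R\<^esub>"
begin

lemma x_closed: "x \<in> carrier R"
  using R.genideal_ideal[OF R.gs_carrier] x_ideal ideal.Icarr by metis

sublocale S: cech_complex S p "map \<sigma> gs"
  using R.gs_carrier by unfold_locales auto

lemma index_map: "S.I i = R.I i"
  by (simp add: cech_index_def)

lemma elem_map: "J \<in> R.I i \<Longrightarrow> S.g J = \<sigma> (R.g J)"
proof -
  assume J: "J \<in> R.I i"
  have "\<sigma> (R.g J) = (\<Otimes>\<^bsub>S\<^esub>j\<in>J. (\<sigma> \<circ> (!) gs) j)"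
    unfolding cech_elem_def using R.gs_nth[OF J] by (intro \<sigma>.hom_finprod) auto
  also have "\<dots> = S.g J"
    unfolding cech_elem_def using J R.gs_nth[OF J] by (intro S.finprod_cong') (auto simp: cech_index_def)
  finally show ?thesis by simp
qed

definition reduce where
  "reduce i c = (\<lambda>J\<in>R.I i. localize_hom S \<sigma> (R.g J) (c J))"

lemma localization_hom_index: "J \<in> R.I i \<Longrightarrow> localization_hom R S \<sigma> (R.g J)"
  using R.g_closed by (rule \<sigma>.localization_homI)

lemma localize_hom_index:
  assumes "J \<in> R.I i"
  shows "semilinear_map R (R.L J) S (S.L J) \<sigma> (localize_hom S \<sigma> (R.g J))"
  using localization_hom.localize_hom_semilinear[OF localization_hom_index[OF assms]] elem_map[OF assms] by simp

lemma reduce_semilinear: "semilinear_map R (R.C i) S (S.C i) \<sigma> (reduce i)"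
proof (intro semilinear_map.intro R.C_module S.C_module semilinear_map_axioms.intro)
  fix u v r assume u: "u \<in> carrier (R.C i)"
  note h = localize_hom_index[of _ i]
  show "reduce i u \<in> carrier (S.C i)"
    unfolding S.carrier_C using u semilinear_map.map_closed[OF h] by (simp add: reduce_def R.carrier_C index_map)
  show "reduce i (u \<oplus>\<^bsub>R.C i\<^esub> v) = reduce i u \<oplus>\<^bsub>S.C i\<^esub> reduce i v" if v: "v \<in> carrier (R.C i)"
    unfolding reduce_def S.add_C R.add_C index_map using u v
    by (intro restrict_ext) (simp add: R.carrier_C semilinear_map.map_add[OF h])
  show "reduce i (r \<odot>\<^bsub>R.C i\<^esub> u) = \<sigma> r \<odot>\<^bsub>S.C i\<^esub> reduce i u" if r: "r \<in> carrier R"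
    unfolding reduce_def S.smult_C R.smult_C index_map using u r
    by (intro restrict_ext) (simp add: R.carrier_C semilinear_map.map_smult[OF h])
qed auto

sublocale reduce: semilinear_map R "R.C i" S "S.C i" \<sigma> "reduce i" for i
  by (rule reduce_semilinear)

lemma reduce_surj:
  assumes u: "u \<in> carrier (S.C i)" shows "\<exists>w\<in>carrier (R.C i). reduce i w = u"
proof -
  have "\<forall>J\<in>R.I i. \<exists>Y. Y \<in> carrier (R.L J) \<and> localize_hom S \<sigma> (R.g J) Y = u J"
    using localization_hom.localize_hom_surj[OF localization_hom_index surj] S.C_nth[OF u] elem_map index_map
    by (metis (no_types, lifting))
  from bchoice[OF this] obtain Y where
    Y: "\<forall>J\<in>R.I i. Y J \<in> carrier (R.L J) \<and> localize_hom S \<sigma> (R.g J) (Y J) = u J" by (rule exE)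
  define w where "w = restrict Y (R.I i)"
  have w: "w \<in> carrier (R.C i)" using Y by (simp add: w_def R.carrier_C)
  moreover have "reduce i w = u"
  proof (rule S.C_ext)
    show "reduce i w \<in> carrier (S.C i)" using w by (rule reduce.map_closed)
  qed (use u Y in \<open>auto simp: reduce_def w_def index_map\<close>)
  ultimately show ?thesis by blast
qed

lemma sigma_x: "\<sigma> x = \<zero>\<^bsub>S\<^esub>"
  using kernel[OF x_closed] x_closed by (metis R.one_closed R.r_one)

lemma reduce_zero_iff:
  assumes w: "w \<in> carrier (R.C i)"
  shows "reduce i w = \<zero>\<^bsub>S.C i\<^esub> \<longleftrightarrow> (\<exists>v\<in>carrier (R.C i). w = x \<odot>\<^bsub>R.C i\<^esub> v)"
proof
  assume zero: "reduce i w = \<zero>\<^bsub>S.C i\<^esub>"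
  have "\<forall>J\<in>R.I i. \<exists>Y. Y \<in> carrier (R.L J) \<and> w J = x \<odot>\<^bsub>R.L J\<^esub> Y"
  proof
    fix J assume J: "J \<in> R.I i"
    have "localize_hom S \<sigma> (R.g J) (w J) = \<zero>\<^bsub>localize S (\<sigma> (R.g J))\<^esub>"
      using fun_cong[OF zero, of J] J elem_map[OF J] by (simp add: reduce_def S.zero_C index_map)
    from localization_hom.localize_hom_kernel[OF localization_hom_index[OF J] x_closed _ R.C_nth[OF w J] this]
    show "\<exists>Y. Y \<in> carrier (R.L J) \<and> w J = x \<odot>\<^bsub>R.L J\<^esub> Y" using kernel unfolding Bex_def by simp
  qed
  from bchoice[OF this] obtain Y where
    Y: "\<forall>J\<in>R.I i. Y J \<in> carrier (R.L J) \<and> w J = x \<odot>\<^bsub>R.L J\<^esub> Y J" by (rule exE)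
  define v where "v = restrict Y (R.I i)"
  have v: "v \<in> carrier (R.C i)" using Y by (simp add: v_def R.carrier_C)
  moreover have "w = x \<odot>\<^bsub>R.C i\<^esub> v"
  proof (rule R.C_ext)
    show "x \<odot>\<^bsub>R.C i\<^esub> v \<in> carrier (R.C i)" using v x_closed by simp
  qed (use w Y in \<open>auto simp: R.smult_C v_def\<close>)
  ultimately show "\<exists>v\<in>carrier (R.C i). w = x \<odot>\<^bsub>R.C i\<^esub> v" by blast
next
  assume "\<exists>v\<in>carrier (R.C i). w = x \<odot>\<^bsub>R.C i\<^esub> v"
  then show "reduce i w = \<zero>\<^bsub>S.C i\<^esub>"
    using x_closed sigma_x reduce.map_closed by (auto simp: reduce.map_smult)
qed

lemma reduce_face:
  assumes J: "J \<in> R.I (Suc i)" and j: "j \<in> J" and c: "c \<in> carrier (R.C i)"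
  shows "S.face J j (reduce i c) = localize_hom S \<sigma> (R.g J) (R.face J j c)"
proof -
  note J' = R.index_remove[OF J j]
  interpret h: semilinear_map R "R.L J" S "S.L J" \<sigma> "localize_hom S \<sigma> (R.g J)"
    by (rule localize_hom_index[OF J])
  interpret m: semilinear_map R "R.L (J - {j})" R "R.L J" "\<lambda>r. r" "localize_map R (R.g (J - {j})) (gs ! j)"
    by (rule R.localize_map_semilinear_index[OF J j])
  have jl: "j < length gs" using J j by (auto simp: cech_index_def)
  have s: "\<sigma> (R.sign J j) = S.sign J j"
    unfolding R.sign_def S.sign_def by (simp add: \<sigma>.ring.hom_nat_pow)
  have "localize_hom S \<sigma> (R.g J) (localize_map R (R.g (J - {j})) (gs ! j) (c (J - {j}))) =
    localize_map S (S.g (J - {j})) (map \<sigma> gs ! j) (localize_hom S \<sigma> (R.g (J - {j})) (c (J - {j})))"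
    using \<sigma>.localize_hom_map[OF R.g_closed[OF J'] R.gs_nth[OF J j] R.C_nth[OF c J']]
      R.g_remove[OF J j] elem_map[OF J'] jl by simp
  then show ?thesis
    unfolding R.face_def S.face_def using R.sign_closed m.map_closed R.C_nth[OF c J'] J'
    by (simp add: h.map_smult s reduce_def)
qed

lemma reduce_d:
  assumes c: "c \<in> carrier (R.C i)"
  shows "reduce (Suc i) (R.d i c) = S.d i (reduce i c)"
proof (rule S.C_ext)
  fix J assume "J \<in> S.I (Suc i)"
  then have J: "J \<in> R.I (Suc i)" and JS: "J \<in> S.I (Suc i)" by (simp_all add: index_map)
  interpret LJ: module S "S.L J" by (rule S.L_module[OF JS])
  interpret h: semilinear_map R "R.L J" S "S.L J" \<sigma> "localize_hom S \<sigma> (R.g J)"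
    by (rule localize_hom_index[OF J])
  have fl: "R.face J j c \<in> carrier (R.L J)" if "j \<in> J" for j
    using semilinear_map.map_closed[OF R.face_semilinear[OF J that]] c by blast
  have "S.d i (reduce i c) J = (\<Oplus>\<^bsub>S.L J\<^esub>j\<in>J. localize_hom S \<sigma> (R.g J) (R.face J j c))"
    unfolding S.cech_diff_face[OF JS] using fl reduce_face[OF J _ c] h.map_closed
    by (intro LJ.M.finsum_cong') auto
  also have "\<dots> = localize_hom S \<sigma> (R.g J) (R.d i c J)"
    unfolding R.cech_diff_face[OF J] using fl R.index_finite[OF J] by (intro h.map_finsum[symmetric]) auto
  finally show "reduce (Suc i) (R.d i c) J = S.d i (reduce i c) J" using J by (simp add: reduce_def)
qed (use c reduce.map_closed R.d.map_closed S.d.map_closed in auto)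

lemma reduce_frob:
  assumes c: "c \<in> carrier (R.C i)"
  shows "reduce i (R.frob i c) = S.frob i (reduce i c)"
  unfolding reduce_def cech_frob_def index_map
  by (intro restrict_ext)
    (simp add: \<sigma>.localize_hom_frob[OF R.char_p_ring_axioms S.char_p_ring_axioms R.g_closed R.C_nth[OF c]] elem_map)

text \<open>
  A cochain \<open>u\<close> with \<open>x u\<close> a cocycle is a cocycle because \<open>x\<close> is regular in the next degree; the
  torsion hypothesis holds because \<open>x\<close> lies in the ideal generated by \<open>gs\<close>.
\<close>

lemma deformation:
  "frobenius_deformation R (R.C k) (R.C (Suc k)) (R.d k) p (R.frob k) (R.frob (Suc k)) x (R.B k) (R.Z (Suc k))"
proof (intro frobenius_deformation.intro frobenius_deformation_axioms.intro R.d_semilinear R.frob_semilinear)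
  show "2 \<le> p" using R.prime prime_ge_2_nat by blast
  show "R.d k y = \<zero>\<^bsub>R.C (Suc k)\<^esub>" if "y \<in> R.B k" for y
    using that R.B_subset_Z by (auto simp: cech_cycles_def)
  show "R.d k c \<in> R.Z (Suc k)" if "c \<in> carrier (R.C k)" for c
    using that R.d.map_closed by (simp add: cech_cycles_def R.d_d)
  show "R.frob (Suc k) z \<in> R.Z (Suc k)" if "z \<in> R.Z (Suc k)" for z using that R.frob_Z by blast
  show "u \<in> R.Z (Suc k)" if u: "u \<in> carrier (R.C (Suc k))" "x \<odot>\<^bsub>R.C (Suc k)\<^esub> u \<in> R.Z (Suc k)" for u
  proof -
    have "x \<odot>\<^bsub>R.C (Suc (Suc k))\<^esub> R.d (Suc k) u = \<zero>\<^bsub>R.C (Suc (Suc k))\<^esub>"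
      using u x_closed by (simp add: cech_cycles_def R.d.map_smult)
    then have "R.d (Suc k) u = \<zero>\<^bsub>R.C (Suc (Suc k))\<^esub>"
      using R.C_regular[OF x_closed regular] R.d.map_closed[OF u(1)] by blast
    then show ?thesis using u by (simp add: cech_cycles_def)
  qed
  show "\<exists>n::nat. x [^]\<^bsub>R\<^esub> n \<odot>\<^bsub>R.C (Suc k)\<^esub> z \<in> R.d k ` carrier (R.C k)" if "z \<in> R.Z (Suc k)" for z
    using R.ideal_torsion[OF x_ideal that] by (simp add: R.B_Suc)
qed (use x_closed R.d_frob R.B_submodule R.Z_submodule R.C_regular[OF x_closed regular] in auto)

sublocale deform: frobenius_deformation R "R.C k" "R.C (Suc k)" "R.d k" p "R.frob k" "R.frob (Suc k)" x
  "R.B k" "R.Z (Suc k)" for k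
  by (rule deformation)

lemma reduce_Z_iff:
  assumes w: "w \<in> carrier (R.C k)"
  shows "reduce k w \<in> S.Z k \<longleftrightarrow> w \<in> deform.mod_cycles k"
  using w reduce.map_closed reduce_zero_iff[OF R.d.map_closed[OF w]]
  by (simp add: cech_cycles_def reduce_d[symmetric] deform.mod_cycles_def)

lemma mod_boundaries_carrier: "w \<in> deform.mod_boundaries k \<Longrightarrow> w \<in> carrier (R.C k)"
  using R.C.submoduleE(1)[OF R.B_submodule] x_closed by (auto simp: deform.mod_boundaries_def)

lemma S_B_reduce: "S.B k = reduce k ` R.B k"
proof (cases k)
  case 0
  then show ?thesis by (simp add: R.B_0 S.B_0 reduce.map_zero)
next
  case (Suc l)
  have "carrier (S.C l) = reduce l ` carrier (R.C l)"
    using reduce_surj reduce.map_closed by (auto simp: image_iff)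
  then show ?thesis using Suc by (simp add: R.B_Suc S.B_Suc image_image reduce_d cong: image_cong)
qed

text \<open>
  Coboundaries lift since \<open>reduce\<close> is onto in the previous degree, and its kernel in the present
  degree is \<open>x C\<close>.
\<close>

lemma reduce_B_iff:
  assumes w: "w \<in> carrier (R.C k)"
  shows "reduce k w \<in> S.B k \<longleftrightarrow> w \<in> deform.mod_boundaries k"
proof
  assume "reduce k w \<in> S.B k"
  then obtain y where y: "y \<in> R.B k" "reduce k w = reduce k y" unfolding S_B_reduce by blast
  have yC: "y \<in> carrier (R.C k)" using y R.C.submoduleE(1)[OF R.B_submodule] by blast
  have "reduce k (w \<ominus>\<^bsub>R.C k\<^esub> y) = \<zero>\<^bsub>S.C k\<^esub>"
    using w yC y(2) reduce.map_closed by (simp add: reduce.map_minus S.C.M.minus_eq_iff)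
  then obtain c where c: "c \<in> carrier (R.C k)" "w \<ominus>\<^bsub>R.C k\<^esub> y = x \<odot>\<^bsub>R.C k\<^esub> c"
    using reduce_zero_iff[of "w \<ominus>\<^bsub>R.C k\<^esub> y"] w yC by auto
  then have "w = y \<oplus>\<^bsub>R.C k\<^esub> x \<odot>\<^bsub>R.C k\<^esub> c" using w yC x_closed by (simp add: R.C.M.minus_eq_iff)
  then show "w \<in> deform.mod_boundaries k" using y c by (auto simp: deform.mod_boundaries_def)
next
  assume "w \<in> deform.mod_boundaries k"
  then obtain y c where y: "y \<in> R.B k" "c \<in> carrier (R.C k)" "w = y \<oplus>\<^bsub>R.C k\<^esub> x \<odot>\<^bsub>R.C k\<^esub> c"
    by (auto simp: deform.mod_boundaries_def)
  have yC: "y \<in> carrier (R.C k)" using y R.C.submoduleE(1)[OF R.B_submodule] by blast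
  have "reduce k w = reduce k y"
    using y yC x_closed sigma_x reduce.map_closed by (simp add: reduce.map_add reduce.map_smult)
  then show "reduce k w \<in> S.B k" using y S_B_reduce by auto
qed

lemma mod_cycles_carrier: "w \<in> deform.mod_cycles k \<Longrightarrow> w \<in> carrier (R.C k)"
  by (simp add: deform.mod_cycles_def)

text \<open>
  The cohomology of the quotient ring, presented by cochains of \<open>R\<close>.
\<close>

sublocale quotient: subquotient_presentation R "R.C k" S "S.C k" \<sigma> "reduce k" "\<lambda>r. r [^]\<^bsub>S\<^esub> p" "S.frob k"
  "deform.mod_cycles k" "deform.mod_boundaries k" "S.Z k" "S.B k" "R.frob k" for k
proof (intro subquotient_presentation.intro subquotient_presentation_axioms.intro reduce_semilinear
    S.frob_semilinear surj S.Z_submodule S.B_submodule S.B_subset_Z S.frob_Z S.frob_B)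
  have W_eq: "deform.mod_cycles k = {w \<in> carrier (R.C k). reduce k w \<in> S.Z k}"
    using reduce_Z_iff mod_cycles_carrier by blast
  show "submodule (deform.mod_cycles k) R (R.C k)"
    unfolding W_eq by (rule reduce.vimage_submodule[OF S.Z_submodule])
  show "reduce k ` deform.mod_cycles k = S.Z k"
  proof
    show "S.Z k \<subseteq> reduce k ` deform.mod_cycles k"
    proof
      fix z assume z: "z \<in> S.Z k"
      then obtain w where "w \<in> carrier (R.C k)" "reduce k w = z"
        using reduce_surj[of z k] by (auto simp: cech_cycles_def)
      then show "z \<in> reduce k ` deform.mod_cycles k" using z reduce_Z_iff by blast
    qed
  qed (auto simp: W_eq)
  show "reduce k w \<in> S.B k \<longleftrightarrow> w \<in> deform.mod_boundaries k" if "w \<in> deform.mod_cycles k" for w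
    using reduce_B_iff mod_cycles_carrier that by blast
  show "deform.mod_boundaries k \<subseteq> deform.mod_cycles k"
    using reduce_B_iff reduce_Z_iff mod_boundaries_carrier S.B_subset_Z by blast
  show "reduce k (R.frob k w) = S.frob k (reduce k w)" if "w \<in> deform.mod_cycles k" for w
    using reduce_frob mod_cycles_carrier that by blast
  show "R.frob k ` deform.mod_cycles k \<subseteq> deform.mod_cycles k"
    unfolding W_eq using S.frob_Z[of k, unfolded image_subset_iff] R.frob.map_closed by (auto simp: reduce_frob)
qed

lemma reduction_injective_iff:
  "injective_action (local_cohomology S (map \<sigma> gs) k) (local_cohomology_frob p S (map \<sigma> gs) k) \<longleftrightarrow>
    injective_on_subquotient (deform.mod_cycles k) (deform.mod_boundaries k) (R.frob k)"
  unfolding local_cohomology_def local_cohomology_frob_def by (rule quotient.injective_iff)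

lemma reduction_full_iff:
  "full_action S (local_cohomology S (map \<sigma> gs) k) (local_cohomology_frob p S (map \<sigma> gs) k) \<longleftrightarrow>
    full_on_subquotient R (R.C k) (deform.mod_cycles k) (deform.mod_boundaries k) (R.frob k)"
  unfolding local_cohomology_def local_cohomology_frob_def by (rule quotient.full_iff)

lemma reduction_anti_nilpotent_iff:
  "anti_nilpotent_action S (local_cohomology S (map \<sigma> gs) k) (local_cohomology_frob p S (map \<sigma> gs) k) \<longleftrightarrow>
    anti_nilpotent_on_subquotient R (R.C k) (deform.mod_cycles k) (deform.mod_boundaries k) (R.frob k)"
  unfolding local_cohomology_def local_cohomology_frob_def by (rule quotient.anti_nilpotent_iff)

text \<open>
  In degree 0 the only coboundary is zero, so the cocycles themselves are \<open>x\<close>-power torsion, while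
  \<open>x\<close> is regular.
\<close>

lemma Z_0: "R.Z 0 = {\<zero>\<^bsub>R.C 0\<^esub>}"
proof
  show "R.Z 0 \<subseteq> {\<zero>\<^bsub>R.C 0\<^esub>}"
  proof
    fix u assume u: "u \<in> R.Z 0"
    then have uC: "u \<in> carrier (R.C 0)" by (simp add: cech_cycles_def)
    obtain n :: nat where "x [^]\<^bsub>R\<^esub> n \<odot>\<^bsub>R.C 0\<^esub> u = \<zero>\<^bsub>R.C 0\<^esub>"
      using R.ideal_torsion[OF x_ideal u] by (auto simp: R.B_0)
    then have "u = \<zero>\<^bsub>R.C 0\<^esub>"
    proof (induction n)
      case 0 then show ?case using uC by simp
    next
      case (Suc n)
      have "x \<odot>\<^bsub>R.C 0\<^esub> (x [^]\<^bsub>R\<^esub> n \<odot>\<^bsub>R.C 0\<^esub> u) = \<zero>\<^bsub>R.C 0\<^esub>"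
        using Suc.prems uC x_closed R.C.pow_smult_pow_smult[of x u 0 1 n] by simp
      then have "x [^]\<^bsub>R\<^esub> n \<odot>\<^bsub>R.C 0\<^esub> u = \<zero>\<^bsub>R.C 0\<^esub>"
        using R.C_regular[OF x_closed regular] uC x_closed by (metis R.C.smult_closed R.nat_pow_closed)
      then show ?case by (rule Suc.IH)
    qed
    then show "u \<in> {\<zero>\<^bsub>R.C 0\<^esub>}" by simp
  qed
qed (use R.C.submodule_zero[OF R.Z_submodule] in auto)

theorem anti_nilpotent_lifts:
  assumes "\<And>k. anti_nilpotent_action S (local_cohomology S (map \<sigma> gs) k) (local_cohomology_frob p S (map \<sigma> gs) k)"
  shows "anti_nilpotent_action R (local_cohomology R gs i) (local_cohomology_frob p R gs i)"
proof (cases i)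
  case 0
  then show ?thesis
    unfolding R.local_cohomology_anti_nilpotent_iff
    by (auto simp: anti_nilpotent_on_subquotient_def injective_on_subquotient_def Z_0 R.B_0)
next
  case (Suc k)
  then show ?thesis
    using deform.anti_nilpotent assms
    by (simp add: R.local_cohomology_anti_nilpotent_iff reduction_anti_nilpotent_iff R.B_Suc)
qed

theorem full_lifts:
  assumes "\<And>k. full_action S (local_cohomology S (map \<sigma> gs) k) (local_cohomology_frob p S (map \<sigma> gs) k)"
  shows "full_action R (local_cohomology R gs i) (local_cohomology_frob p R gs i)"
proof (cases i)
  case 0
  then show ?thesis
    unfolding R.local_cohomology_full_iff by (auto simp: full_on_subquotient_def Z_0 R.B_0)
next
  case (Suc k)
  then show ?thesis
    using deform.full assms by (simp add: R.local_cohomology_full_iff reduction_full_iff R.B_Suc)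
qed

text \<open>
  Fullness in degree \<open>k - 1\<close> makes the cohomology of \<open>R\<close> in degree \<open>k\<close> divisible by \<open>x\<close>, which is
  the injectivity of the connecting map in degree \<open>k\<close>.
\<close>

theorem injective_lifts:
  assumes full: "\<And>k. full_action S (local_cohomology S (map \<sigma> gs) k) (local_cohomology_frob p S (map \<sigma> gs) k)"
    and inj: "\<And>k. injective_action (local_cohomology S (map \<sigma> gs) k) (local_cohomology_frob p S (map \<sigma> gs) k)"
  shows "injective_action (local_cohomology R gs i) (local_cohomology_frob p R gs i)"
proof (cases i)
  case 0
  then show ?thesis
    unfolding R.local_cohomology_injective_iff by (auto simp: injective_on_subquotient_def Z_0 R.B_0)
next
  case (Suc k)
  have cycles: "c \<in> deform.mod_boundaries k" if c: "c \<in> carrier (R.C k)" "R.d k c = \<zero>\<^bsub>R.C (Suc k)\<^esub>" for c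
  proof -
    have cZ: "c \<in> R.Z k" using c by (simp add: cech_cycles_def)
    have "\<exists>v\<in>carrier (R.C k). c \<ominus>\<^bsub>R.C k\<^esub> x \<odot>\<^bsub>R.C k\<^esub> v \<in> R.B k"
    proof (cases k)
      case 0
      then have "c \<ominus>\<^bsub>R.C k\<^esub> x \<odot>\<^bsub>R.C k\<^esub> \<zero>\<^bsub>R.C k\<^esub> \<in> R.B k"
        using cZ Z_0 x_closed by (simp add: R.B_0 R.C.M.minus_eq_iff)
      then show ?thesis by blast
    next
      case (Suc l)
      obtain v where "v \<in> R.Z (Suc l)" "c \<ominus>\<^bsub>R.C (Suc l)\<^esub> x \<odot>\<^bsub>R.C (Suc l)\<^esub> v \<in> R.B (Suc l)"
        using deform.divisible[of l c] full[of l] cZ Suc by (auto simp: reduction_full_iff R.B_Suc)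
      then show ?thesis using Suc deform.Z_carrier by blast
    qed
    then obtain v where v: "v \<in> carrier (R.C k)" "c \<ominus>\<^bsub>R.C k\<^esub> x \<odot>\<^bsub>R.C k\<^esub> v \<in> R.B k" by blast
    let ?y = "c \<ominus>\<^bsub>R.C k\<^esub> x \<odot>\<^bsub>R.C k\<^esub> v"
    have "c = x \<odot>\<^bsub>R.C k\<^esub> v \<oplus>\<^bsub>R.C k\<^esub> ?y"
      using R.C.M.minus_eq_iff[of c k "x \<odot>\<^bsub>R.C k\<^esub> v" ?y] c v x_closed by simp
    also have "\<dots> = ?y \<oplus>\<^bsub>R.C k\<^esub> x \<odot>\<^bsub>R.C k\<^esub> v" using c v x_closed by (intro R.C.M.a_comm) auto
    finally show ?thesis unfolding deform.mod_boundaries_def using v by blast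
  qed
  from deform.injective[OF _ cycles] inj show ?thesis
    using Suc by (simp add: R.local_cohomology_injective_iff reduction_injective_iff R.B_Suc)
qed

end

section \<open>Quotients of local rings\<close>

lemma (in noetherian_local_ring) max_ideal_eq: "max_ideal R = \<mm>"
  unfolding max_ideal_def using maximal unique_maximal by (rule the_equality)

lemma zero_FactRing: "\<zero>\<^bsub>R Quot I\<^esub> = I"
  by (simp add: FactRing_def)

lemma carrier_FactRing: "carrier (R Quot I) = (+>\<^bsub>R\<^esub>) I ` carrier R"
  by (auto simp: FactRing_def A_RCOSETS_def')

lemma (in ideal) image_coset_vimage:
  assumes J: "ideal J (R Quot I)"
  shows "(+>) I ` {r \<in> carrier R. I +> r \<in> J} = J"
proof
  show "J \<subseteq> (+>) I ` {r \<in> carrier R. I +> r \<in> J}"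
  proof
    fix y assume y: "y \<in> J"
    then have "y \<in> carrier (R Quot I)" by (rule ideal.Icarr[OF J])
    then obtain r where "r \<in> carrier R" "y = I +> r" unfolding carrier_FactRing by (rule imageE)
    then show "y \<in> (+>) I ` {r \<in> carrier R. I +> r \<in> J}" using y by simp
  qed
qed auto

lemma (in ideal) vimage_coset_image:
  assumes J: "ideal J R" and IJ: "I \<subseteq> J"
  shows "{r \<in> carrier R. I +> r \<in> (+>) I ` J} = J"
proof (intro subset_antisym subsetI)
  interpret J: ideal J R by fact
  fix r assume "r \<in> {r \<in> carrier R. I +> r \<in> (+>) I ` J}"
  then obtain s where s: "r \<in> carrier R" "s \<in> J" "I +> r = I +> s" by auto
  then have "r \<in> I +> s" using a_rcos_self by metis
  then obtain i where "i \<in> I" "r = i \<oplus> s" by (auto simp: a_r_coset_def')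
  then show "r \<in> J" using s(2) IJ by auto
qed (use ideal.Icarr[OF J] in auto)

context noetherian_local_ring begin

text \<open>
  Maximal ideals of the quotient pull back to maximal ideals of \<open>R\<close>, and there is only \<open>\<mm>\<close>.
\<close>

lemma max_ideal_quotient:
  assumes I: "ideal I R" and I_le: "I \<subseteq> \<mm>"
  shows "max_ideal (R Quot I) = (+>) I ` \<mm>"
proof -
  interpret I: ideal I R by fact
  interpret m: maximalideal \<mm> R by (rule maximal)
  interpret h: ring_hom_ring R "R Quot I" "(+>) I" by (rule I.rcos_ring_hom_ring)
  have carrier: "carrier (R Quot I) = (+>) I ` carrier R" by (rule carrier_FactRing)
  have pre: "ideal {r \<in> carrier R. I +> r \<in> J} R" "I \<subseteq> {r \<in> carrier R. I +> r \<in> J}"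
    if J: "ideal J (R Quot I)" for J
  proof -
    show "ideal {r \<in> carrier R. I +> r \<in> J} R" by (rule h.ideal_vimage[OF J])
    show "I \<subseteq> {r \<in> carrier R. I +> r \<in> J}"
    proof
      fix r assume r: "r \<in> I"
      have "I +> r = \<zero>\<^bsub>R Quot I\<^esub>" unfolding zero_FactRing by (rule I.a_rcos_const[OF r])
      also have "\<dots> \<in> J" by (rule additive_subgroup.zero_closed[OF ideal.axioms(1)[OF J]])
      finally show "r \<in> {r \<in> carrier R. I +> r \<in> J}" using I.Icarr[OF r] by simp
    qed
  qed
  have "maximalideal ((+>) I ` \<mm>) (R Quot I)"
  proof (rule maximalidealI)
    show "ideal ((+>) I ` \<mm>) (R Quot I)" by (rule ring_ideal_imp_quot_ideal[OF I m.ideal_axioms])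
    show "carrier (R Quot I) \<noteq> (+>) I ` \<mm>"
    proof
      assume "carrier (R Quot I) = (+>) I ` \<mm>"
      then have "{r \<in> carrier R. I +> r \<in> (+>) I ` \<mm>} = carrier R" using carrier by auto
      then show False using I.vimage_coset_image[OF m.ideal_axioms I_le] m.I_notcarr by simp
    qed
    fix J assume J: "ideal J (R Quot I)" "(+>) I ` \<mm> \<subseteq> J"
    let ?J = "{r \<in> carrier R. I +> r \<in> J}"
    have "?J = \<mm> \<or> ?J = carrier R"
      using J(2) m.Icarr by (intro m.I_maximal pre[OF J(1)]) auto
    then have "(+>) I ` ?J = (+>) I ` \<mm> \<or> (+>) I ` ?J = carrier (R Quot I)"
      unfolding carrier by (elim disjE) (simp_all only: simp_thms)
    then show "J = (+>) I ` \<mm> \<or> J = carrier (R Quot I)"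
      unfolding I.image_coset_vimage[OF J(1)] .
  qed
  moreover have "K = (+>) I ` \<mm>" if "maximalideal K (R Quot I)" for K
  proof -
    interpret K: maximalideal K "R Quot I" by fact
    let ?K = "{r \<in> carrier R. I +> r \<in> K}"
    note K_pre = pre[OF K.ideal_axioms] and K_image = I.image_coset_vimage[OF K.ideal_axioms]
    have "maximalideal ?K R"
    proof (rule maximalidealI)
      show "ideal ?K R" by (rule K_pre)
      show "carrier R \<noteq> ?K"
      proof
        assume eq: "carrier R = ?K"
        have "(+>) I ` carrier R = (+>) I ` ?K" using eq by (rule arg_cong)
        then have "(+>) I ` carrier R = K" unfolding K_image .
        then show False using K.I_notcarr carrier by simp
      qed
      fix J assume J: "ideal J R" "?K \<subseteq> J" "J \<subseteq> carrier R"
      have "K \<subseteq> (+>) I ` J" using image_mono[OF J(2), of "(+>) I"] K_image by simp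
      then have "(+>) I ` J = K \<or> (+>) I ` J = carrier (R Quot I)"
        using J(3) carrier by (intro K.I_maximal ring_ideal_imp_quot_ideal[OF I J(1)]) auto
      moreover have J_eq: "{r \<in> carrier R. I +> r \<in> (+>) I ` J} = J"
        using K_pre(2) J(2) by (intro I.vimage_coset_image[OF J(1)]) (rule subset_trans)
      moreover have "{r \<in> carrier R. I +> r \<in> carrier (R Quot I)} = carrier R"
        unfolding carrier by blast
      ultimately show "J = ?K \<or> J = carrier R"
        by (elim disjE) (simp_all only: simp_thms)
    qed
    then have "?K = \<mm>" by (rule unique_maximal)
    then show ?thesis using K_image by (simp only:)
  qed
  ultimately show ?thesis unfolding max_ideal_def by (rule the_equality)
qed

lemma generates_max_ideal_quotient:
  assumes I: "ideal I R" and I_le: "I \<subseteq> \<mm>" and gs: "generates_max_ideal R gs"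
  shows "generates_max_ideal (R Quot I) (map ((+>) I) gs)"
proof -
  interpret I: ideal I R by fact
  interpret h: ring_hom_ring R "R Quot I" "(+>) I" by (rule I.rcos_ring_hom_ring)
  have gs_carrier: "set gs \<subseteq> carrier R" and Idl: "Idl (set gs) = \<mm>"
    using gs by (auto simp: generates_max_ideal_def max_ideal_eq)
  have gs': "(+>) I ` set gs \<subseteq> carrier (R Quot I)" using gs_carrier by auto
  have ideal_m: "ideal \<mm> R" using maximal by (simp add: maximalideal_def)
  have "Idl\<^bsub>R Quot I\<^esub> ((+>) I ` set gs) \<subseteq> (+>) I ` \<mm>"
    using genideal_self[OF gs_carrier] Idl
    by (intro h.S.genideal_minimal ring_ideal_imp_quot_ideal I ideal_m) auto
  moreover have "\<mm> \<subseteq> {r \<in> carrier R. I +> r \<in> Idl\<^bsub>R Quot I\<^esub> ((+>) I ` set gs)}"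
    unfolding Idl[symmetric]
    using gs_carrier h.S.genideal_self[OF gs']
    by (intro genideal_minimal h.ideal_vimage h.S.genideal_ideal gs') auto
  ultimately show ?thesis
    using gs' max_ideal_quotient[OF I I_le] unfolding generates_max_ideal_def by auto
qed

lemma regular_reduction_quotient:
  assumes p: "prime p" "[p] \<cdot> \<one> = \<zero>" and x: "regular_element R \<mm> x" and gs: "generates_max_ideal R gs"
  shows "regular_reduction R p gs (R Quot (PIdl x)) ((+>) (PIdl x)) x"
proof -
  have gs_carrier: "set gs \<subseteq> carrier R" and Idl: "Idl (set gs) = \<mm>"
    using gs by (auto simp: generates_max_ideal_def max_ideal_eq)
  have xm: "x \<in> \<mm>" and reg: "\<And>a. a \<in> carrier R \<Longrightarrow> x \<otimes> a = \<zero> \<Longrightarrow> a = \<zero>"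
    using x by (auto simp: regular_element_def)
  have xR: "x \<in> carrier R"
    using xm maximal ideal.Icarr[of \<mm> R x] by (simp add: maximalideal_def)
  interpret I: ideal "PIdl x" R by (rule cgenideal_ideal[OF xR])
  interpret h: ring_hom_cring R "R Quot (PIdl x)" "(+>) (PIdl x)" by (rule I.rcos_ring_hom_cring[OF is_cring])
  have pow: "PIdl x +> [n] \<cdot> \<one> = [n] \<cdot>\<^bsub>R Quot (PIdl x)\<^esub> \<one>\<^bsub>R Quot (PIdl x)\<^esub>" for n :: nat
    by (induction n) auto
  show ?thesis
  proof (intro regular_reduction.intro cech_complex.intro cech_complex_axioms.intro
      char_p_ring.intro char_p_ring_axioms.intro regular_reduction_axioms.intro
      is_cring h.S.is_cring h.ring_hom_cring_axioms gs_carrier p)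
    show "[p] \<cdot>\<^bsub>R Quot (PIdl x)\<^esub> \<one>\<^bsub>R Quot (PIdl x)\<^esub> = \<zero>\<^bsub>R Quot (PIdl x)\<^esub>"
      using pow[of p] p(2) by simp
    show "(+>) (PIdl x) ` carrier R = carrier (R Quot (PIdl x))"
      by (rule carrier_FactRing[symmetric])
    show "x \<in> Idl (set gs)" using xm Idl by simp
    show "b = \<zero>" if "b \<in> carrier R" "x \<otimes> b = \<zero>" for b using reg that .
    fix a assume a: "a \<in> carrier R"
    have "PIdl x +> a = \<zero>\<^bsub>R Quot (PIdl x)\<^esub> \<longleftrightarrow> a \<in> PIdl x"
      unfolding zero_FactRing
      by (rule iffI, erule I.rcos_const_imp_mem[OF a], erule I.a_rcos_const)
    also have "\<dots> \<longleftrightarrow> (\<exists>b\<in>carrier R. a = x \<otimes> b)"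
      unfolding cgenideal_def Bex_def using m_comm[OF xR] by auto
    finally show "PIdl x +> a = \<zero>\<^bsub>R Quot (PIdl x)\<^esub> \<longleftrightarrow> (\<exists>b\<in>carrier R. a = x \<otimes> b)" .
  qed
qed

end

theorem theorem1p1:
  fixes R :: "('a, 'b) ring_scheme" and \<mm> :: "'a set" and p :: nat and x :: 'a
  assumes "noetherian_local_ring R \<mm>"
    and "prime p" and "[p] \<cdot>\<^bsub>R\<^esub> \<one>\<^bsub>R\<^esub> = \<zero>\<^bsub>R\<^esub>"
    and "regular_element R \<mm> x"
  shows "(F_anti_nilpotent p (R Quot (PIdl\<^bsub>R\<^esub> x)) \<longrightarrow> F_anti_nilpotent p R) \<and>
    (F_full p (R Quot (PIdl\<^bsub>R\<^esub> x)) \<longrightarrow> F_full p R) \<and>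
    (F_full p (R Quot (PIdl\<^bsub>R\<^esub> x)) \<and> F_injective p (R Quot (PIdl\<^bsub>R\<^esub> x)) \<longrightarrow>
      F_full p R \<and> F_injective p R)"
proof -
  interpret noetherian_local_ring R \<mm> by fact
  let ?S = "R Quot (PIdl\<^bsub>R\<^esub> x)"
  let ?red = "map ((+>\<^bsub>R\<^esub>) (PIdl\<^bsub>R\<^esub> x))"
  have xm: "x \<in> \<mm>" using assms(4) by (simp add: regular_element_def)
  have m: "ideal \<mm> R" using maximal by (simp add: maximalideal_def)
  have gen: "generates_max_ideal ?S (?red gs)" if "generates_max_ideal R gs" for gs
    using generates_max_ideal_quotient[OF cgenideal_ideal cgenideal_minimal[OF m xm] that]
      ideal.Icarr[OF m xm] by blast
  have red: "regular_reduction R p gs ?S ((+>\<^bsub>R\<^esub>) (PIdl\<^bsub>R\<^esub> x)) x" if "generates_max_ideal R gs" for gs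
    using regular_reduction_quotient assms(2-4) that by blast
  have anti: "F_anti_nilpotent p ?S \<longrightarrow> F_anti_nilpotent p R"
    using gen regular_reduction.anti_nilpotent_lifts[OF red] by (simp add: F_anti_nilpotent_def)
  have full: "F_full p ?S \<longrightarrow> F_full p R"
    using gen regular_reduction.full_lifts[OF red] by (simp add: F_full_def)
  have inj: "F_full p ?S \<and> F_injective p ?S \<longrightarrow> F_injective p R"
    using gen regular_reduction.injective_lifts[OF red] by (simp add: F_full_def F_injective_def)
  from anti full inj show ?thesis by blast
qed

end
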